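(* Let $R$ be a Cohen-Macaulay (Noetherian, commutative) local ring and let $I$ be a strongly Cohen-Macaulay ideal of $R$. Then $R/\operatorname{Ann}_R(I)$ is a maximal Cohen-Macaulay $R$-module.
   Context: For an ideal $I$ of $R$, $H_i(I,R)$ denotes the $i$-th homology module of the Koszul complex of $R$ with respect to a generating set of $I$. The ideal $I$ is called strongly Cohen-Macaulay if $H_i(I,R)$ is a Cohen-Macaulay $R$-module for all $i$ (this property does not depend on the choice of the finite generating set of $I$). A finitely generated $R$-module $M$ is Cohen-Macaulay if $M=0$ or $\operatorname{depth}_R M=\dim_R M$; it is maximal Cohen-Macaulay if $M=0$ or $\operatorname{depth}_R M=\dim R$. $\operatorname{Ann}_R(I)=(0:_R I)$ is the annihilator of $I$ in $R$. *)

theory Defs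
  imports "HOL-Library.Extended_Nat" "HOL-Algebra.Algebra"
begin

section \<open>Modules\<close>

text \<open>
  A module record of HOL-Algebra extends a ring record; the fields \<open>mult\<close> and \<open>one\<close> play no role
  for a module and are left \<open>undefined\<close> below.
\<close>

definition ring_module :: "('a, 'b) ring_scheme \<Rightarrow> ('a, 'a) module" where
  "ring_module R = \<lparr>carrier = carrier R, monoid.mult = undefined, one = undefined,
     ring.zero = \<zero>\<^bsub>R\<^esub>, add = add R, smult = monoid.mult R\<rparr>"

definition quot_module :: "('a, 'c, 'd) module_scheme \<Rightarrow> 'c set \<Rightarrow> ('a, 'c set) module" where
  "quot_module M N = \<lparr>carrier = a_rcosets\<^bsub>M\<^esub> N, monoid.mult = undefined, one = undefined,
     ring.zero = N, add = set_add M, smult = (\<lambda>a A. \<Union>x\<in>A. N +>\<^bsub>M\<^esub> (a \<odot>\<^bsub>M\<^esub> x))\<rparr>"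

definition gen_submodule ::
  "('a, 'b) ring_scheme \<Rightarrow> ('a, 'c, 'd) module_scheme \<Rightarrow> 'c set \<Rightarrow> 'c set" where
  "gen_submodule R M A = \<Inter>{N. submodule N R M \<and> A \<subseteq> N}"

definition fin_gen_module ::
  "('a, 'b) ring_scheme \<Rightarrow> ('a, 'c, 'd) module_scheme \<Rightarrow> bool" where
  "fin_gen_module R M \<longleftrightarrow>
     module R M \<and> (\<exists>A \<subseteq> carrier M. finite A \<and> gen_submodule R M A = carrier M)"

text \<open>\<open>annihilator R M N\<close> is \<open>(0 :\<^sub>R N)\<close> for a subset \<open>N\<close> of \<open>M\<close>.\<close>

definition annihilator ::
  "('a, 'b) ring_scheme \<Rightarrow> ('a, 'c, 'd) module_scheme \<Rightarrow> 'c set \<Rightarrow> 'a set" where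
  "annihilator R M N = {a \<in> carrier R. \<forall>x\<in>N. a \<odot>\<^bsub>M\<^esub> x = \<zero>\<^bsub>M\<^esub>}"


section \<open>Dimension\<close>

text \<open>
  With values in \<^typ>\<open>enat\<close> the zero ring and the zero module get dimension 0 instead of the
  customary negative value. The zero module is treated separately in the definition of
  Cohen-Macaulay modules, and local rings are nonzero, so this value is never used.
\<close>

definition krull_dim :: "('a, 'b) ring_scheme \<Rightarrow> enat" where
  "krull_dim R = Sup {enat n | n. \<exists>P :: nat \<Rightarrow> 'a set.
     (\<forall>i\<le>n. primeideal (P i) R) \<and> (\<forall>i<n. P i \<subset> P (Suc i))}"

definition module_dim ::
  "('a, 'b) ring_scheme \<Rightarrow> ('a, 'c, 'd) module_scheme \<Rightarrow> enat" where
  "module_dim R M = krull_dim (R Quot annihilator R M (carrier M))"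


section \<open>Regular sequences and depth\<close>

definition nonzerodivisor_on :: "('a, 'c, 'd) module_scheme \<Rightarrow> 'a \<Rightarrow> bool" where
  "nonzerodivisor_on M a \<longleftrightarrow> (\<forall>x\<in>carrier M. a \<odot>\<^bsub>M\<^esub> x = \<zero>\<^bsub>M\<^esub> \<longrightarrow> x = \<zero>\<^bsub>M\<^esub>)"

text \<open>The submodule \<open>(A)M\<close>, where \<open>(A)\<close> is the ideal generated by \<open>A\<close>.\<close>

definition ideal_mult_module ::
  "('a, 'b) ring_scheme \<Rightarrow> 'a set \<Rightarrow> ('a, 'c, 'd) module_scheme \<Rightarrow> 'c set" where
  "ideal_mult_module R A M =
     gen_submodule R M {a \<odot>\<^bsub>M\<^esub> x | a x. a \<in> Idl\<^bsub>R\<^esub> A \<and> x \<in> carrier M}"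

definition regular_sequence ::
  "('a, 'b) ring_scheme \<Rightarrow> ('a, 'c, 'd) module_scheme \<Rightarrow> 'a list \<Rightarrow> bool" where
  "regular_sequence R M xs \<longleftrightarrow>
     set xs \<subseteq> carrier R \<and>
     (\<forall>i<length xs.
        nonzerodivisor_on (quot_module M (ideal_mult_module R (set (take i xs)) M)) (xs ! i)) \<and>
     ideal_mult_module R (set xs) M \<noteq> carrier M"

locale noetherian_local_ring = noetherian_ring R + cring R for R (structure) +
  assumes unique_maximalideal: "\<exists>!m. maximalideal m R"

definition max_ideal :: "('a, 'b) ring_scheme \<Rightarrow> 'a set" where
  "max_ideal R = (THE m. maximalideal m R)"

definition depth :: "('a, 'b) ring_scheme \<Rightarrow> ('a, 'c, 'd) module_scheme \<Rightarrow> enat" where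
  "depth R M = Sup {enat (length xs) | xs. set xs \<subseteq> max_ideal R \<and> regular_sequence R M xs}"


section \<open>Cohen-Macaulay modules and rings\<close>

definition cohen_macaulay_module ::
  "('a, 'b) ring_scheme \<Rightarrow> ('a, 'c, 'd) module_scheme \<Rightarrow> bool" where
  "cohen_macaulay_module R M \<longleftrightarrow>
     fin_gen_module R M \<and> (carrier M = {\<zero>\<^bsub>M\<^esub>} \<or> depth R M = module_dim R M)"

definition maximal_cohen_macaulay_module ::
  "('a, 'b) ring_scheme \<Rightarrow> ('a, 'c, 'd) module_scheme \<Rightarrow> bool" where
  "maximal_cohen_macaulay_module R M \<longleftrightarrow>
     fin_gen_module R M \<and> (carrier M = {\<zero>\<^bsub>M\<^esub>} \<or> depth R M = krull_dim R)"

locale cohen_macaulay_local_ring = noetherian_local_ring +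
  assumes cohen_macaulay: "cohen_macaulay_module R (ring_module R)"


section \<open>Koszul homology\<close>

text \<open>
  For a sequence \<open>xs\<close> of length \<open>n\<close>, the \<open>i\<close>-th exterior power of \<open>R\<^sup>n\<close> is the free module on the
  basis elements \<open>e\<^sub>S\<close>, the wedge products over \<open>S\<close> in increasing order, for the \<open>i\<close>-element subsets
  \<open>S\<close> of \<open>{0, \<dots>, n - 1}\<close>; its elements are represented by their coefficient functions.
\<close>

definition koszul_basis :: "nat \<Rightarrow> nat \<Rightarrow> nat set set" where
  "koszul_basis n i = {S. S \<subseteq> {..<n} \<and> card S = i}"

definition koszul_module ::
  "('a, 'b) ring_scheme \<Rightarrow> 'a list \<Rightarrow> nat \<Rightarrow> ('a, nat set \<Rightarrow> 'a) module" where
  "koszul_module R xs i = (let B = koszul_basis (length xs) i in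
     \<lparr>carrier = B \<rightarrow>\<^sub>E carrier R, monoid.mult = undefined, one = undefined,
      ring.zero = (\<lambda>S\<in>B. \<zero>\<^bsub>R\<^esub>), add = (\<lambda>f g. \<lambda>S\<in>B. f S \<oplus>\<^bsub>R\<^esub> g S),
      smult = (\<lambda>a f. \<lambda>S\<in>B. a \<otimes>\<^bsub>R\<^esub> f S)\<rparr>)"

text \<open>
  \<open>koszul_diff R xs i\<close> is the differential from degree \<open>i + 1\<close> to degree \<open>i\<close>. It sends \<open>e\<^sub>S\<close> to the
  sum over \<open>j \<in> S\<close> of \<open>(-1)\<^sup>p x\<^sub>j e\<^bsub>S - {j}\<^esub>\<close>, where \<open>p\<close> is the number of elements of \<open>S\<close> below \<open>j\<close>. The
  coefficient of \<open>e\<^sub>T\<close> in the image of \<open>f\<close> thus collects the sets \<open>S = insert j T\<close> with \<open>j \<notin> T\<close>.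
\<close>

definition koszul_diff ::
  "('a, 'b) ring_scheme \<Rightarrow> 'a list \<Rightarrow> nat \<Rightarrow> (nat set \<Rightarrow> 'a) \<Rightarrow> (nat set \<Rightarrow> 'a)" where
  "koszul_diff R xs i f = (\<lambda>T\<in>koszul_basis (length xs) i.
     (\<Oplus>\<^bsub>R\<^esub>j \<in> {..<length xs} - T.
        (\<ominus>\<^bsub>R\<^esub> \<one>\<^bsub>R\<^esub>) [^]\<^bsub>R\<^esub> card {k \<in> T. k < j} \<otimes>\<^bsub>R\<^esub> (xs ! j) \<otimes>\<^bsub>R\<^esub> f (insert j T)))"

primrec koszul_cycles ::
  "('a, 'b) ring_scheme \<Rightarrow> 'a list \<Rightarrow> nat \<Rightarrow> (nat set \<Rightarrow> 'a) set" where
  "koszul_cycles R xs 0 = carrier (koszul_module R xs 0)"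
| "koszul_cycles R xs (Suc i) =
     a_kernel (koszul_module R xs (Suc i)) (koszul_module R xs i) (koszul_diff R xs i)"

definition koszul_boundaries ::
  "('a, 'b) ring_scheme \<Rightarrow> 'a list \<Rightarrow> nat \<Rightarrow> (nat set \<Rightarrow> 'a) set" where
  "koszul_boundaries R xs i = koszul_diff R xs i ` carrier (koszul_module R xs (Suc i))"

definition koszul_homology ::
  "('a, 'b) ring_scheme \<Rightarrow> 'a list \<Rightarrow> nat \<Rightarrow> ('a, (nat set \<Rightarrow> 'a) set) module" where
  "koszul_homology R xs i =
     quot_module ((koszul_module R xs i)\<lparr>carrier := koszul_cycles R xs i\<rparr>) (koszul_boundaries R xs i)"

text \<open>
  Whether all Koszul homology modules are Cohen-Macaulay does not depend on the generating
  sequence, so it is required for one of them.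
\<close>

definition strongly_cohen_macaulay :: "('a, 'b) ring_scheme \<Rightarrow> 'a set \<Rightarrow> bool" where
  "strongly_cohen_macaulay R I \<longleftrightarrow>
     (\<exists>xs. set xs \<subseteq> carrier R \<and> Idl\<^bsub>R\<^esub> (set xs) = I \<and>
        (\<forall>i. cohen_macaulay_module R (koszul_homology R xs i)))"

end

theory Submission
  imports Defs
begin

text \<open>
  Let \<open>d = dim R\<close>, let \<open>K\<close> be the Koszul complex of generators \<open>x\<^sub>1, \<dots>, x\<^sub>n\<close> of \<open>I\<close> with cycles
  \<open>Z\<^sub>i\<close>, boundaries \<open>B\<^sub>i\<close> and homology \<open>H\<^sub>i\<close>. If \<open>Ann I = 0\<close> there is nothing to prove. Otherwise
  some associated prime \<open>P = Ann s\<close> of \<open>R\<close> has \<open>s \<in> Ann I\<close>, so \<open>I \<subseteq> P\<close>, and \<open>dim R/P = d\<close>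
  because \<open>R\<close> is Cohen-Macaulay. By induction on \<open>n\<close> (mapping cone and Nakayama at \<open>P\<close>), every \<open>H\<^sub>i\<close>
  with \<open>i \<le> n\<close> has \<open>P\<close> in its support, so the Cohen-Macaulay module \<open>H\<^sub>i\<close> has depth \<open>d\<close>. Prime
  avoidance gives one sequence of length \<open>d\<close> that is regular on \<open>R\<close> and on every nonzero \<open>H\<^sub>i\<close>. Regularity
  of a fixed sequence passes to kernels of surjections, so starting from \<open>Z\<^sub>0 = K\<^sub>0\<close> it is inherited by
  all \<open>Z\<^sub>i\<close> and \<open>B\<^sub>i \<cong> K\<^bsub>i+1\<^esub>/Z\<^bsub>i+1\<^esub>\<close>, finally by \<open>K\<^sub>n/Z\<^sub>n \<cong> R/Ann I\<close>.
\<close>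

section \<open>Noetherian local rings and prime avoidance\<close>

text \<open>The depth lemma for short exact sequences is usually read off from Ext or local
  cohomology. Here one fixed sequence replaces it: if the sequence is regular on the middle and the
  right term, it is regular on the left one. All depths must therefore be realised simultaneously,
  which forces prime avoidance over all \<open>K_i\<close> and \<open>H_i\<close> at once. The price
  is that a first regular element must be exchangeable for any other without further loss of depth;
  this is proved by comparing socles. The depth of \<open>H_i\<close> comes from its dimension: if
  no element outside \<open>P\<close> kills \<open>H_i\<close>, then \<open>dim H_i\<close> is at
  least \<open>dim R/P\<close>, and Cohen-Macaulayness turns dimension into depth. The long chain of
  primes above \<open>P\<close> comes from a regular sequence on \<open>R\<close>, each element of
  which enlarges the prime. Localization is avoided: statements at \<open>P\<close> are statements
  up to a factor outside \<open>P\<close>. Subquotients are pairs of submodules of a fixed module,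
  and regularity is weak, so that intermediate quotients may vanish; Nakayama's lemma restores
  properness at the end.\<close>

lemma (in noetherian_ring) ideal_family_maximal:
  assumes "S \<noteq> {}" "\<And>J. J \<in> S \<Longrightarrow> ideal J R"
  shows "\<exists>J\<in>S. \<forall>K\<in>S. J \<subseteq> K \<longrightarrow> K = J"
proof (rule subset_Zorn_nonempty[OF assms(1)])
  fix C assume C: "C \<noteq> {}" "subset.chain S C"
  then have "subset.chain {J. ideal J R} C"
    using assms(2) by (auto simp: pred_on.chain_def)
  \<comment> \<open>In a Noetherian ring a nonempty chain of ideals contains its own union.\<close>
  from ideal_chain_is_trivial[OF C(1) this] C(2) show "\<Union>C \<in> S"
    by (auto simp: pred_on.chain_def)
qed

lemma (in noetherian_local_ring) maximalideal_max_ideal: "maximalideal (max_ideal R) R"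
  unfolding max_ideal_def using unique_maximalideal by (rule theI')

lemma (in noetherian_local_ring) primeideal_max_ideal: "primeideal (max_ideal R) R"
  by (rule maximalideal_prime[OF maximalideal_max_ideal])

lemma (in noetherian_local_ring) max_ideal_subset: "max_ideal R \<subseteq> carrier R"
  using primeideal_max_ideal
  by (meson additive_subgroup.a_subset ideal_def primeideal_def)

text \<open>If \<open>1\<close> were not a multiple of \<open>t\<close>, an ideal containing
  \<open>t\<close> and maximal among those without \<open>1\<close> would be a maximal ideal, hence
  the unique one, which \<open>t\<close> avoids.\<close>

lemma (in noetherian_local_ring) unit_if_not_in_max_ideal:
  assumes t: "t \<in> carrier R" "t \<notin> max_ideal R"
  shows "\<exists>s\<in>carrier R. s \<otimes> t = \<one>"
proof (rule ccontr)
  assume no: "\<not> ?thesis"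
  let ?S = "{J. ideal J R \<and> t \<in> J \<and> \<one> \<notin> J}"
  have "PIdl t \<in> ?S"
    using no t cgenideal_ideal[of t] cgenideal_self[of t] by (force simp: cgenideal_def)
  then obtain J where J: "J \<in> ?S" "\<forall>K\<in>?S. J \<subseteq> K \<longrightarrow> K = J"
    using ideal_family_maximal[of ?S] by blast
  have "maximalideal J R"
  proof (rule maximalidealI)
    show "ideal J R" "carrier R \<noteq> J" using J(1) by auto
    fix K assume K: "ideal K R" "J \<subseteq> K"
    show "K = J \<or> K = carrier R"
    proof (cases "\<one> \<in> K")
      case True then show ?thesis using ideal.one_imp_carrier[OF K(1)] by blast
    next
      case False then show ?thesis using J K by blast
    qed
  qed
  then have "J = max_ideal R" using unique_maximalideal maximalideal_max_ideal by blast
  with J(1) t(2) show False by blast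
qed

text \<open>Choose an element outside \<open>P\<close> from \<open>J\<close> and from each ideal in
  \<open>S\<close>: the product lies in all of these ideals, and primality keeps it outside
  \<open>P\<close>.\<close>

lemma (in cring) exists_in_ideals_not_in_prime:
  assumes "finite S" "\<And>Q. Q \<in> S \<Longrightarrow> ideal Q R \<and> \<not> Q \<subseteq> P"
    and J: "ideal J R" "\<not> J \<subseteq> P" and P: "primeideal P R"
  shows "\<exists>y\<in>J. y \<notin> P \<and> (\<forall>Q\<in>S. y \<in> Q)"
  using assms(1,2)
proof (induction S)
  case empty
  then show ?case using J(2) by auto
next
  case (insert Q S)
  then obtain y where y: "y \<in> J" "y \<notin> P" "\<forall>Q\<in>S. y \<in> Q" by auto
  obtain z where z: "z \<in> Q" "z \<notin> P" using insert.prems[of Q] by auto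
  have id: "ideal Q' R" if "Q' \<in> insert Q S" for Q' using insert.prems that by blast
  have c: "y \<in> carrier R" "z \<in> carrier R"
    using y z J(1) id[of Q] by (auto intro: ideal.Icarr)
  have "y \<otimes> z \<notin> P" using primeideal.I_prime[OF P c] y z by auto
  moreover have "y \<otimes> z \<in> J" using ideal.I_r_closed[OF J(1) y(1) c(2)] .
  moreover have "y \<otimes> z \<in> Q" using ideal.I_l_closed[OF id z(1) c(1)] by simp
  moreover have "y \<otimes> z \<in> Q'" if "Q' \<in> S" for Q'
    using ideal.I_r_closed[OF id _ c(2), of Q' y] y that by simp
  ultimately show ?case by auto
qed

lemma (in cring) prime_avoidance:
  assumes "finite S" "\<And>P. P \<in> S \<Longrightarrow> primeideal P R" "ideal J R"
    and "\<And>P. P \<in> S \<Longrightarrow> \<not> J \<subseteq> P"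
  shows "\<exists>x\<in>J. \<forall>P\<in>S. x \<notin> P"
  using assms
proof (induction "card S" arbitrary: S rule: less_induct)
  case less
  note J = less.prems(3)
  show ?case
  proof (cases "S = {}")
    case True
    then show ?thesis using additive_subgroup.zero_closed[OF ideal.axioms(1)[OF J]] by auto
  next
    case False
    show ?thesis
    proof (cases "\<exists>P\<in>S. \<exists>Q\<in>S. P \<noteq> Q \<and> Q \<subseteq> P")
      case True
      then obtain P Q where PQ: "P \<in> S" "Q \<in> S" "P \<noteq> Q" "Q \<subseteq> P" by auto
      have "card (S - {Q}) < card S" using PQ less.prems(1) by (intro card_Diff1_less)
      from less.hyps[OF this] less.prems obtain x where "x \<in> J" "\<forall>P\<in>S - {Q}. x \<notin> P" by auto
      then show ?thesis using PQ by blast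
    next
      case anti: False
      obtain P where P: "P \<in> S" using False by auto
      have "card (S - {P}) < card S" using P less.prems(1) by (intro card_Diff1_less)
      from less.hyps[OF this] less.prems obtain x where x: "x \<in> J" "\<forall>Q\<in>S - {P}. x \<notin> Q" by auto
      show ?thesis
      proof (cases "x \<in> P")
        case False then show ?thesis using x by blast
      next
        case True
        have idl: "ideal Q R" if "Q \<in> S" for Q using less.prems(2)[OF that] by (simp add: primeideal_def)
        obtain y where y: "y \<in> J" "y \<notin> P" "\<forall>Q\<in>S - {P}. y \<in> Q"
          using exists_in_ideals_not_in_prime[of "S - {P}" P J] less.prems P anti idl by blast
        have c: "x \<in> carrier R" "y \<in> carrier R" using x y J by (auto intro: ideal.Icarr)
        have sum: "v \<in> Q" if "ideal Q R" "u \<oplus> v \<in> Q" "u \<in> Q" "u \<in> carrier R" "v \<in> carrier R" for u v Q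
        proof -
          interpret I: ideal Q R by fact
          have "\<ominus> u \<oplus> (u \<oplus> v) \<in> Q" using that by auto
          then show ?thesis using that by (simp add: r_neg1 add.m_assoc[symmetric] l_neg)
        qed
        have "x \<oplus> y \<notin> P" using sum[of P x y] idl P True y c by auto
        moreover have "x \<oplus> y \<notin> Q" if "Q \<in> S - {P}" for Q
          using sum[of Q y x] idl x y c that by (auto simp: a_comm)
        moreover have "x \<oplus> y \<in> J" using x y J by (simp add: additive_subgroup.a_closed ideal_def)
        ultimately show ?thesis by blast
      qed
    qed
  qed
qed

section \<open>Regular sequences on subquotients\<close>

text \<open>
  A pair of submodules \<open>B \<subseteq> A\<close> of \<open>M\<close> stands for the module \<open>A / B\<close>. Then \<open>ext_sub M A B x\<close> is
  \<open>B + x A\<close>, and \<open>wreg\<close> is weak regularity: \<open>A / (B + x\<^sub>1 A + \<dots> + x\<^sub>k A)\<close> may vanish.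
\<close>

definition ext_sub :: "('a, 'c, 'd) module_scheme \<Rightarrow> 'c set \<Rightarrow> 'c set \<Rightarrow> 'a \<Rightarrow> 'c set" where
  "ext_sub M A B x = {u \<in> carrier M. \<exists>a\<in>A. u \<ominus>\<^bsub>M\<^esub> x \<odot>\<^bsub>M\<^esub> a \<in> B}"

definition nzd_mod :: "('a, 'c, 'd) module_scheme \<Rightarrow> 'c set \<Rightarrow> 'c set \<Rightarrow> 'a \<Rightarrow> bool" where
  "nzd_mod M A B x \<longleftrightarrow> (\<forall>u\<in>A. x \<odot>\<^bsub>M\<^esub> u \<in> B \<longrightarrow> u \<in> B)"

primrec wreg :: "('a, 'c, 'd) module_scheme \<Rightarrow> 'c set \<Rightarrow> 'c set \<Rightarrow> 'a list \<Rightarrow> bool" where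
  "wreg M A B [] \<longleftrightarrow> True"
| "wreg M A B (x # xs) \<longleftrightarrow> nzd_mod M A B x \<and> wreg M A (ext_sub M A B x) xs"

text \<open>This is the annihilator of the class of \<open>u\<close> in \<open>M / B\<close>. The
  prime ideals of this form with \<open>u\<close> in \<open>A\<close> are the associated primes of
  \<open>A / B\<close>.\<close>

definition colon :: "('a, 'b) ring_scheme \<Rightarrow> ('a, 'c, 'd) module_scheme \<Rightarrow> 'c set \<Rightarrow> 'c \<Rightarrow> 'a set" where
  "colon R M B u = {a \<in> carrier R. a \<odot>\<^bsub>M\<^esub> u \<in> B}"

context module
begin

section \<open>Arithmetic in modules and submodules\<close>

lemma smult_left_commute:
  "\<lbrakk>a \<in> carrier R; b \<in> carrier R; x \<in> carrier M\<rbrakk> \<Longrightarrow> a \<odot>\<^bsub>M\<^esub> (b \<odot>\<^bsub>M\<^esub> x) = b \<odot>\<^bsub>M\<^esub> (a \<odot>\<^bsub>M\<^esub> x)"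
  by (metis smult_assoc1 R.m_comm)

text \<open>Cancellation with another summand in between, a form that ordered rewriting of sums
  produces.\<close>

lemma minus_cancel_left:
  assumes "u \<in> carrier M" "v \<in> carrier M"
  shows "u \<oplus>\<^bsub>M\<^esub> (v \<oplus>\<^bsub>M\<^esub> \<ominus>\<^bsub>M\<^esub> u) = v" "\<ominus>\<^bsub>M\<^esub> u \<oplus>\<^bsub>M\<^esub> (v \<oplus>\<^bsub>M\<^esub> u) = v"
  using assms M.a_comm[of v] by (simp_all add: M.r_neg1 M.r_neg2)

lemma minus_zero_right [simp]: "u \<in> carrier M \<Longrightarrow> u \<ominus>\<^bsub>M\<^esub> \<zero>\<^bsub>M\<^esub> = u"
  using M.add.inv_one by (simp add: M.minus_eq)

lemmas module_simps = minus_cancel_left M.minus_eq R.minus_eq M.minus_add M.a_ac M.r_neg M.r_neg1 M.r_neg2 M.l_neg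
  smult_r_distr smult_r_minus smult_l_distr smult_l_minus smult_assoc1 smult_left_commute

lemma sub_carrier: "submodule N R M \<Longrightarrow> u \<in> N \<Longrightarrow> u \<in> carrier M"
  using submoduleE(1) by blast

lemma sub_add: "submodule N R M \<Longrightarrow> u \<in> N \<Longrightarrow> v \<in> N \<Longrightarrow> u \<oplus>\<^bsub>M\<^esub> v \<in> N"
  using submoduleE(5) by blast

lemma sub_neg: "submodule N R M \<Longrightarrow> u \<in> N \<Longrightarrow> \<ominus>\<^bsub>M\<^esub> u \<in> N"
  using submoduleE(3) by blast

lemma sub_minus: "submodule N R M \<Longrightarrow> u \<in> N \<Longrightarrow> v \<in> N \<Longrightarrow> u \<ominus>\<^bsub>M\<^esub> v \<in> N"
  by (simp add: M.minus_eq sub_add sub_neg)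

lemma sub_smult: "submodule N R M \<Longrightarrow> a \<in> carrier R \<Longrightarrow> u \<in> N \<Longrightarrow> a \<odot>\<^bsub>M\<^esub> u \<in> N"
  using submoduleE(4) by blast

lemma sub_zero: "submodule N R M \<Longrightarrow> \<zero>\<^bsub>M\<^esub> \<in> N"
proof -
  assume N: "submodule N R M"
  then obtain u where "u \<in> N" using submoduleE(2) by blast
  with N have "u \<ominus>\<^bsub>M\<^esub> u \<in> N" "u \<in> carrier M" using sub_minus sub_carrier by auto
  then show ?thesis by (simp add: M.minus_eq M.r_neg)
qed

lemma sub_minus_cancel:
  assumes "submodule N R M" "u \<ominus>\<^bsub>M\<^esub> v \<in> N" "v \<in> N" "u \<in> carrier M"
  shows "u \<in> N"
proof -
  have "v \<in> carrier M" using assms sub_carrier by blast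
  then have "u = (u \<ominus>\<^bsub>M\<^esub> v) \<oplus>\<^bsub>M\<^esub> v" using assms by (simp add: module_simps)
  then show ?thesis using assms sub_add by metis
qed

lemma sub_minus_cancel':
  assumes "submodule N R M" "u \<ominus>\<^bsub>M\<^esub> v \<in> N" "u \<in> N" "v \<in> carrier M"
  shows "v \<in> N"
proof -
  have "u \<in> carrier M" using assms sub_carrier by blast
  then have "v = u \<ominus>\<^bsub>M\<^esub> (u \<ominus>\<^bsub>M\<^esub> v)" using assms by (simp add: module_simps)
  then show ?thesis using assms sub_minus by metis
qed

text \<open>The set is \<open>N + C\<close>, phrased as congruence modulo \<open>C\<close>. In this
  form it covers both \<open>ext_sub\<close>, where \<open>N\<close> is \<open>x A\<close>, and the
  extension of a submodule by one element in the proof of Nakayama's lemma.\<close>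

lemma submodule_sum:
  assumes N: "submodule N R M" and C: "submodule C R M"
  shows "submodule {w \<in> carrier M. \<exists>n\<in>N. w \<ominus>\<^bsub>M\<^esub> n \<in> C} R M"
proof (rule submoduleI)
  note [simp, intro] = sub_carrier[OF N] sub_carrier[OF C]
  show "\<zero>\<^bsub>M\<^esub> \<in> {w \<in> carrier M. \<exists>n\<in>N. w \<ominus>\<^bsub>M\<^esub> n \<in> C}"
    using sub_zero[OF N] sub_zero[OF C] sub_minus[OF C]
    by (auto intro!: bexI[of _ "\<zero>\<^bsub>M\<^esub>"])
  fix w assume "w \<in> {w \<in> carrier M. \<exists>n\<in>N. w \<ominus>\<^bsub>M\<^esub> n \<in> C}"
  then obtain n where n: "w \<in> carrier M" "n \<in> N" "w \<ominus>\<^bsub>M\<^esub> n \<in> C" by auto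
  then have nc: "n \<in> carrier M" by auto
  have "\<ominus>\<^bsub>M\<^esub> (w \<ominus>\<^bsub>M\<^esub> n) = (\<ominus>\<^bsub>M\<^esub> w) \<ominus>\<^bsub>M\<^esub> (\<ominus>\<^bsub>M\<^esub> n)" using n nc by (simp add: module_simps)
  then have "(\<ominus>\<^bsub>M\<^esub> w) \<ominus>\<^bsub>M\<^esub> (\<ominus>\<^bsub>M\<^esub> n) \<in> C" using sub_neg[OF C n(3)] by simp
  then show "\<ominus>\<^bsub>M\<^esub> w \<in> {w \<in> carrier M. \<exists>n\<in>N. w \<ominus>\<^bsub>M\<^esub> n \<in> C}"
    using n sub_neg[OF N n(2)] by auto
  {
    fix a assume a: "a \<in> carrier R"
    have "a \<odot>\<^bsub>M\<^esub> (w \<ominus>\<^bsub>M\<^esub> n) = a \<odot>\<^bsub>M\<^esub> w \<ominus>\<^bsub>M\<^esub> a \<odot>\<^bsub>M\<^esub> n" using n nc a by (simp add: module_simps)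
    then have "a \<odot>\<^bsub>M\<^esub> w \<ominus>\<^bsub>M\<^esub> a \<odot>\<^bsub>M\<^esub> n \<in> C" using sub_smult[OF C a n(3)] by simp
    then show "a \<odot>\<^bsub>M\<^esub> w \<in> {w \<in> carrier M. \<exists>n\<in>N. w \<ominus>\<^bsub>M\<^esub> n \<in> C}"
      using n a sub_smult[OF N a n(2)] by auto
  }
  fix v assume "v \<in> {w \<in> carrier M. \<exists>n\<in>N. w \<ominus>\<^bsub>M\<^esub> n \<in> C}"
  then obtain k where k: "v \<in> carrier M" "k \<in> N" "v \<ominus>\<^bsub>M\<^esub> k \<in> C" by auto
  then have kc: "k \<in> carrier M" by auto
  have "(w \<ominus>\<^bsub>M\<^esub> n) \<oplus>\<^bsub>M\<^esub> (v \<ominus>\<^bsub>M\<^esub> k) = (w \<oplus>\<^bsub>M\<^esub> v) \<ominus>\<^bsub>M\<^esub> (n \<oplus>\<^bsub>M\<^esub> k)"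
    using n nc k kc by (simp add: module_simps)
  then have "(w \<oplus>\<^bsub>M\<^esub> v) \<ominus>\<^bsub>M\<^esub> (n \<oplus>\<^bsub>M\<^esub> k) \<in> C" using sub_add[OF C n(3) k(3)] by simp
  then show "w \<oplus>\<^bsub>M\<^esub> v \<in> {w \<in> carrier M. \<exists>n\<in>N. w \<ominus>\<^bsub>M\<^esub> n \<in> C}"
    using n k sub_add[OF N n(2) k(2)] by auto
qed auto

lemma submodule_smult_image:
  assumes A: "submodule A R M" and x: "x \<in> carrier R"
  shows "submodule ((\<lambda>a. x \<odot>\<^bsub>M\<^esub> a) ` A) R M"
proof (rule submoduleI)
  note A' = sub_carrier[OF A]
  show "(\<lambda>a. x \<odot>\<^bsub>M\<^esub> a) ` A \<subseteq> carrier M" using A' x by auto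
  show "\<zero>\<^bsub>M\<^esub> \<in> (\<lambda>a. x \<odot>\<^bsub>M\<^esub> a) ` A"
    using sub_zero[OF A] x by (auto intro!: image_eqI[of _ _ "\<zero>\<^bsub>M\<^esub>"])
  fix u assume "u \<in> (\<lambda>a. x \<odot>\<^bsub>M\<^esub> a) ` A"
  then obtain a where a: "a \<in> A" "u = x \<odot>\<^bsub>M\<^esub> a" by auto
  show "\<ominus>\<^bsub>M\<^esub> u \<in> (\<lambda>a. x \<odot>\<^bsub>M\<^esub> a) ` A"
    using a x A' sub_neg[OF A a(1)] by (auto intro!: image_eqI[of _ _ "\<ominus>\<^bsub>M\<^esub> a"] simp: smult_r_minus)
  show "b \<odot>\<^bsub>M\<^esub> u \<in> (\<lambda>a. x \<odot>\<^bsub>M\<^esub> a) ` A" if "b \<in> carrier R" for b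
    using a x A' sub_smult[OF A that a(1)] that
    by (auto intro!: image_eqI[of _ _ "b \<odot>\<^bsub>M\<^esub> a"] simp: smult_left_commute)
  fix v assume "v \<in> (\<lambda>a. x \<odot>\<^bsub>M\<^esub> a) ` A"
  then obtain b where b: "b \<in> A" "v = x \<odot>\<^bsub>M\<^esub> b" by auto
  show "u \<oplus>\<^bsub>M\<^esub> v \<in> (\<lambda>a. x \<odot>\<^bsub>M\<^esub> a) ` A"
    using a b x A' sub_add[OF A a(1) b(1)]
    by (auto intro!: image_eqI[of _ _ "a \<oplus>\<^bsub>M\<^esub> b"] simp: smult_r_distr)
qed

lemma submodule_cyclic:
  assumes z: "z \<in> carrier M"
  shows "submodule ((\<lambda>r. r \<odot>\<^bsub>M\<^esub> z) ` carrier R) R M"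
proof (rule submoduleI)
  show "\<zero>\<^bsub>M\<^esub> \<in> (\<lambda>r. r \<odot>\<^bsub>M\<^esub> z) ` carrier R"
    using z by (auto intro!: image_eqI[of _ _ "\<zero>\<^bsub>R\<^esub>"])
  fix u assume "u \<in> (\<lambda>r. r \<odot>\<^bsub>M\<^esub> z) ` carrier R"
  then obtain a where a: "a \<in> carrier R" "u = a \<odot>\<^bsub>M\<^esub> z" by auto
  show "\<ominus>\<^bsub>M\<^esub> u \<in> (\<lambda>r. r \<odot>\<^bsub>M\<^esub> z) ` carrier R"
    using a z by (auto intro!: image_eqI[of _ _ "\<ominus>\<^bsub>R\<^esub> a"] simp: smult_l_minus)
  show "b \<odot>\<^bsub>M\<^esub> u \<in> (\<lambda>r. r \<odot>\<^bsub>M\<^esub> z) ` carrier R" if "b \<in> carrier R" for b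
    using a z that by (auto intro!: image_eqI[of _ _ "b \<otimes>\<^bsub>R\<^esub> a"] simp: smult_assoc1)
  fix v assume "v \<in> (\<lambda>r. r \<odot>\<^bsub>M\<^esub> z) ` carrier R"
  then obtain b where b: "b \<in> carrier R" "v = b \<odot>\<^bsub>M\<^esub> z" by auto
  show "u \<oplus>\<^bsub>M\<^esub> v \<in> (\<lambda>r. r \<odot>\<^bsub>M\<^esub> z) ` carrier R"
    using a b z by (auto intro!: image_eqI[of _ _ "a \<oplus>\<^bsub>R\<^esub> b"] simp: smult_l_distr)
qed (use z in auto)

lemma submodule_ext_sub:
  assumes "submodule A R M" "submodule B R M" "x \<in> carrier R"
  shows "submodule (ext_sub M A B x) R M"
  using submodule_sum[OF submodule_smult_image[OF assms(1,3)] assms(2)]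
  by (simp add: ext_sub_def)

lemma ext_subI:
  assumes "submodule B R M" "a \<in> A" "u \<in> carrier M" "u \<ominus>\<^bsub>M\<^esub> x \<odot>\<^bsub>M\<^esub> a \<in> B"
  shows "u \<in> ext_sub M A B x"
  using assms by (auto simp: ext_sub_def)

lemma ext_sub_superset:
  assumes "submodule A R M" "submodule B R M" "x \<in> carrier R"
  shows "B \<subseteq> ext_sub M A B x"
proof
  fix b assume b: "b \<in> B"
  then have "b \<ominus>\<^bsub>M\<^esub> x \<odot>\<^bsub>M\<^esub> \<zero>\<^bsub>M\<^esub> = b" using assms(2,3) sub_carrier by (simp add: M.minus_eq)
  then show "b \<in> ext_sub M A B x"
    using ext_subI[OF assms(2) sub_zero[OF assms(1)]] b assms(2) sub_carrier by metis
qed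

lemma smult_in_ext_sub:
  assumes "submodule A R M" "submodule B R M" "x \<in> carrier R" "a \<in> A"
  shows "x \<odot>\<^bsub>M\<^esub> a \<in> ext_sub M A B x"
  using assms sub_carrier[OF assms(1)] sub_zero[OF assms(2)]
  by (intro ext_subI[of B a]) (auto simp: M.minus_eq M.r_neg)

lemma ext_sub_subset:
  assumes "submodule A R M" "submodule B R M" "x \<in> carrier R" "B \<subseteq> A"
  shows "ext_sub M A B x \<subseteq> A"
proof
  fix u assume "u \<in> ext_sub M A B x"
  then obtain a where "u \<in> carrier M" "a \<in> A" "u \<ominus>\<^bsub>M\<^esub> x \<odot>\<^bsub>M\<^esub> a \<in> B" by (auto simp: ext_sub_def)
  then show "u \<in> A" using sub_minus_cancel[OF assms(1)] sub_smult assms by blast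
qed

lemma ext_sub_commute_subset:
  assumes A: "submodule A R M" and B: "submodule B R M" and xy: "x \<in> carrier R" "y \<in> carrier R"
  shows "ext_sub M A (ext_sub M A B x) y \<subseteq> ext_sub M A (ext_sub M A B y) x"
proof
  fix u assume "u \<in> ext_sub M A (ext_sub M A B x) y"
  then obtain a b where u: "u \<in> carrier M" "a \<in> A" "b \<in> A"
    "u \<ominus>\<^bsub>M\<^esub> y \<odot>\<^bsub>M\<^esub> a \<ominus>\<^bsub>M\<^esub> x \<odot>\<^bsub>M\<^esub> b \<in> B" by (auto simp: ext_sub_def)
  have c: "a \<in> carrier M" "b \<in> carrier M" using u sub_carrier[OF A] by auto
  have "u \<ominus>\<^bsub>M\<^esub> y \<odot>\<^bsub>M\<^esub> a \<ominus>\<^bsub>M\<^esub> x \<odot>\<^bsub>M\<^esub> b = u \<ominus>\<^bsub>M\<^esub> x \<odot>\<^bsub>M\<^esub> b \<ominus>\<^bsub>M\<^esub> y \<odot>\<^bsub>M\<^esub> a"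
    using u c xy by (simp add: module_simps)
  then show "u \<in> ext_sub M A (ext_sub M A B y) x"
    using u c xy by (auto simp: ext_sub_def)
qed

lemma ext_sub_commute:
  assumes "submodule A R M" "submodule B R M" "x \<in> carrier R" "y \<in> carrier R"
  shows "ext_sub M A (ext_sub M A B x) y = ext_sub M A (ext_sub M A B y) x"
  using ext_sub_commute_subset[OF assms] ext_sub_commute_subset[OF assms(1,2,4,3)] by auto

text \<open>The hypotheses say that \<open>h\<close> induces an isomorphism of \<open>A / B\<close>
  with \<open>A' / B'\<close>: \<open>ker\<close> gives that it is well defined and injective,
  \<open>surj\<close> that it is onto. Both persist when \<open>B\<close> and \<open>B'\<close> are
  enlarged by \<open>x A\<close> and \<open>x A'\<close>, so the induction keeps \<open>h\<close>,
  \<open>A\<close> and \<open>A'\<close> fixed.\<close>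

lemma wreg_transport:
  assumes M': "module R M'" and A: "submodule A R M" and A': "submodule A' R M'"
    and B: "submodule B R M" "submodule B' R M'" and xs: "set xs \<subseteq> carrier R"
    and closed: "\<And>u. u \<in> A \<Longrightarrow> h u \<in> A'"
    and add: "\<And>u v. u \<in> A \<Longrightarrow> v \<in> A \<Longrightarrow> h (u \<oplus>\<^bsub>M\<^esub> v) = h u \<oplus>\<^bsub>M'\<^esub> h v"
    and smult: "\<And>a u. a \<in> carrier R \<Longrightarrow> u \<in> A \<Longrightarrow> h (a \<odot>\<^bsub>M\<^esub> u) = a \<odot>\<^bsub>M'\<^esub> h u"
    and ker: "\<And>u. u \<in> A \<Longrightarrow> h u \<in> B' \<longleftrightarrow> u \<in> B"
    and surj: "\<And>w. w \<in> A' \<Longrightarrow> \<exists>u\<in>A. w \<ominus>\<^bsub>M'\<^esub> h u \<in> B'"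
  shows "wreg M A B xs \<longleftrightarrow> wreg M' A' B' xs"
  using xs B ker surj
proof (induction xs arbitrary: B B')
  case Nil
  then show ?case by simp
next
  case (Cons x xs)
  interpret M': module R M' by fact
  note B = Cons.prems(2,3) note ker = Cons.prems(4) note surj = Cons.prems(5)
  have x: "x \<in> carrier R" using Cons.prems(1) by simp
  note hc = M'.sub_carrier[OF A' closed]
  have minus: "h (u \<ominus>\<^bsub>M\<^esub> v) = h u \<ominus>\<^bsub>M'\<^esub> h v" if uv: "u \<in> A" "v \<in> A" for u v
  proof -
    have "u \<ominus>\<^bsub>M\<^esub> v = u \<oplus>\<^bsub>M\<^esub> (\<ominus>\<^bsub>R\<^esub> \<one>\<^bsub>R\<^esub>) \<odot>\<^bsub>M\<^esub> v"
      using uv sub_carrier[OF A] by (simp add: smult_l_minus M.minus_eq)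
    then show ?thesis
      using uv hc[OF uv(2)] add[OF uv(1) sub_smult[OF A _ uv(2)]] smult[OF _ uv(2)]
      by (simp add: M'.smult_l_minus M'.M.minus_eq)
  qed
  have "nzd_mod M A B x \<longleftrightarrow> nzd_mod M' A' B' x"
  proof
    assume n: "nzd_mod M A B x"
    show "nzd_mod M' A' B' x" unfolding nzd_mod_def
    proof (intro ballI impI)
      fix w assume w: "w \<in> A'" "x \<odot>\<^bsub>M'\<^esub> w \<in> B'"
      obtain u where u: "u \<in> A" "w \<ominus>\<^bsub>M'\<^esub> h u \<in> B'" using surj w(1) by blast
      have wc: "w \<in> carrier M'" using w M'.sub_carrier[OF A'] by blast
      have "x \<odot>\<^bsub>M'\<^esub> w \<ominus>\<^bsub>M'\<^esub> x \<odot>\<^bsub>M'\<^esub> h u = x \<odot>\<^bsub>M'\<^esub> (w \<ominus>\<^bsub>M'\<^esub> h u)"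
        using wc hc[OF u(1)] x by (simp add: M'.module_simps)
      also have "\<dots> \<in> B'" using M'.sub_smult[OF B(2) x u(2)] .
      finally have "x \<odot>\<^bsub>M'\<^esub> h u \<in> B'" using M'.sub_minus_cancel'[OF B(2)] w(2) hc[OF u(1)] x by blast
      then have "x \<odot>\<^bsub>M\<^esub> u \<in> B" using ker[OF sub_smult[OF A x u(1)]] smult[OF x u(1)] by simp
      then have "u \<in> B" using n u(1) by (auto simp: nzd_mod_def)
      then show "w \<in> B'" using M'.sub_minus_cancel[OF B(2) u(2)] ker[OF u(1)] wc by blast
    qed
  next
    assume n: "nzd_mod M' A' B' x"
    show "nzd_mod M A B x" unfolding nzd_mod_def
    proof (intro ballI impI)
      fix u assume u: "u \<in> A" "x \<odot>\<^bsub>M\<^esub> u \<in> B"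
      then have "x \<odot>\<^bsub>M'\<^esub> h u \<in> B'" using ker[OF sub_smult[OF A x u(1)]] smult[OF x u(1)] by simp
      then have "h u \<in> B'" using n closed[OF u(1)] by (auto simp: nzd_mod_def)
      then show "u \<in> B" using ker u by simp
    qed
  qed
  moreover have "wreg M A (ext_sub M A B x) xs \<longleftrightarrow> wreg M' A' (ext_sub M' A' B' x) xs"
  proof (rule Cons.IH)
    show "set xs \<subseteq> carrier R" using Cons.prems by simp
    show "submodule (ext_sub M A B x) R M" by (rule submodule_ext_sub[OF A B(1) x])
    show "submodule (ext_sub M' A' B' x) R M'" by (rule M'.submodule_ext_sub[OF A' B(2) x])
    show "h u \<in> ext_sub M' A' B' x \<longleftrightarrow> u \<in> ext_sub M A B x" if u: "u \<in> A" for u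
    proof
      assume "u \<in> ext_sub M A B x"
      then obtain a where a: "a \<in> A" "u \<ominus>\<^bsub>M\<^esub> x \<odot>\<^bsub>M\<^esub> a \<in> B" by (auto simp: ext_sub_def)
      have xa: "x \<odot>\<^bsub>M\<^esub> a \<in> A" using sub_smult[OF A x a(1)] .
      have "h u \<ominus>\<^bsub>M'\<^esub> x \<odot>\<^bsub>M'\<^esub> h a \<in> B'"
        using ker[OF sub_minus[OF A u xa]] a minus[OF u xa] smult[OF x a(1)] by simp
      then show "h u \<in> ext_sub M' A' B' x"
        using M'.ext_subI[OF B(2) closed[OF a(1)]] hc[OF u] by blast
    next
      assume "h u \<in> ext_sub M' A' B' x"
      then obtain w where w: "w \<in> A'" "h u \<ominus>\<^bsub>M'\<^esub> x \<odot>\<^bsub>M'\<^esub> w \<in> B'" by (auto simp: ext_sub_def)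
      obtain a where a: "a \<in> A" "w \<ominus>\<^bsub>M'\<^esub> h a \<in> B'" using surj w(1) by blast
      have wc: "w \<in> carrier M'" using w M'.sub_carrier[OF A'] by blast
      have xa: "x \<odot>\<^bsub>M\<^esub> a \<in> A" using sub_smult[OF A x a(1)] .
      have "h u \<ominus>\<^bsub>M'\<^esub> x \<odot>\<^bsub>M'\<^esub> h a = (h u \<ominus>\<^bsub>M'\<^esub> x \<odot>\<^bsub>M'\<^esub> w) \<oplus>\<^bsub>M'\<^esub> x \<odot>\<^bsub>M'\<^esub> (w \<ominus>\<^bsub>M'\<^esub> h a)"
        using wc hc[OF u] hc[OF a(1)] x by (simp add: M'.module_simps)
      also have "\<dots> \<in> B'" using M'.sub_add[OF B(2) w(2) M'.sub_smult[OF B(2) x a(2)]] .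
      finally have "u \<ominus>\<^bsub>M\<^esub> x \<odot>\<^bsub>M\<^esub> a \<in> B"
        using ker[OF sub_minus[OF A u xa]] minus[OF u xa] smult[OF x a(1)] by simp
      then show "u \<in> ext_sub M A B x" using ext_subI[OF B(1) a(1)] u sub_carrier[OF A] by blast
    qed
    show "\<exists>u\<in>A. w \<ominus>\<^bsub>M'\<^esub> h u \<in> ext_sub M' A' B' x" if "w \<in> A'" for w
      using surj[OF that] M'.ext_sub_superset[OF A' B(2) x] by blast
  qed
  ultimately show ?case by simp
qed

text \<open>An element \<open>x\<close> regular on \<open>A / B\<close> satisfies \<open>x A \<inter> B = x B\<close>, so the sequence
  \<open>0 \<rightarrow> B / C \<rightarrow> A / C \<rightarrow> A / B \<rightarrow> 0\<close> stays exact modulo \<open>x\<close>.\<close>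

lemma wreg_restrict:
  assumes A: "submodule A R M" and "submodule B R M" "submodule C R M" "C \<subseteq> B" "B \<subseteq> A"
    and "set xs \<subseteq> carrier R" "wreg M A C xs" "wreg M A B xs"
  shows "wreg M B C xs"
  using assms(2-)
proof (induction xs arbitrary: B C)
  case Nil
  then show ?case by simp
next
  case (Cons x xs)
  note B = Cons.prems(1) and C = Cons.prems(2)
  have x: "x \<in> carrier R" using Cons.prems(5) by simp
  have nC: "nzd_mod M A C x" and nB: "nzd_mod M A B x" using Cons.prems by auto
  have eB: "submodule (ext_sub M A B x) R M" and eC: "submodule (ext_sub M A C x) R M"
    using submodule_ext_sub A B C x by auto
  have "nzd_mod M B C x" using nC Cons.prems(4) by (auto simp: nzd_mod_def)
  moreover have "wreg M (ext_sub M A B x) (ext_sub M A C x) xs"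
  proof (rule Cons.IH[OF eB eC])
    show "ext_sub M A C x \<subseteq> ext_sub M A B x" using Cons.prems(3) by (auto simp: ext_sub_def)
    show "ext_sub M A B x \<subseteq> A" using ext_sub_subset A B x Cons.prems(4) by blast
  qed (use Cons.prems in auto)
  \<comment> \<open>The induction hypothesis lives on \<open>(B + x A) / (C + x A)\<close>. The
    inclusion of \<open>B\<close> identifies \<open>B / (C + x B)\<close> with it; injectivity is
    where regularity of \<open>x\<close> on \<open>A / B\<close> enters.\<close>
  moreover have "wreg M B (ext_sub M B C x) xs \<longleftrightarrow> wreg M (ext_sub M A B x) (ext_sub M A C x) xs"
  proof (rule wreg_transport[where h = id])
    show "module R M" ..
    show "submodule (ext_sub M B C x) R M" using submodule_ext_sub B C x by blast
    show "set xs \<subseteq> carrier R" using Cons.prems by simp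
    show "id u \<in> ext_sub M A B x" if "u \<in> B" for u
      using that ext_sub_superset[OF A B x] by auto
    show "id u \<in> ext_sub M A C x \<longleftrightarrow> u \<in> ext_sub M B C x" if u: "u \<in> B" for u
    proof
      assume "id u \<in> ext_sub M A C x"
      then obtain a where a: "u \<in> carrier M" "a \<in> A" "u \<ominus>\<^bsub>M\<^esub> x \<odot>\<^bsub>M\<^esub> a \<in> C"
        by (auto simp: ext_sub_def)
      have "x \<odot>\<^bsub>M\<^esub> a \<in> B"
        using sub_minus_cancel'[OF B, of u "x \<odot>\<^bsub>M\<^esub> a"] a u x Cons.prems(3) sub_carrier[OF A] by blast
      then have "a \<in> B" using nB a by (auto simp: nzd_mod_def)
      then show "u \<in> ext_sub M B C x" using a by (auto simp: ext_sub_def)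
    next
      assume "u \<in> ext_sub M B C x"
      then show "id u \<in> ext_sub M A C x" using Cons.prems(4) by (auto simp: ext_sub_def)
    qed
    show "\<exists>u\<in>B. w \<ominus>\<^bsub>M\<^esub> id u \<in> ext_sub M A C x" if w: "w \<in> ext_sub M A B x" for w
    proof -
      obtain a where a: "w \<in> carrier M" "a \<in> A" "w \<ominus>\<^bsub>M\<^esub> x \<odot>\<^bsub>M\<^esub> a \<in> B"
        using w by (auto simp: ext_sub_def)
      have "w \<ominus>\<^bsub>M\<^esub> (w \<ominus>\<^bsub>M\<^esub> x \<odot>\<^bsub>M\<^esub> a) = x \<odot>\<^bsub>M\<^esub> a"
        using a x sub_carrier[OF A] by (simp add: module_simps)
      then show ?thesis using a smult_in_ext_sub[OF A C x a(2)] by (auto intro!: bexI[OF _ a(3)])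
    qed
  qed (use B eB eC in auto)
  ultimately show ?case by simp
qed

lemma wreg_take: "wreg M A B xs \<Longrightarrow> wreg M A B (take k xs)"
  by (induction xs arbitrary: B k) (auto simp: take_Cons split: nat.splits)

section \<open>Annihilators of classes, and generated submodules\<close>

lemma colon_ideal:
  assumes B: "submodule B R M" and u: "u \<in> carrier M"
  shows "ideal (colon R M B u) R"
proof (rule idealI)
  show "ring R" ..
  show "subgroup (colon R M B u) (add_monoid R)"
  proof (rule R.add.subgroupI)
    show "colon R M B u \<subseteq> carrier R" by (auto simp: colon_def)
    have "\<zero>\<^bsub>R\<^esub> \<in> colon R M B u" using u sub_zero[OF B] by (simp add: colon_def)
    then show "colon R M B u \<noteq> {}" by blast
    show "\<ominus>\<^bsub>R\<^esub> a \<in> colon R M B u" if "a \<in> colon R M B u" for a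
      using that u sub_neg[OF B] by (simp add: colon_def smult_l_minus)
    show "a \<oplus>\<^bsub>R\<^esub> b \<in> colon R M B u" if "a \<in> colon R M B u" "b \<in> colon R M B u" for a b
      using that u sub_add[OF B] by (simp add: colon_def smult_l_distr)
  qed
  fix a x assume ax: "a \<in> colon R M B u" "x \<in> carrier R"
  then show "x \<otimes>\<^bsub>R\<^esub> a \<in> colon R M B u"
    using u sub_smult[OF B] by (simp add: colon_def smult_assoc1)
  then show "a \<otimes>\<^bsub>R\<^esub> x \<in> colon R M B u"
    using ax by (simp add: R.m_comm colon_def)
qed

text \<open>With \<open>J\<close> a prime annihilator this is the submodule along which prime chains
  are built; with \<open>J\<close> a single element it bounds a span, all of whose members that
  element kills modulo \<open>B\<close>.\<close>

lemma submodule_colon: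
  assumes B: "submodule B R M" and J: "J \<subseteq> carrier R" and A: "submodule A R M"
  shows "submodule {v \<in> A. \<forall>a\<in>J. a \<odot>\<^bsub>M\<^esub> v \<in> B} R M"
proof (rule submoduleI)
  show "{v \<in> A. \<forall>a\<in>J. a \<odot>\<^bsub>M\<^esub> v \<in> B} \<subseteq> carrier M" using sub_carrier[OF A] by auto
  show "\<zero>\<^bsub>M\<^esub> \<in> {v \<in> A. \<forall>a\<in>J. a \<odot>\<^bsub>M\<^esub> v \<in> B}" using J sub_zero[OF B] sub_zero[OF A] by auto
  fix v assume v: "v \<in> {v \<in> A. \<forall>a\<in>J. a \<odot>\<^bsub>M\<^esub> v \<in> B}"
  then have vc: "v \<in> carrier M" using sub_carrier[OF A] by auto
  show "\<ominus>\<^bsub>M\<^esub> v \<in> {v \<in> A. \<forall>a\<in>J. a \<odot>\<^bsub>M\<^esub> v \<in> B}"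
    using v vc J sub_neg[OF B] sub_neg[OF A] by (auto simp: smult_r_minus subset_iff)
  show "b \<odot>\<^bsub>M\<^esub> v \<in> {v \<in> A. \<forall>a\<in>J. a \<odot>\<^bsub>M\<^esub> v \<in> B}" if b: "b \<in> carrier R" for b
  proof -
    have "a \<odot>\<^bsub>M\<^esub> (b \<odot>\<^bsub>M\<^esub> v) \<in> B" if "a \<in> J" for a
      using that v b J vc sub_smult[OF B b] smult_left_commute[of a b v] by auto
    then show ?thesis using v b sub_smult[OF A] by auto
  qed
  fix w assume w: "w \<in> {v \<in> A. \<forall>a\<in>J. a \<odot>\<^bsub>M\<^esub> v \<in> B}"
  then have wc: "w \<in> carrier M" using sub_carrier[OF A] by auto
  show "v \<oplus>\<^bsub>M\<^esub> w \<in> {v \<in> A. \<forall>a\<in>J. a \<odot>\<^bsub>M\<^esub> v \<in> B}"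
    using v vc w wc J sub_add[OF B] sub_add[OF A] by (auto simp: smult_r_distr subset_iff)
qed

lemma submodule_gen_submodule:
  assumes "U \<subseteq> carrier M"
  shows "submodule (gen_submodule R M U) R M"
proof (rule submoduleI)
  show "gen_submodule R M U \<subseteq> carrier M"
    using assms carrier_is_submodule by (auto simp: gen_submodule_def)
qed (auto simp: gen_submodule_def sub_zero sub_neg sub_add sub_smult)

lemma gen_submodule_superset: "U \<subseteq> gen_submodule R M U"
  by (auto simp: gen_submodule_def)

lemma gen_submodule_least: "submodule N R M \<Longrightarrow> U \<subseteq> N \<Longrightarrow> gen_submodule R M U \<subseteq> N"
  by (auto simp: gen_submodule_def)

end

section \<open>Associated primes and Nakayama's lemma\<close>

text \<open>The vanishing of \<open>Hom(k, A / B)\<close> for the residue field \<open>k\<close>.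
  For Noetherian modules it amounts to a nonzerodivisor on \<open>A / B\<close> in the maximal
  ideal, but unlike a chosen nonzerodivisor it can be compared between different quotients.\<close>

definition no_socle :: "('a, 'b) ring_scheme \<Rightarrow> ('a, 'c, 'd) module_scheme \<Rightarrow> 'c set \<Rightarrow> 'c set \<Rightarrow> bool" where
  "no_socle R M A B \<longleftrightarrow> (\<forall>u\<in>A. (\<forall>a\<in>max_ideal R. a \<odot>\<^bsub>M\<^esub> u \<in> B) \<longrightarrow> u \<in> B)"

text \<open>Since \<open>wreg\<close> is weak, a vanishing \<open>A / B\<close> satisfies this for
  every \<open>k\<close>, matching the convention that the zero module has infinite depth. The value
  of \<open>depth\<close> at the zero module is 0 instead.\<close>

definition depth_ge :: "('a, 'b) ring_scheme \<Rightarrow> ('a, 'c, 'd) module_scheme \<Rightarrow> nat \<Rightarrow> 'c set \<Rightarrow> 'c set \<Rightarrow> bool" where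
  "depth_ge R M k A B \<longleftrightarrow> (\<exists>xs. length xs = k \<and> set xs \<subseteq> max_ideal R \<and> wreg M A B xs)"

text \<open>The maximal condition stands in for finite generation: Nakayama's lemma and the
  finiteness of the set of maximal annihilators are derived from it, and it is inherited by
  quotients.\<close>

locale local_noetherian_module = module R M + noetherian_local_ring R
  for R :: "('a, 'b) ring_scheme" (structure) and M :: "('a, 'c, 'd) module_scheme" (structure) +
  assumes submodule_family_maximal:
    "S \<noteq> {} \<Longrightarrow> (\<And>N. N \<in> S \<Longrightarrow> submodule N R M) \<Longrightarrow> \<exists>N\<in>S. \<forall>K\<in>S. N \<subseteq> K \<longrightarrow> K = N"
begin

text \<open>Nakayama's lemma for \<open>A / B\<close> localized at \<open>P\<close>, with denominators cleared: a submodule \<open>C\<close>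
  maximal among those failing the conclusion can be enlarged by one element.\<close>

lemma nakayama_at_prime:
  assumes P: "primeideal P R" "c \<in> P" and A: "submodule A R M" and B: "submodule B R M" "B \<subseteq> A"
    and H: "\<And>u. u \<in> A \<Longrightarrow> \<exists>t\<in>carrier R - P. \<exists>v\<in>A. t \<odot>\<^bsub>M\<^esub> u \<ominus>\<^bsub>M\<^esub> c \<odot>\<^bsub>M\<^esub> v \<in> B"
  shows "\<exists>t\<in>carrier R - P. \<forall>u\<in>A. t \<odot>\<^bsub>M\<^esub> u \<in> B"
proof (rule ccontr)
  assume no: "\<not> ?thesis"
  interpret P: primeideal P R by fact
  define S where
    "S = {C. submodule C R M \<and> B \<subseteq> C \<and> C \<subseteq> A \<and> \<not> (\<exists>t\<in>carrier R - P. \<forall>u\<in>A. t \<odot>\<^bsub>M\<^esub> u \<in> C)}"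
  have "B \<in> S" using no B by (simp add: S_def)
  then have "S \<noteq> {}" by blast
  moreover have "submodule N R M" if "N \<in> S" for N using that by (simp add: S_def)
  ultimately obtain C where C: "C \<in> S" and max: "\<forall>K\<in>S. C \<subseteq> K \<longrightarrow> K = C"
    using submodule_family_maximal[of S] by blast
  then have sC: "submodule C R M" "B \<subseteq> C" "C \<subseteq> A"
    and CS: "\<not> (\<exists>t\<in>carrier R - P. \<forall>u\<in>A. t \<odot>\<^bsub>M\<^esub> u \<in> C)" by (simp_all add: S_def)
  have c: "c \<in> carrier R" using P.a_Hcarr[OF P(2)] .
  have one: "\<one>\<^bsub>R\<^esub> \<in> carrier R - P" using P.one_imp_carrier P.I_notcarr by auto
  have "C \<noteq> A"
  proof
    assume "C = A"
    then have "\<forall>u\<in>A. \<one>\<^bsub>R\<^esub> \<odot>\<^bsub>M\<^esub> u \<in> C" using sub_carrier[OF A] by simp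
    then show False using CS one by blast
  qed
  then obtain z where z: "z \<in> A" "z \<notin> C" using sC by auto
  have zc: "z \<in> carrier M" using z sub_carrier[OF A] by blast
  \<comment> \<open>\<open>D\<close> is \<open>C + R z\<close>. It is strictly larger than
    \<open>C\<close>, so by maximality some \<open>t0\<close> outside \<open>P\<close> carries
    \<open>A\<close> into it.\<close>
  define D where "D = {w \<in> carrier M. \<exists>n\<in>(\<lambda>r. r \<odot>\<^bsub>M\<^esub> z) ` carrier R. w \<ominus>\<^bsub>M\<^esub> n \<in> C}"
  have D: "submodule D R M" unfolding D_def by (rule submodule_sum[OF submodule_cyclic[OF zc] sC(1)])
  have CD: "C \<subseteq> D"
  proof
    fix w assume "w \<in> C"
    then show "w \<in> D" using sub_carrier[OF sC(1)] zc
      by (auto intro!: bexI[of _ "\<zero>\<^bsub>R\<^esub>"] simp: D_def)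
  qed
  have DA: "D \<subseteq> A"
  proof
    fix w assume "w \<in> D"
    then obtain r where r: "w \<in> carrier M" "r \<in> carrier R" "w \<ominus>\<^bsub>M\<^esub> r \<odot>\<^bsub>M\<^esub> z \<in> C"
      by (auto simp: D_def)
    show "w \<in> A" using sub_minus_cancel[OF A _ sub_smult[OF A r(2) z(1)] r(1)] r(3) sC(3) by blast
  qed
  have "z \<in> D" using zc sub_zero[OF sC(1)]
    by (auto intro!: bexI[of _ "\<one>\<^bsub>R\<^esub>"] simp: D_def M.minus_eq M.r_neg)
  then have "D \<notin> S" using max z(2) CD by blast
  then obtain t0 where t0: "t0 \<in> carrier R - P" "\<forall>u\<in>A. t0 \<odot>\<^bsub>M\<^esub> u \<in> D"
    using D DA order_trans[OF sC(2) CD] unfolding S_def by blast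
  obtain t1 v where t1: "t1 \<in> carrier R - P" "v \<in> A" "t1 \<odot>\<^bsub>M\<^esub> z \<ominus>\<^bsub>M\<^esub> c \<odot>\<^bsub>M\<^esub> v \<in> B"
    using H[OF z(1)] by auto
  have vc: "v \<in> carrier M" using t1(2) sub_carrier[OF A] by blast
  obtain r where r: "r \<in> carrier R" "t0 \<odot>\<^bsub>M\<^esub> v \<ominus>\<^bsub>M\<^esub> r \<odot>\<^bsub>M\<^esub> z \<in> C"
    using t0(2) t1(2) unfolding D_def by blast
  \<comment> \<open>A determinant trick for one generator: \<open>t1 z = c v\<close> modulo
    \<open>B\<close> and \<open>t0 v = r z\<close> modulo \<open>C\<close> give
    \<open>t0 t1 z = c r z\<close> modulo \<open>C\<close>, so \<open>s\<close> carries
    \<open>z\<close> into \<open>C\<close>. As \<open>c\<close> lies in \<open>P\<close> and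
    \<open>t0\<close>, \<open>t1\<close> do not, \<open>s\<close> is outside
    \<open>P\<close>.\<close>
  define s where "s = t0 \<otimes>\<^bsub>R\<^esub> t1 \<ominus>\<^bsub>R\<^esub> c \<otimes>\<^bsub>R\<^esub> r"
  have tc: "t0 \<in> carrier R" "t1 \<in> carrier R" "s \<in> carrier R" using t0 t1 c r by (auto simp: s_def)
  have "s \<odot>\<^bsub>M\<^esub> z = t0 \<odot>\<^bsub>M\<^esub> (t1 \<odot>\<^bsub>M\<^esub> z \<ominus>\<^bsub>M\<^esub> c \<odot>\<^bsub>M\<^esub> v) \<oplus>\<^bsub>M\<^esub> c \<odot>\<^bsub>M\<^esub> (t0 \<odot>\<^bsub>M\<^esub> v \<ominus>\<^bsub>M\<^esub> r \<odot>\<^bsub>M\<^esub> z)"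
    using tc c r zc vc by (simp add: s_def module_simps)
  also have "\<dots> \<in> C"
    using t1(3) sC(2) sub_add[OF sC(1) sub_smult[OF sC(1) tc(1)] sub_smult[OF sC(1) c r(2)]] by blast
  finally have sz: "s \<odot>\<^bsub>M\<^esub> z \<in> C" .
  have "s \<notin> P"
  proof
    assume "s \<in> P"
    moreover have "c \<otimes>\<^bsub>R\<^esub> r \<in> P" using P.I_r_closed[OF P(2) r(1)] .
    ultimately have "s \<oplus>\<^bsub>R\<^esub> c \<otimes>\<^bsub>R\<^esub> r \<in> P" by (rule P.a_closed)
    also have "s \<oplus>\<^bsub>R\<^esub> c \<otimes>\<^bsub>R\<^esub> r = t0 \<otimes>\<^bsub>R\<^esub> t1"
      using tc c r(1) by (simp add: s_def R.minus_eq R.a_assoc R.l_neg)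
    finally show False using P.I_prime[OF tc(1,2)] t0 t1 by blast
  qed
  then have "s \<otimes>\<^bsub>R\<^esub> t0 \<in> carrier R - P" using P.I_prime[OF tc(3,1)] t0 tc by auto
  \<comment> \<open>\<open>t0\<close> carries \<open>A\<close> into \<open>C + R z\<close>, and
    \<open>s\<close> carries that into \<open>C\<close>, against the choice of
    \<open>C\<close>.\<close>
  moreover have "(s \<otimes>\<^bsub>R\<^esub> t0) \<odot>\<^bsub>M\<^esub> u \<in> C" if u: "u \<in> A" for u
  proof -
    obtain q where q: "q \<in> carrier R" "t0 \<odot>\<^bsub>M\<^esub> u \<ominus>\<^bsub>M\<^esub> q \<odot>\<^bsub>M\<^esub> z \<in> C"
      using t0(2) u unfolding D_def by blast
    have uc: "u \<in> carrier M" using u sub_carrier[OF A] by blast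
    have "s \<odot>\<^bsub>M\<^esub> (t0 \<odot>\<^bsub>M\<^esub> u \<ominus>\<^bsub>M\<^esub> q \<odot>\<^bsub>M\<^esub> z) \<oplus>\<^bsub>M\<^esub> q \<odot>\<^bsub>M\<^esub> (s \<odot>\<^bsub>M\<^esub> z) = (s \<otimes>\<^bsub>R\<^esub> t0) \<odot>\<^bsub>M\<^esub> u"
      using tc q(1) uc zc by (simp add: module_simps)
    then show ?thesis
      using sub_add[OF sC(1) sub_smult[OF sC(1) tc(3) q(2)] sub_smult[OF sC(1) q(1) sz]] by simp
  qed
  ultimately show False using CS by blast
qed

text \<open>For the maximal ideal the denominator left over by \<open>nakayama_at_prime\<close> is a
  unit and cancels.\<close>

lemma nakayama_local:
  assumes c: "c \<in> max_ideal R" and A: "submodule A R M" and B: "submodule B R M" "B \<subseteq> A"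
    and H: "A \<subseteq> ext_sub M A B c"
  shows "A \<subseteq> B"
proof -
  interpret P: primeideal "max_ideal R" R by (rule primeideal_max_ideal)
  have one: "\<one>\<^bsub>R\<^esub> \<in> carrier R - max_ideal R" using P.one_imp_carrier P.I_notcarr by auto
  have "\<exists>t\<in>carrier R - max_ideal R. \<exists>v\<in>A. t \<odot>\<^bsub>M\<^esub> u \<ominus>\<^bsub>M\<^esub> c \<odot>\<^bsub>M\<^esub> v \<in> B" if u: "u \<in> A" for u
    using H u sub_carrier[OF A u] one by (intro bexI[of _ "\<one>\<^bsub>R\<^esub>"]) (auto simp: ext_sub_def)
  from nakayama_at_prime[OF primeideal_max_ideal c A B this] obtain t
    where t: "t \<in> carrier R - max_ideal R" "\<forall>u\<in>A. t \<odot>\<^bsub>M\<^esub> u \<in> B" by blast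
  obtain s where s: "s \<in> carrier R" "s \<otimes>\<^bsub>R\<^esub> t = \<one>\<^bsub>R\<^esub>" using unit_if_not_in_max_ideal t(1) by blast
  show ?thesis
  proof
    fix u assume u: "u \<in> A"
    then have "s \<odot>\<^bsub>M\<^esub> (t \<odot>\<^bsub>M\<^esub> u) \<in> B" using t(2) s(1) sub_smult[OF B(1)] by blast
    then show "u \<in> B" using s t(1) sub_carrier[OF A u] by (simp flip: smult_assoc1)
  qed
qed

text \<open>One application of Nakayama's lemma per element. This is what turns weak regularity on a
  nonzero module into regularity.\<close>

lemma wreg_imp_proper:
  assumes "set xs \<subseteq> max_ideal R" "submodule A R M" "submodule B R M" "B \<subseteq> A" "\<not> A \<subseteq> B"
  shows "\<not> A \<subseteq> fold (\<lambda>x N. ext_sub M A N x) xs B"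
  using assms(1,3-)
proof (induction xs arbitrary: B)
  case (Cons x xs)
  have x: "x \<in> carrier R" using Cons.prems(1) max_ideal_subset by auto
  have "\<not> A \<subseteq> ext_sub M A B x"
    using nakayama_local[of x A B] Cons.prems assms(2) by auto
  then show ?case
    using Cons.IH[of "ext_sub M A B x"] Cons.prems submodule_ext_sub[OF assms(2) Cons.prems(2) x]
      ext_sub_subset[OF assms(2) Cons.prems(2) x] by auto
qed simp

text \<open>An annihilator maximal among those of nonzero classes is prime: if \<open>a b\<close>
  kills \<open>u\<close> but \<open>b\<close> does not, then the annihilator of \<open>b u\<close>
  contains that of \<open>u\<close>, hence equals it, and contains \<open>a\<close>. Starting above
  the annihilator of \<open>w\<close> shows that every zero divisor lies in such a prime.\<close>

lemma exists_maximal_colon: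
  assumes A: "submodule A R M" and B: "submodule B R M" and w: "w \<in> A" "w \<notin> B"
  shows "\<exists>u\<in>A. u \<notin> B \<and> primeideal (colon R M B u) R \<and> colon R M B w \<subseteq> colon R M B u \<and>
    (\<forall>v\<in>A. v \<notin> B \<longrightarrow> colon R M B u \<subseteq> colon R M B v \<longrightarrow> colon R M B v = colon R M B u)"
proof -
  note Ac = sub_carrier[OF A]
  define S where "S = colon R M B ` {u \<in> A. u \<notin> B \<and> colon R M B w \<subseteq> colon R M B u}"
  have "S \<noteq> {}" using w by (auto simp: S_def)
  moreover have "ideal J R" if "J \<in> S" for J
    using that colon_ideal[OF B] Ac by (auto simp: S_def)
  ultimately obtain J where J: "J \<in> S" "\<forall>K\<in>S. J \<subseteq> K \<longrightarrow> K = J"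
    using ideal_family_maximal[of S] by blast
  obtain u where u: "u \<in> A" "u \<notin> B" "colon R M B w \<subseteq> colon R M B u" "J = colon R M B u"
    using J(1) by (auto simp: S_def)
  have max: "\<forall>v\<in>A. v \<notin> B \<longrightarrow> colon R M B u \<subseteq> colon R M B v \<longrightarrow> colon R M B v = colon R M B u"
  proof (intro ballI impI)
    fix v assume v: "v \<in> A" "v \<notin> B" "colon R M B u \<subseteq> colon R M B v"
    then have "colon R M B v \<in> S" using u(3) by (auto simp: S_def)
    then show "colon R M B v = colon R M B u" using J(2) v(3) u(4) by simp
  qed
  have "primeideal (colon R M B u) R"
  proof (rule primeidealI)
    show "ideal (colon R M B u) R" using colon_ideal[OF B] Ac u by blast
    show "cring R" ..
    have "\<one>\<^bsub>R\<^esub> \<notin> colon R M B u" using u Ac by (simp add: colon_def)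
    then show "carrier R \<noteq> colon R M B u" by blast
    fix a b assume ab: "a \<in> carrier R" "b \<in> carrier R" "a \<otimes>\<^bsub>R\<^esub> b \<in> colon R M B u"
    show "a \<in> colon R M B u \<or> b \<in> colon R M B u"
    proof (cases "b \<odot>\<^bsub>M\<^esub> u \<in> B")
      case True then show ?thesis using ab by (simp add: colon_def)
    next
      case False
      have "colon R M B u \<subseteq> colon R M B (b \<odot>\<^bsub>M\<^esub> u)"
      proof
        fix r assume "r \<in> colon R M B u"
        then have r: "r \<in> carrier R" "r \<odot>\<^bsub>M\<^esub> u \<in> B" by (auto simp: colon_def)
        then show "r \<in> colon R M B (b \<odot>\<^bsub>M\<^esub> u)"
          using sub_smult[OF B ab(2) r(2)] ab(2) Ac u smult_left_commute[of r b u]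
          by (simp add: colon_def)
      qed
      then have "colon R M B (b \<odot>\<^bsub>M\<^esub> u) = colon R M B u"
        using max False sub_smult[OF A ab(2) u(1)] by blast
      moreover have "a \<in> colon R M B (b \<odot>\<^bsub>M\<^esub> u)"
        using ab Ac[OF u(1)] by (simp add: colon_def smult_assoc1)
      ultimately show ?thesis by simp
    qed
  qed
  with u max show ?thesis by blast
qed

text \<open>A maximal annihilator \<open>P\<^sub>u\<close> with \<open>u\<close> in the span of \<open>B\<close> and \<open>w\<^sub>1, \<dots>, w\<^sub>n\<close> contains the
  intersection of the \<open>P\<^sub>w\<close>, hence equals one of them.\<close>

lemma finite_primes_cover_zero_divisors:
  assumes A: "submodule A R M" and B: "submodule B R M"
  shows "\<exists>S. finite S \<and> (\<forall>P\<in>S. primeideal P R \<and> (\<exists>u\<in>A. u \<notin> B \<and> P = colon R M B u)) \<and>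
    (\<forall>u\<in>A. u \<notin> B \<longrightarrow> (\<exists>P\<in>S. colon R M B u \<subseteq> P))"
proof -
  note Ac = sub_carrier[OF A] and Bc = sub_carrier[OF B]
  define gens where "gens = {u \<in> A. u \<notin> B \<and> primeideal (colon R M B u) R \<and>
    (\<forall>v\<in>A. v \<notin> B \<longrightarrow> colon R M B u \<subseteq> colon R M B v \<longrightarrow> colon R M B v = colon R M B u)}"
  \<comment> \<open>A maximal span of \<open>B\<close> and finitely many members of
    \<open>gens\<close> contains all of \<open>gens\<close>; this takes the place of finite
    generation.\<close>
  define S where "S = (\<lambda>U. gen_submodule R M (B \<union> U)) ` {U. finite U \<and> U \<subseteq> gens}"
  have sub: "B \<union> U \<subseteq> carrier M" if "U \<subseteq> gens" for U using that Ac Bc by (auto simp: gens_def)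
  have "S \<noteq> {}" by (auto simp: S_def)
  moreover have "submodule N R M" if "N \<in> S" for N
    using that submodule_gen_submodule[OF sub] by (auto simp: S_def)
  ultimately obtain N where N: "N \<in> S" and max: "\<forall>K\<in>S. N \<subseteq> K \<longrightarrow> K = N"
    using submodule_family_maximal[of S] by blast
  then obtain U where U: "finite U" "U \<subseteq> gens" "N = gen_submodule R M (B \<union> U)"
    by (auto simp: S_def)
  have gens_N: "gens \<subseteq> N"
  proof
    fix u assume u: "u \<in> gens"
    have "gen_submodule R M (B \<union> insert u U) \<in> S"
      unfolding S_def using U u by (intro imageI) auto
    moreover have "N \<subseteq> gen_submodule R M (B \<union> insert u U)"
      unfolding U(3) by (auto simp: gen_submodule_def)
    ultimately have "gen_submodule R M (B \<union> insert u U) = N" using max by blast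
    then show "u \<in> N" using gen_submodule_superset[of "B \<union> insert u U"] by auto
  qed
  have covered: "\<exists>w\<in>U. colon R M B w = colon R M B u" if u: "u \<in> gens" for u
  proof (rule ccontr)
    assume no: "\<not> ?thesis"
    have pu: "primeideal (colon R M B u) R" using u by (simp add: gens_def)
    \<comment> \<open>Distinct maximal annihilators are incomparable.\<close>
    have nsub: "\<not> colon R M B w \<subseteq> colon R M B u" if "w \<in> U" for w
      using no that U(2) u by (auto simp: gens_def)
    have "\<exists>y\<in>carrier R. y \<notin> colon R M B u \<and> (\<forall>Q\<in>colon R M B ` U. y \<in> Q)"
    proof (rule exists_in_ideals_not_in_prime[OF _ _ oneideal _ pu])
      show "finite (colon R M B ` U)" using U(1) by simp
      show "ideal Q R \<and> \<not> Q \<subseteq> colon R M B u" if "Q \<in> colon R M B ` U" for Q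
        using that nsub colon_ideal[OF B] U(2) Ac by (auto simp: gens_def subset_iff)
      show "\<not> carrier R \<subseteq> colon R M B u"
        using primeideal.I_notcarr[OF pu] by (auto simp: colon_def)
    qed
    then obtain y where y: "y \<in> carrier R" "y \<notin> colon R M B u" "\<forall>w\<in>U. y \<in> colon R M B w" by auto
    \<comment> \<open>As \<open>y\<close> kills \<open>B\<close> and all of \<open>U\<close> modulo
      \<open>B\<close>, it kills their span \<open>N\<close>, which contains \<open>u\<close>; but
      \<open>y\<close> was chosen outside the annihilator of \<open>u\<close>.\<close>
    let ?V = "{v \<in> carrier M. \<forall>a\<in>{y}. a \<odot>\<^bsub>M\<^esub> v \<in> B}"
    have "submodule ?V R M" using submodule_colon[OF B _ carrier_is_submodule, of "{y}"] y by simp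
    moreover have "B \<union> U \<subseteq> ?V"
      using y U(2) Ac Bc sub_smult[OF B y(1)] by (auto simp: gens_def colon_def)
    ultimately have "N \<subseteq> ?V" unfolding U(3) by (rule gen_submodule_least)
    then show False using gens_N u y by (auto simp: colon_def)
  qed
  show ?thesis
  proof (intro exI conjI ballI impI)
    show "finite (colon R M B ` U)" using U(1) by simp
    show "primeideal P R" "\<exists>u\<in>A. u \<notin> B \<and> P = colon R M B u" if "P \<in> colon R M B ` U" for P
      using that U(2) by (auto simp: gens_def)
    fix u assume "u \<in> A" "u \<notin> B"
    from exists_maximal_colon[OF A B this] obtain v where "v \<in> gens" "colon R M B u \<subseteq> colon R M B v"
      by (auto simp: gens_def)
    with covered[OF this(1)] show "\<exists>P\<in>colon R M B ` U. colon R M B u \<subseteq> P" by auto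
  qed
qed

section \<open>Socles and the exchange of nonzerodivisors\<close>

lemma no_socle_if_nzd_mod: "x \<in> max_ideal R \<Longrightarrow> nzd_mod M A B x \<Longrightarrow> no_socle R M A B"
  by (auto simp: no_socle_def nzd_mod_def)

text \<open>For nonzerodivisors \<open>x\<close> in the maximal ideal, the socle of
  \<open>A / (B + x A)\<close> is \<open>Ext^1(k, A / B)\<close>, whatever \<open>x\<close> is; the
  proof makes the comparison explicit. A socle element \<open>u\<close> modulo \<open>y\<close>
  gives a \<open>v\<close> with \<open>x u = y v\<close> modulo \<open>B\<close>, which is a socle
  element modulo \<open>x\<close>. So \<open>v = x w\<close>, and cancelling \<open>x\<close> in
  \<open>x u = y x w\<close> yields \<open>u = y w\<close>.\<close>

lemma no_socle_exchange:
  assumes A: "submodule A R M" and B: "submodule B R M"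
    and x: "x \<in> max_ideal R" "nzd_mod M A B x" and y: "y \<in> carrier R" "nzd_mod M A B y"
    and ns: "no_socle R M A (ext_sub M A B x)"
  shows "no_socle R M A (ext_sub M A B y)"
  unfolding no_socle_def
proof (intro ballI impI)
  note Ac = sub_carrier[OF A]
  fix u assume u: "u \<in> A" "\<forall>a\<in>max_ideal R. a \<odot>\<^bsub>M\<^esub> u \<in> ext_sub M A B y"
  have xc: "x \<in> carrier R" using x max_ideal_subset by blast
  obtain v where v: "v \<in> A" "x \<odot>\<^bsub>M\<^esub> u \<ominus>\<^bsub>M\<^esub> y \<odot>\<^bsub>M\<^esub> v \<in> B" using u x by (auto simp: ext_sub_def)
  have "a \<odot>\<^bsub>M\<^esub> v \<in> ext_sub M A B x" if a: "a \<in> max_ideal R" for a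
  proof -
    have ac: "a \<in> carrier R" using a max_ideal_subset by blast
    obtain w where w: "w \<in> A" "a \<odot>\<^bsub>M\<^esub> u \<ominus>\<^bsub>M\<^esub> y \<odot>\<^bsub>M\<^esub> w \<in> B" using u a by (auto simp: ext_sub_def)
    \<comment> \<open>Substituting \<open>x u = y v\<close> and \<open>a u = y w\<close> shows that
      \<open>y\<close> kills \<open>a v - x w\<close> modulo \<open>B\<close>, and \<open>y\<close>
      can be cancelled.\<close>
    have "y \<odot>\<^bsub>M\<^esub> (a \<odot>\<^bsub>M\<^esub> v \<ominus>\<^bsub>M\<^esub> x \<odot>\<^bsub>M\<^esub> w) =
        x \<odot>\<^bsub>M\<^esub> (a \<odot>\<^bsub>M\<^esub> u \<ominus>\<^bsub>M\<^esub> y \<odot>\<^bsub>M\<^esub> w) \<ominus>\<^bsub>M\<^esub> a \<odot>\<^bsub>M\<^esub> (x \<odot>\<^bsub>M\<^esub> u \<ominus>\<^bsub>M\<^esub> y \<odot>\<^bsub>M\<^esub> v)"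
      using ac xc y(1) Ac[OF u(1)] Ac[OF v(1)] Ac[OF w(1)] by (simp add: module_simps)
    also have "\<dots> \<in> B" using sub_minus[OF B] sub_smult[OF B] w v ac xc by blast
    finally have "a \<odot>\<^bsub>M\<^esub> v \<ominus>\<^bsub>M\<^esub> x \<odot>\<^bsub>M\<^esub> w \<in> B"
      using y(2) sub_minus[OF A sub_smult[OF A ac v(1)] sub_smult[OF A xc w(1)]] by (auto simp: nzd_mod_def)
    then show ?thesis using ext_subI[OF B w(1)] ac Ac[OF v(1)] by blast
  qed
  then have "v \<in> ext_sub M A B x" using ns v(1) by (auto simp: no_socle_def)
  then obtain w where w: "w \<in> A" "v \<ominus>\<^bsub>M\<^esub> x \<odot>\<^bsub>M\<^esub> w \<in> B" by (auto simp: ext_sub_def)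
  have "x \<odot>\<^bsub>M\<^esub> (u \<ominus>\<^bsub>M\<^esub> y \<odot>\<^bsub>M\<^esub> w) =
      (x \<odot>\<^bsub>M\<^esub> u \<ominus>\<^bsub>M\<^esub> y \<odot>\<^bsub>M\<^esub> v) \<oplus>\<^bsub>M\<^esub> y \<odot>\<^bsub>M\<^esub> (v \<ominus>\<^bsub>M\<^esub> x \<odot>\<^bsub>M\<^esub> w)"
    using xc y(1) Ac[OF u(1)] Ac[OF v(1)] Ac[OF w(1)] by (simp add: module_simps)
  also have "\<dots> \<in> B" using sub_add[OF B v(2) sub_smult[OF B y(1) w(2)]] .
  finally have "u \<ominus>\<^bsub>M\<^esub> y \<odot>\<^bsub>M\<^esub> w \<in> B"
    using x(2) sub_minus[OF A u(1) sub_smult[OF A y(1) w(1)]] by (auto simp: nzd_mod_def)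
  then show "u \<in> ext_sub M A B y" using ext_subI[OF B w(1) Ac[OF u(1)]] by blast
qed

text \<open>The half of the permutability of regular sequences that holds without Nakayama's lemma:
  in \<open>y u = z v\<close> the element \<open>v\<close> is divisible by \<open>y\<close>, say
  \<open>v = y w\<close>, and cancelling \<open>y\<close> gives \<open>u = z w\<close>, all modulo
  \<open>B\<close>.\<close>

lemma nzd_mod_swap:
  assumes A: "submodule A R M" and B: "submodule B R M" and yz: "y \<in> carrier R" "z \<in> carrier R"
    and y: "nzd_mod M A B y" and z: "nzd_mod M A (ext_sub M A B y) z"
  shows "nzd_mod M A (ext_sub M A B z) y"
  unfolding nzd_mod_def
proof (intro ballI impI)
  note Ac = sub_carrier[OF A]
  fix u assume u: "u \<in> A" "y \<odot>\<^bsub>M\<^esub> u \<in> ext_sub M A B z"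
  then obtain v where v: "v \<in> A" "y \<odot>\<^bsub>M\<^esub> u \<ominus>\<^bsub>M\<^esub> z \<odot>\<^bsub>M\<^esub> v \<in> B" by (auto simp: ext_sub_def)
  note c = yz Ac[OF u(1)] Ac[OF v(1)]
  have "z \<odot>\<^bsub>M\<^esub> v \<ominus>\<^bsub>M\<^esub> y \<odot>\<^bsub>M\<^esub> u = \<ominus>\<^bsub>M\<^esub> (y \<odot>\<^bsub>M\<^esub> u \<ominus>\<^bsub>M\<^esub> z \<odot>\<^bsub>M\<^esub> v)"
    using c by (simp add: module_simps)
  then have "z \<odot>\<^bsub>M\<^esub> v \<ominus>\<^bsub>M\<^esub> y \<odot>\<^bsub>M\<^esub> u \<in> B" using sub_neg[OF B v(2)] by simp
  then have "z \<odot>\<^bsub>M\<^esub> v \<in> ext_sub M A B y" using ext_subI[OF B u(1)] c by blast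
  then have "v \<in> ext_sub M A B y" using z v by (auto simp: nzd_mod_def)
  then obtain w where w: "w \<in> A" "v \<ominus>\<^bsub>M\<^esub> y \<odot>\<^bsub>M\<^esub> w \<in> B" by (auto simp: ext_sub_def)
  have "y \<odot>\<^bsub>M\<^esub> (u \<ominus>\<^bsub>M\<^esub> z \<odot>\<^bsub>M\<^esub> w) =
      (y \<odot>\<^bsub>M\<^esub> u \<ominus>\<^bsub>M\<^esub> z \<odot>\<^bsub>M\<^esub> v) \<oplus>\<^bsub>M\<^esub> z \<odot>\<^bsub>M\<^esub> (v \<ominus>\<^bsub>M\<^esub> y \<odot>\<^bsub>M\<^esub> w)"
    using c Ac[OF w(1)] by (simp add: module_simps)
  also have "\<dots> \<in> B" using sub_add[OF B v(2) sub_smult[OF B yz(2) w(2)]] .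
  finally have "u \<ominus>\<^bsub>M\<^esub> z \<odot>\<^bsub>M\<^esub> w \<in> B"
    using y sub_minus[OF A u(1) sub_smult[OF A yz(2) w(1)]] by (auto simp: nzd_mod_def)
  then show "u \<in> ext_sub M A B z" using ext_subI[OF B w(1) c(3)] by blast
qed

text \<open>Along an associated prime, going modulo a nonzerodivisor strictly enlarges the prime; this is
  the inequality \<open>depth M \<le> dim R/P\<close> for \<open>P\<close> associated to \<open>M\<close>.\<close>

lemma exists_prime_chain:
  assumes A: "submodule A R M"
  shows "\<lbrakk>submodule B R M; B \<subseteq> A; set xs \<subseteq> max_ideal R; wreg M A B xs; u \<in> A;
     primeideal (colon R M B u) R\<rbrakk> \<Longrightarrow>
    \<exists>P :: nat \<Rightarrow> 'a set. P 0 = colon R M B u \<and> (\<forall>i\<le>length xs. primeideal (P i) R) \<and>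
      (\<forall>i<length xs. P i \<subset> P (Suc i))"
proof (induction xs arbitrary: B u)
  case Nil
  then show ?case by (intro exI[of _ "\<lambda>_. colon R M B u"]) simp
next
  case (Cons x xs)
  note Ac = sub_carrier[OF A]
  note B = Cons.prems(1) and BA = Cons.prems(2) and u = Cons.prems(5) and prime = Cons.prems(6)
  let ?p = "colon R M B u" and ?E = "ext_sub M A B x"
  have x: "x \<in> max_ideal R" "x \<in> carrier R" using Cons.prems(3) max_ideal_subset by auto
  have nzd: "nzd_mod M A B x" using Cons.prems(4) by simp
  have uB: "u \<notin> B"
  proof
    assume "u \<in> B"
    then have "?p = carrier R" using sub_smult[OF B] by (auto simp: colon_def)
    then show False using primeideal.I_notcarr[OF prime] by simp
  qed
  have E: "submodule ?E R M" "?E \<subseteq> A" "B \<subseteq> ?E"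
    using submodule_ext_sub ext_sub_subset ext_sub_superset A B BA x by auto
  define N where "N = {v \<in> A. \<forall>a\<in>?p. a \<odot>\<^bsub>M\<^esub> v \<in> B}"
  have pc: "?p \<subseteq> carrier R" by (auto simp: colon_def)
  have N: "submodule N R M" unfolding N_def by (rule submodule_colon[OF B pc A])
  have "u \<in> N" using u by (auto simp: N_def colon_def)
  \<comment> \<open>Otherwise each \<open>w\<close> in \<open>N\<close> is \<open>x v\<close> modulo
    \<open>B\<close>, and since \<open>x\<close> is regular, \<open>v\<close> is killed by the prime
    as well, so it lies in \<open>N\<close>. Then \<open>N = B + x N\<close>, and Nakayama's lemma
    gives \<open>N = B\<close>, against \<open>u\<close>.\<close>
  have "\<not> N \<subseteq> ?E"
  proof
    assume NE: "N \<subseteq> ?E"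
    have "B \<subseteq> N" using BA sub_smult[OF B] pc by (auto simp: N_def)
    have "N \<subseteq> ext_sub M N B x"
    proof
      fix w assume w: "w \<in> N"
      then have wA: "w \<in> A" by (simp add: N_def)
      obtain v where v: "v \<in> A" "w \<ominus>\<^bsub>M\<^esub> x \<odot>\<^bsub>M\<^esub> v \<in> B" using w NE by (auto simp: ext_sub_def)
      have "a \<odot>\<^bsub>M\<^esub> v \<in> B" if a: "a \<in> ?p" for a
      proof -
        have ac: "a \<in> carrier R" using a pc by blast
        have "a \<odot>\<^bsub>M\<^esub> w \<ominus>\<^bsub>M\<^esub> x \<odot>\<^bsub>M\<^esub> (a \<odot>\<^bsub>M\<^esub> v) = a \<odot>\<^bsub>M\<^esub> (w \<ominus>\<^bsub>M\<^esub> x \<odot>\<^bsub>M\<^esub> v)"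
          using ac x Ac[OF wA] Ac[OF v(1)] by (simp add: module_simps)
        also have "\<dots> \<in> B" using sub_smult[OF B ac v(2)] .
        finally have "x \<odot>\<^bsub>M\<^esub> (a \<odot>\<^bsub>M\<^esub> v) \<in> B"
          using sub_minus_cancel'[OF B] w a ac x Ac[OF v(1)] by (auto simp: N_def)
        then show ?thesis using nzd sub_smult[OF A ac v(1)] by (auto simp: nzd_mod_def)
      qed
      then have "v \<in> N" using v by (simp add: N_def)
      then show "w \<in> ext_sub M N B x" using ext_subI[OF B _ Ac[OF wA] v(2)] by blast
    qed
    from nakayama_local[OF x(1) N B \<open>B \<subseteq> N\<close> this] show False using \<open>u \<in> N\<close> uB by blast
  qed
  then obtain w where w: "w \<in> N" "w \<notin> ?E" by blast
  then have wA: "w \<in> A" by (simp add: N_def)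
  \<comment> \<open>Modulo \<open>B + x A\<close> the class of \<open>w\<close> is nonzero and
    killed by the old prime and by \<open>x\<close>, which is not in the old prime. Any prime
    annihilator above it is therefore strictly larger.\<close>
  from exists_maximal_colon[OF A E(1) wA w(2)] obtain v where
    v: "v \<in> A" "primeideal (colon R M ?E v) R" "colon R M ?E w \<subseteq> colon R M ?E v" by blast
  obtain P :: "nat \<Rightarrow> 'a set" where P: "P 0 = colon R M ?E v"
    "\<forall>i\<le>length xs. primeideal (P i) R" "\<forall>i<length xs. P i \<subset> P (Suc i)"
    using Cons.IH[OF E(1,2) _ _ v(1,2)] Cons.prems(3,4) by auto
  have "x \<in> colon R M ?E v"
    using smult_in_ext_sub[OF A B x(2) wA] v(3) x(2) by (auto simp: colon_def)
  moreover have "x \<notin> ?p" using nzd u uB by (auto simp: colon_def nzd_mod_def)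
  moreover have "?p \<subseteq> colon R M ?E w" using w E(3) by (auto simp: N_def colon_def)
  ultimately have less: "?p \<subset> P 0" using P(1) v(3) by blast
  show ?case
  proof (intro exI conjI allI impI)
    show "case_nat ?p P 0 = ?p" by simp
    show "primeideal (case_nat ?p P i) R" if "i \<le> length (x # xs)" for i
      using that P(2) prime by (cases i) auto
    show "case_nat ?p P i \<subset> case_nat ?p P (Suc i)" if "i < length (x # xs)" for i
      using that P(3) less by (cases i) auto
  qed
qed

end

text \<open>The finitely many maximal annihilators of all the quotients are pooled and avoided at
  once. None of them contains the maximal ideal: each is the annihilator of a nonzero class, which
  would otherwise be a socle element. The modules may differ with \<open>j\<close>; only the primes
  of \<open>R\<close> have to be compared.\<close>

lemma (in noetherian_local_ring) exists_common_nzd: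
  assumes J: "finite J" and "\<And>j. j \<in> J \<Longrightarrow> local_noetherian_module R (M j)"
    and "\<And>j. j \<in> J \<Longrightarrow> submodule (A j) R (M j)" "\<And>j. j \<in> J \<Longrightarrow> submodule (B j) R (M j)"
    and ns: "\<And>j. j \<in> J \<Longrightarrow> no_socle R (M j) (A j) (B j)"
  shows "\<exists>x\<in>max_ideal R. \<forall>j\<in>J. nzd_mod (M j) (A j) (B j) x"
proof -
  have "\<forall>j\<in>J. \<exists>S. finite S \<and>
      (\<forall>P\<in>S. primeideal P R \<and> (\<exists>u\<in>A j. u \<notin> B j \<and> P = colon R (M j) (B j) u)) \<and>
      (\<forall>u\<in>A j. u \<notin> B j \<longrightarrow> (\<exists>P\<in>S. colon R (M j) (B j) u \<subseteq> P))"
    by (intro ballI local_noetherian_module.finite_primes_cover_zero_divisors assms)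
  then obtain S where S: "\<And>j. j \<in> J \<Longrightarrow> finite (S j)"
    "\<And>j P. j \<in> J \<Longrightarrow> P \<in> S j \<Longrightarrow> primeideal P R \<and> (\<exists>u\<in>A j. u \<notin> B j \<and> P = colon R (M j) (B j) u)"
    "\<And>j u. j \<in> J \<Longrightarrow> u \<in> A j \<Longrightarrow> u \<notin> B j \<Longrightarrow> \<exists>P\<in>S j. colon R (M j) (B j) u \<subseteq> P"
    by metis
  have "\<exists>x\<in>max_ideal R. \<forall>P\<in>(\<Union>j\<in>J. S j). x \<notin> P"
  proof (rule prime_avoidance)
    show "finite (\<Union>j\<in>J. S j)" using J S(1) by blast
    show "ideal (max_ideal R) R" using primeideal_max_ideal by (simp add: primeideal_def)
    fix P assume "P \<in> (\<Union>j\<in>J. S j)"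
    then obtain j where j: "j \<in> J" "P \<in> S j" by blast
    show "primeideal P R" using S(2)[OF j] by blast
    show "\<not> max_ideal R \<subseteq> P"
      using S(2)[OF j] ns[OF j(1)] by (auto simp: no_socle_def colon_def subset_iff)
  qed
  then obtain x where x: "x \<in> max_ideal R" "\<And>j P. j \<in> J \<Longrightarrow> P \<in> S j \<Longrightarrow> x \<notin> P" by blast
  have "nzd_mod (M j) (A j) (B j) x" if j: "j \<in> J" for j
    unfolding nzd_mod_def
  proof (intro ballI impI, rule ccontr)
    fix u assume u: "u \<in> A j" "x \<odot>\<^bsub>M j\<^esub> u \<in> B j" "u \<notin> B j"
    then have "x \<in> colon R (M j) (B j) u" using x(1) max_ideal_subset by (auto simp: colon_def)
    then show False using S(3)[OF j u(1,3)] x(2)[OF j] by blast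
  qed
  with x(1) show ?thesis by blast
qed

context local_noetherian_module
begin

lemma depth_ge_Suc_iff:
  "depth_ge R M (Suc k) A B \<longleftrightarrow> (\<exists>x\<in>max_ideal R. nzd_mod M A B x \<and> depth_ge R M k A (ext_sub M A B x))"
proof
  assume "depth_ge R M (Suc k) A B"
  then obtain x xs where "length xs = k" "set (x # xs) \<subseteq> max_ideal R" "wreg M A B (x # xs)"
    unfolding depth_ge_def by (metis length_Suc_conv)
  then show "\<exists>x\<in>max_ideal R. nzd_mod M A B x \<and> depth_ge R M k A (ext_sub M A B x)"
    by (auto simp: depth_ge_def)
next
  assume "\<exists>x\<in>max_ideal R. nzd_mod M A B x \<and> depth_ge R M k A (ext_sub M A B x)"
  then obtain x xs where "length xs = k" "set (x # xs) \<subseteq> max_ideal R" "wreg M A B (x # xs)"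
    by (auto simp: depth_ge_def)
  then show "depth_ge R M (Suc k) A B" unfolding depth_ge_def by (metis length_Cons)
qed

text \<open>The induction step replaces \<open>x\<close> and the first element \<open>y\<close> of a given regular sequence by an
  element \<open>z\<close> that is regular modulo both.\<close>

lemma depth_ge_ext_sub:
  assumes A: "submodule A R M"
  shows "\<lbrakk>submodule B R M; x \<in> max_ideal R; nzd_mod M A B x; depth_ge R M (Suc k) A B\<rbrakk>
    \<Longrightarrow> depth_ge R M k A (ext_sub M A B x)"
proof (induction k arbitrary: B x)
  case 0
  show ?case by (simp add: depth_ge_def)
next
  case (Suc k)
  note B = Suc.prems(1) and x = Suc.prems(2,3)
  obtain y where y: "y \<in> max_ideal R" "nzd_mod M A B y" and dy: "depth_ge R M (Suc k) A (ext_sub M A B y)"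
    using Suc.prems(4) depth_ge_Suc_iff by blast
  have c: "x \<in> carrier R" "y \<in> carrier R" using x y max_ideal_subset by auto
  have sE: "submodule (ext_sub M A B a) R M" if "a \<in> carrier R" for a
    using submodule_ext_sub[OF A B that] .
  have nsy: "no_socle R M A (ext_sub M A B y)"
    using dy no_socle_if_nzd_mod unfolding depth_ge_Suc_iff by blast
  have nsx: "no_socle R M A (ext_sub M A B x)"
    using no_socle_exchange[OF A B y c(1) x(2) nsy] .
  have "\<exists>z\<in>max_ideal R. \<forall>a\<in>{x, y}. nzd_mod M A (ext_sub M A B a) z"
    using nsx nsy sE c A by (intro exists_common_nzd) (auto intro: local_noetherian_module_axioms)
  then obtain z where z: "z \<in> max_ideal R" "nzd_mod M A (ext_sub M A B x) z"
    "nzd_mod M A (ext_sub M A B y) z" by auto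
  have zc: "z \<in> carrier R" using z max_ideal_subset by auto
  \<comment> \<open>The induction hypothesis is used twice, modulo \<open>y\<close> for the element
    \<open>z\<close> and then modulo \<open>z\<close> for the element \<open>x\<close>. Between the
    two, the order of the elements is swapped.\<close>
  have "depth_ge R M k A (ext_sub M A (ext_sub M A B y) z)"
    using Suc.IH[OF sE[OF c(2)] z(1,3) dy] .
  then have "depth_ge R M k A (ext_sub M A (ext_sub M A B z) y)"
    using ext_sub_commute[OF A B c(2) zc] by simp
  moreover have "nzd_mod M A (ext_sub M A B z) y" using nzd_mod_swap[OF A B c(2) zc y(2) z(3)] .
  ultimately have "depth_ge R M (Suc k) A (ext_sub M A B z)" using y(1) depth_ge_Suc_iff by blast
  moreover have "nzd_mod M A (ext_sub M A B z) x" using nzd_mod_swap[OF A B c(1) zc x(2) z(2)] .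
  ultimately have "depth_ge R M k A (ext_sub M A (ext_sub M A B z) x)"
    using Suc.IH[OF sE[OF zc] x(1)] by blast
  then have "depth_ge R M k A (ext_sub M A (ext_sub M A B x) z)"
    using ext_sub_commute[OF A B c(1) zc] by simp
  then show ?case using z depth_ge_Suc_iff by blast
qed

end

text \<open>The individual sequences may have no element in common. By
  \<open>depth_ge_ext_sub\<close> any common nonzerodivisor can come first in all the modules, each
  keeping depth \<open>k - 1\<close>, so a common sequence is built one element at a time.\<close>

lemma (in noetherian_local_ring) exists_common_wreg:
  assumes J: "finite J" and M: "\<And>j. j \<in> J \<Longrightarrow> local_noetherian_module R (M j)"
    and A: "\<And>j. j \<in> J \<Longrightarrow> submodule (A j) R (M j)"
  shows "\<lbrakk>\<And>j. j \<in> J \<Longrightarrow> submodule (B j) R (M j); \<And>j. j \<in> J \<Longrightarrow> depth_ge R (M j) k (A j) (B j)\<rbrakk>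
    \<Longrightarrow> \<exists>xs. length xs = k \<and> set xs \<subseteq> max_ideal R \<and> (\<forall>j\<in>J. wreg (M j) (A j) (B j) xs)"
proof (induction k arbitrary: B)
  case 0
  show ?case by (intro exI[of _ "[]"]) simp
next
  case (Suc k)
  have ns: "no_socle R (M j) (A j) (B j)" if j: "j \<in> J" for j
  proof -
    interpret local_noetherian_module R "M j" using M[OF j] .
    show ?thesis using Suc.prems(2)[OF j] no_socle_if_nzd_mod unfolding depth_ge_Suc_iff by blast
  qed
  have "\<exists>x\<in>max_ideal R. \<forall>j\<in>J. nzd_mod (M j) (A j) (B j) x"
    by (rule exists_common_nzd) (auto intro: J M A Suc.prems(1) ns)
  then obtain x where
    x: "x \<in> max_ideal R" "\<forall>j\<in>J. nzd_mod (M j) (A j) (B j) x" by blast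
  have xc: "x \<in> carrier R" using x max_ideal_subset by blast
  let ?E = "\<lambda>j. ext_sub (M j) (A j) (B j) x"
  have E: "submodule (?E j) R (M j)" "depth_ge R (M j) k (A j) (?E j)" if j: "j \<in> J" for j
  proof -
    interpret local_noetherian_module R "M j" using M[OF j] .
    show "submodule (?E j) R (M j)" using submodule_ext_sub A Suc.prems(1) j xc by blast
    show "depth_ge R (M j) k (A j) (?E j)" using depth_ge_ext_sub A Suc.prems j x by blast
  qed
  have "\<exists>xs. length xs = k \<and> set xs \<subseteq> max_ideal R \<and> (\<forall>j\<in>J. wreg (M j) (A j) (?E j) xs)"
    by (rule Suc.IH) (auto intro: E)
  then obtain xs where
    "length xs = k" "set xs \<subseteq> max_ideal R" "\<forall>j\<in>J. wreg (M j) (A j) (?E j) xs" by blast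
  then show ?case using x by (intro exI[of _ "x # xs"]) auto
qed

section \<open>Quotient modules, depth and dimension\<close>

lemma ring_module_simps [simp]:
  "carrier (ring_module R) = carrier R" "\<zero>\<^bsub>ring_module R\<^esub> = \<zero>\<^bsub>R\<^esub>"
  "x \<oplus>\<^bsub>ring_module R\<^esub> y = x \<oplus>\<^bsub>R\<^esub> y" "x \<odot>\<^bsub>ring_module R\<^esub> y = x \<otimes>\<^bsub>R\<^esub> y"
  "\<ominus>\<^bsub>ring_module R\<^esub> x = \<ominus>\<^bsub>R\<^esub> x" "x \<ominus>\<^bsub>ring_module R\<^esub> y = x \<ominus>\<^bsub>R\<^esub> y"
  by (simp_all add: ring_module_def a_inv_def a_minus_def m_inv_def)

lemma (in cring) module_ring_module: "module R (ring_module R)"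
proof (rule moduleI)
  show "cring R" ..
  show "abelian_group (ring_module R)"
    by (rule abelian_groupI) (auto simp: a_ac intro: l_neg)
qed (auto simp: l_distr r_distr m_assoc)

lemma (in cring) submodule_ring_module_iff: "submodule N R (ring_module R) \<longleftrightarrow> ideal N R"
proof
  assume N: "submodule N R (ring_module R)"
  show "ideal N R"
  proof (rule idealI)
    show "subgroup N (add_monoid R)"
      using submodule.axioms(1)[OF N] by (simp add: ring_module_def subgroup_def m_inv_def)
    have Nc: "N \<subseteq> carrier R"
      using module.submoduleE(1)[OF module_ring_module N] by simp
    show mult: "x \<otimes> a \<in> N" if "a \<in> N" "x \<in> carrier R" for a x
      using submodule.smult_closed[OF N that(2,1)] by simp
    show "a \<otimes> x \<in> N" if "a \<in> N" "x \<in> carrier R" for a x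
      using mult[OF that] that Nc m_comm[of a x] by auto
  qed (rule ring_axioms)
next
  assume N: "ideal N R"
  interpret ideal N R by fact
  show "submodule N R (ring_module R)"
  proof (intro submodule.intro submodule_axioms.intro)
    show "subgroup N (add_monoid (ring_module R))"
      using a_subgroup by (simp add: ring_module_def subgroup_def m_inv_def)
  qed (simp add: I_l_closed)
qed

context module
begin

lemma ideal_colon_carrier:
  assumes N: "submodule N R M"
  shows "ideal {a \<in> carrier R. \<forall>u\<in>carrier M. a \<odot>\<^bsub>M\<^esub> u \<in> N} R"
proof (rule idealI)
  show "ring R" ..
  let ?J = "{a \<in> carrier R. \<forall>u\<in>carrier M. a \<odot>\<^bsub>M\<^esub> u \<in> N}"
  show "subgroup ?J (add_monoid R)"
  proof (rule R.add.subgroupI)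
    have "\<zero>\<^bsub>R\<^esub> \<in> ?J" using sub_zero[OF N] by simp
    then show "?J \<noteq> {}" by blast
    show "\<ominus>\<^bsub>R\<^esub> a \<in> ?J" if "a \<in> ?J" for a
      using that sub_neg[OF N] by (simp add: smult_l_minus)
    show "a \<oplus>\<^bsub>R\<^esub> b \<in> ?J" if "a \<in> ?J" "b \<in> ?J" for a b
      using that sub_add[OF N] by (simp add: smult_l_distr)
  qed auto
  fix a x assume ax: "a \<in> ?J" "x \<in> carrier R"
  then show "x \<otimes>\<^bsub>R\<^esub> a \<in> ?J" using sub_smult[OF N] by (simp add: smult_assoc1)
  then show "a \<otimes>\<^bsub>R\<^esub> x \<in> ?J" using ax by (simp add: R.m_comm)
qed

lemma submodule_zero: "submodule {\<zero>\<^bsub>M\<^esub>} R M"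
  using M.add.inv_one by (intro submoduleI) auto

lemma ideal_annihilator:
  assumes "U \<subseteq> carrier M"
  shows "ideal (annihilator R M U) R"
proof (rule idealI)
  show "ring R" ..
  show "subgroup (annihilator R M U) (add_monoid R)"
  proof (rule R.add.subgroupI)
    have "\<zero>\<^bsub>R\<^esub> \<in> annihilator R M U" using assms by (auto simp: annihilator_def)
    then show "annihilator R M U \<noteq> {}" by blast
    show "\<ominus>\<^bsub>R\<^esub> a \<in> annihilator R M U" if "a \<in> annihilator R M U" for a
      using that assms M.add.inv_one by (auto simp: annihilator_def smult_l_minus subset_iff)
    show "a \<oplus>\<^bsub>R\<^esub> b \<in> annihilator R M U" if "a \<in> annihilator R M U" "b \<in> annihilator R M U" for a b
      using that assms by (auto simp: annihilator_def smult_l_distr subset_iff)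
  qed (auto simp: annihilator_def)
  fix a x assume ax: "a \<in> annihilator R M U" "x \<in> carrier R"
  then show "x \<otimes>\<^bsub>R\<^esub> a \<in> annihilator R M U"
    using assms by (auto simp: annihilator_def smult_assoc1 subset_iff)
  then show "a \<otimes>\<^bsub>R\<^esub> x \<in> annihilator R M U"
    using ax by (simp add: R.m_comm annihilator_def)
qed

lemma wreg_self:
  assumes "submodule A R M" "set xs \<subseteq> carrier R"
  shows "wreg M A A xs"
  using assms(2)
proof (induction xs)
  case (Cons x xs)
  then have "ext_sub M A A x = A"
    using ext_sub_subset[OF assms(1,1)] ext_sub_superset[OF assms(1,1)] by auto
  then show ?case using Cons by (auto simp: nzd_mod_def)
qed simp

text \<open>Links the recursion of \<open>wreg\<close> to the indexed condition in
  \<open>regular_sequence\<close>.\<close>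

lemma wreg_iff_nth:
  "wreg M A B xs \<longleftrightarrow>
    (\<forall>i<length xs. nzd_mod M A (fold (\<lambda>x N. ext_sub M A N x) (take i xs) B) (xs ! i))"
proof (induction xs arbitrary: B)
  case (Cons x xs)
  show ?case
    unfolding wreg.simps Cons.IH by (simp add: All_less_Suc2)
qed simp

lemma ideal_mult_module_empty: "ideal_mult_module R {} M = {\<zero>\<^bsub>M\<^esub>}"
proof -
  have "Idl\<^bsub>R\<^esub> {} \<subseteq> {\<zero>\<^bsub>R\<^esub>}" using R.zeroideal R.genideal_minimal by blast
  then have "{a \<odot>\<^bsub>M\<^esub> x | a x. a \<in> Idl\<^bsub>R\<^esub> {} \<and> x \<in> carrier M} \<subseteq> {\<zero>\<^bsub>M\<^esub>}" by auto
  then have "ideal_mult_module R {} M \<subseteq> {\<zero>\<^bsub>M\<^esub>}"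
    unfolding ideal_mult_module_def by (rule gen_submodule_least[OF submodule_zero])
  moreover have "\<zero>\<^bsub>M\<^esub> \<in> ideal_mult_module R {} M"
    unfolding ideal_mult_module_def by (auto simp: gen_submodule_def sub_zero)
  ultimately show ?thesis by blast
qed

lemma submodule_ideal_mult_module:
  assumes "S \<subseteq> carrier R"
  shows "submodule (ideal_mult_module R S M) R M"
  unfolding ideal_mult_module_def
  using R.genideal_ideal[OF assms] by (intro submodule_gen_submodule) (auto intro: ideal.Icarr)

lemma smult_in_ideal_mult_module:
  "a \<in> Idl\<^bsub>R\<^esub> S \<Longrightarrow> u \<in> carrier M \<Longrightarrow> a \<odot>\<^bsub>M\<^esub> u \<in> ideal_mult_module R S M"
  unfolding ideal_mult_module_def by (rule subsetD[OF gen_submodule_superset]) blast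

text \<open>The ring elements that carry \<open>M\<close> into a fixed submodule form an ideal, so
  the nontrivial inclusion need only be tested on the generators \<open>insert y S\<close>.\<close>

lemma ideal_mult_module_insert:
  assumes S: "S \<subseteq> carrier R" and y: "y \<in> carrier R"
  shows "ideal_mult_module R (insert y S) M =
    ext_sub M (carrier M) (ideal_mult_module R S M) y" (is "?L = ?E")
proof
  have sub: "submodule (ideal_mult_module R S M) R M" by (rule submodule_ideal_mult_module[OF S])
  have E: "submodule ?E R M" by (rule submodule_ext_sub[OF carrier_is_submodule sub y])
  have "insert y S \<subseteq> {a \<in> carrier R. \<forall>u\<in>carrier M. a \<odot>\<^bsub>M\<^esub> u \<in> ?E}"
  proof -
    have "y \<odot>\<^bsub>M\<^esub> u \<in> ?E" if "u \<in> carrier M" for u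
      using smult_in_ext_sub[OF carrier_is_submodule sub y that] .
    moreover have "s \<odot>\<^bsub>M\<^esub> u \<in> ?E" if "s \<in> S" "u \<in> carrier M" for s u
    proof -
      have "s \<in> Idl\<^bsub>R\<^esub> S" using R.genideal_self[OF S] that by blast
      then have "s \<odot>\<^bsub>M\<^esub> u \<in> ideal_mult_module R S M"
        using smult_in_ideal_mult_module that(2) by blast
      then show ?thesis using ext_sub_superset[OF carrier_is_submodule sub y] by blast
    qed
    ultimately show ?thesis using S y by auto
  qed
  then have "Idl\<^bsub>R\<^esub> (insert y S) \<subseteq> {a \<in> carrier R. \<forall>u\<in>carrier M. a \<odot>\<^bsub>M\<^esub> u \<in> ?E}"
    by (rule R.genideal_minimal[OF ideal_colon_carrier[OF E]])
  then show "?L \<subseteq> ?E"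
    unfolding ideal_mult_module_def[of R "insert y S"] by (intro gen_submodule_least[OF E]) auto
  have yS: "insert y S \<subseteq> carrier R" using S y by auto
  have L: "submodule ?L R M" by (rule submodule_ideal_mult_module[OF yS])
  have "Idl\<^bsub>R\<^esub> S \<subseteq> Idl\<^bsub>R\<^esub> (insert y S)" using R.subset_Idl_subset[OF yS] by blast
  then have SL: "ideal_mult_module R S M \<subseteq> ?L"
    unfolding ideal_mult_module_def[of R S] using smult_in_ideal_mult_module
    by (intro gen_submodule_least[OF L]) blast
  have "y \<in> Idl\<^bsub>R\<^esub> (insert y S)" using R.genideal_self[OF yS] by blast
  then have yL: "y \<odot>\<^bsub>M\<^esub> u \<in> ?L" if "u \<in> carrier M" for u
    using smult_in_ideal_mult_module that by blast
  show "?E \<subseteq> ?L"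
  proof
    fix u assume "u \<in> ?E"
    then obtain a where "u \<in> carrier M" "a \<in> carrier M" "u \<ominus>\<^bsub>M\<^esub> y \<odot>\<^bsub>M\<^esub> a \<in> ideal_mult_module R S M"
      by (auto simp: ext_sub_def)
    then show "u \<in> ?L" using sub_minus_cancel[OF L] SL yL by blast
  qed
qed

lemma ideal_mult_module_set:
  "set xs \<subseteq> carrier R \<Longrightarrow>
    ideal_mult_module R (set xs) M = fold (\<lambda>x N. ext_sub M (carrier M) N x) xs {\<zero>\<^bsub>M\<^esub>}"
  by (induction xs rule: rev_induct) (auto simp: ideal_mult_module_empty ideal_mult_module_insert)

section \<open>Cosets and quotient modules\<close>

lemma abelian_subgroup_if_submodule:
  assumes "submodule N R M"
  shows "abelian_subgroup N M"
  using submodule.axioms(1)[OF assms]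
  by (intro abelian_subgroupI3 additive_subgroupI) (auto intro: M.abelian_group_axioms)

lemma carrier_quot_module: "carrier (quot_module M N) = (\<lambda>u. N +>\<^bsub>M\<^esub> u) ` carrier M"
  by (auto simp: quot_module_def A_RCOSETS_def')

lemma zero_quot_module: "\<zero>\<^bsub>quot_module M N\<^esub> = N"
  by (simp add: quot_module_def)

lemma rcos_eq_iff:
  assumes N: "submodule N R M" and uv: "u \<in> carrier M" "v \<in> carrier M"
  shows "N +>\<^bsub>M\<^esub> u = N +>\<^bsub>M\<^esub> v \<longleftrightarrow> u \<ominus>\<^bsub>M\<^esub> v \<in> N"
proof -
  interpret abelian_subgroup N M by (rule abelian_subgroup_if_submodule[OF N])
  have "u \<ominus>\<^bsub>M\<^esub> v \<in> N \<longleftrightarrow> u \<in> N +>\<^bsub>M\<^esub> v"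
    using a_rcos_module[OF uv(2,1)] by (simp add: M.minus_eq)
  also have "\<dots> \<longleftrightarrow> N +>\<^bsub>M\<^esub> u = N +>\<^bsub>M\<^esub> v"
    using a_repr_independence'[OF _ uv(2)] a_rcos_self[OF uv(1)] by metis
  finally show ?thesis by simp
qed

lemma rcos_eq_zero_iff:
  assumes N: "submodule N R M" and u: "u \<in> carrier M"
  shows "N +>\<^bsub>M\<^esub> u = N \<longleftrightarrow> u \<in> N"
proof -
  interpret abelian_subgroup N M by (rule abelian_subgroup_if_submodule[OF N])
  have "N +>\<^bsub>M\<^esub> \<zero>\<^bsub>M\<^esub> = N" using a_rcos_const[OF sub_zero[OF N]] .
  then show ?thesis using rcos_eq_iff[OF N u M.zero_closed] u by simp
qed

lemma add_quot_module:
  assumes N: "submodule N R M" and "u \<in> carrier M" "v \<in> carrier M"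
  shows "(N +>\<^bsub>M\<^esub> u) \<oplus>\<^bsub>quot_module M N\<^esub> (N +>\<^bsub>M\<^esub> v) = N +>\<^bsub>M\<^esub> (u \<oplus>\<^bsub>M\<^esub> v)"
proof -
  interpret abelian_subgroup N M by (rule abelian_subgroup_if_submodule[OF N])
  show ?thesis using a_rcos_sum assms by (simp add: quot_module_def)
qed

lemma smult_quot_module:
  assumes N: "submodule N R M" and a: "a \<in> carrier R" and u: "u \<in> carrier M"
  shows "a \<odot>\<^bsub>quot_module M N\<^esub> (N +>\<^bsub>M\<^esub> u) = N +>\<^bsub>M\<^esub> (a \<odot>\<^bsub>M\<^esub> u)"
proof -
  interpret abelian_subgroup N M by (rule abelian_subgroup_if_submodule[OF N])
  have "N +>\<^bsub>M\<^esub> (a \<odot>\<^bsub>M\<^esub> v) = N +>\<^bsub>M\<^esub> (a \<odot>\<^bsub>M\<^esub> u)" if v: "v \<in> N +>\<^bsub>M\<^esub> u" for v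
  proof -
    have vc: "v \<in> carrier M" using a_elemrcos_carrier[OF u v] .
    have "v \<ominus>\<^bsub>M\<^esub> u \<in> N" using a_rcos_module_imp[OF u v] by (simp add: M.minus_eq)
    from sub_smult[OF N a this] show ?thesis
      using rcos_eq_iff[OF N, of "a \<odot>\<^bsub>M\<^esub> v" "a \<odot>\<^bsub>M\<^esub> u"] a u vc by (simp add: module_simps)
  qed
  moreover have "u \<in> N +>\<^bsub>M\<^esub> u" using a_rcos_self[OF u] .
  ultimately have "(\<Union>v\<in>N +>\<^bsub>M\<^esub> u. N +>\<^bsub>M\<^esub> (a \<odot>\<^bsub>M\<^esub> v)) = N +>\<^bsub>M\<^esub> (a \<odot>\<^bsub>M\<^esub> u)" by blast
  then show ?thesis by (simp add: quot_module_def)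
qed

lemma module_quot_module:
  assumes N: "submodule N R M"
  shows "module R (quot_module M N)"
proof (rule moduleI)
  let ?Q = "quot_module M N"
  note simps = carrier_quot_module add_quot_module[OF N] smult_quot_module[OF N]
  have zero: "\<zero>\<^bsub>?Q\<^esub> = N +>\<^bsub>M\<^esub> \<zero>\<^bsub>M\<^esub>"
    using rcos_eq_zero_iff[OF N M.zero_closed] sub_zero[OF N] by (simp add: zero_quot_module)
  show "cring R" ..
  show "abelian_group ?Q"
  proof (rule abelian_groupI)
    fix U assume "U \<in> carrier ?Q"
    then obtain u where u: "u \<in> carrier M" "U = N +>\<^bsub>M\<^esub> u" by (auto simp: simps)
    show "\<zero>\<^bsub>?Q\<^esub> \<oplus>\<^bsub>?Q\<^esub> U = U" using u by (simp add: zero simps)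
    show "\<exists>V\<in>carrier ?Q. V \<oplus>\<^bsub>?Q\<^esub> U = \<zero>\<^bsub>?Q\<^esub>"
      using u by (intro bexI[of _ "N +>\<^bsub>M\<^esub> (\<ominus>\<^bsub>M\<^esub> u)"]) (auto simp: zero simps M.l_neg)
  qed (auto simp: simps zero M.a_ac)
qed (auto simp: carrier_quot_module add_quot_module[OF N] smult_quot_module[OF N]
    smult_l_distr smult_r_distr smult_assoc1)

lemma nonzerodivisor_on_quot_module_iff:
  assumes N: "submodule N R M" and x: "x \<in> carrier R"
  shows "nonzerodivisor_on (quot_module M N) x \<longleftrightarrow> nzd_mod M (carrier M) N x"
  using x by (auto simp: nonzerodivisor_on_def nzd_mod_def carrier_quot_module zero_quot_module
      smult_quot_module[OF N] rcos_eq_zero_iff[OF N])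

lemma regular_sequence_iff:
  "regular_sequence R M xs \<longleftrightarrow> set xs \<subseteq> carrier R \<and> wreg M (carrier M) {\<zero>\<^bsub>M\<^esub>} xs \<and>
    fold (\<lambda>x N. ext_sub M (carrier M) N x) xs {\<zero>\<^bsub>M\<^esub>} \<noteq> carrier M"
proof (cases "set xs \<subseteq> carrier R")
  case True
  have "nonzerodivisor_on (quot_module M (ideal_mult_module R (set (take i xs)) M)) (xs ! i) \<longleftrightarrow>
      nzd_mod M (carrier M) (fold (\<lambda>x N. ext_sub M (carrier M) N x) (take i xs) {\<zero>\<^bsub>M\<^esub>}) (xs ! i)"
    if "i < length xs" for i
  proof -
    have t: "set (take i xs) \<subseteq> carrier R" using set_take_subset[of i xs] True by blast
    have "xs ! i \<in> carrier R" using True that by auto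
    then show ?thesis
      using nonzerodivisor_on_quot_module_iff[OF submodule_ideal_mult_module[OF t]]
      by (simp add: ideal_mult_module_set[OF t])
  qed
  then show ?thesis
    using True by (auto simp: regular_sequence_def wreg_iff_nth ideal_mult_module_set)
qed (simp add: regular_sequence_def)

lemma wreg_quot_module_iff:
  assumes N: "submodule N R M" and xs: "set xs \<subseteq> carrier R"
  shows "wreg (quot_module M N) (carrier (quot_module M N)) {\<zero>\<^bsub>quot_module M N\<^esub>} xs \<longleftrightarrow>
    wreg M (carrier M) N xs"
proof (rule wreg_transport[symmetric, where h = "\<lambda>u. N +>\<^bsub>M\<^esub> u"])
  interpret Q: module R "quot_module M N" by (rule module_quot_module[OF N])
  show "module R (quot_module M N)" ..
  show "submodule (carrier (quot_module M N)) R (quot_module M N)" by (rule Q.carrier_is_submodule)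
  show "submodule {\<zero>\<^bsub>quot_module M N\<^esub>} R (quot_module M N)" by (rule Q.submodule_zero)
  show "\<exists>u\<in>carrier M. w \<ominus>\<^bsub>quot_module M N\<^esub> (N +>\<^bsub>M\<^esub> u) \<in> {\<zero>\<^bsub>quot_module M N\<^esub>}"
    if w: "w \<in> carrier (quot_module M N)" for w
  proof -
    obtain u where "u \<in> carrier M" "w = N +>\<^bsub>M\<^esub> u" using w by (auto simp: carrier_quot_module)
    then show ?thesis using w by (intro bexI[of _ u]) (auto simp: Q.M.minus_eq Q.M.r_neg)
  qed
qed (use assms carrier_is_submodule in \<open>auto simp: carrier_quot_module zero_quot_module
    add_quot_module smult_quot_module rcos_eq_zero_iff\<close>)

text \<open>Koszul homology is a quotient of the record whose carrier is cut down to the cycles.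
  This brings its regular sequences back to pairs of submodules of the Koszul module.\<close>

lemma wreg_carrier_update_iff:
  assumes A: "submodule A R M" and B: "submodule B R M" "B \<subseteq> A" and xs: "set xs \<subseteq> carrier R"
  shows "wreg (M\<lparr>carrier := A\<rparr>) A B xs \<longleftrightarrow> wreg M A B xs"
proof -
  let ?A = "M\<lparr>carrier := A\<rparr>"
  interpret A: module R ?A using submodule.submodule_is_module[OF A] module_axioms by blast
  have "module R (?A\<lparr>carrier := B\<rparr>)"
    using submodule.submodule_is_module[OF B(1)] module_axioms by simp
  then have "submodule B R ?A" using A.module_incl_imp_submodule B(2) by simp
  moreover have "w \<ominus>\<^bsub>M\<^esub> id w \<in> B" if "w \<in> A" for w
    using that sub_zero[OF B(1)] sub_carrier[OF A] by (simp add: M.minus_eq M.r_neg)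
  ultimately show ?thesis
    using A.carrier_is_submodule A B xs
    by (intro A.wreg_transport[where h = id] module_axioms) auto
qed

lemma submodule_carrier_update:
  assumes A: "submodule A R M" and B: "submodule B R M" "B \<subseteq> A"
  shows "submodule B R (M\<lparr>carrier := A\<rparr>)"
proof -
  interpret A: module R "M\<lparr>carrier := A\<rparr>"
    using submodule.submodule_is_module[OF A] module_axioms by blast
  have "module R (M\<lparr>carrier := A\<rparr>\<lparr>carrier := B\<rparr>)"
    using submodule.submodule_is_module[OF B(1)] module_axioms by simp
  then show ?thesis using A.module_incl_imp_submodule B(2) by simp
qed

end

text \<open>The empty supremum is 0, hence the positivity of \<open>k\<close>. If all members were
  below \<open>k\<close>, then \<open>k - 1\<close> would bound them.\<close>

lemma enat_le_Sup_imp: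
  assumes "enat k \<le> Sup {enat n | n. Q n}" "0 < k"
  shows "\<exists>n\<ge>k. Q n"
proof (rule ccontr)
  assume no: "\<not> ?thesis"
  have "Sup {enat n | n. Q n} \<le> enat (k - 1)"
  proof (rule Sup_least)
    fix x assume "x \<in> {enat n | n. Q n}"
    then obtain n where n: "x = enat n" "Q n" by blast
    then have "\<not> n \<ge> k" using no by blast
    then show "x \<le> enat (k - 1)" by (simp add: n)
  qed
  with assms(1) have "enat k \<le> enat (k - 1)" by (rule order_trans)
  then show False using assms(2) by simp
qed

text \<open>Comparing suprema through their finite lower bounds makes a finiteness proof for the
  Krull dimension unnecessary.\<close>

lemma enat_le_if_all_nat_le:
  assumes "\<And>k. enat k \<le> a \<Longrightarrow> enat k \<le> b"
  shows "a \<le> b"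
proof (rule ccontr)
  assume "\<not> a \<le> b"
  then obtain n where n: "b = enat n" "enat n < a" by (cases b) auto
  then have "enat (Suc n) \<le> a" using ileI1 by (fastforce simp: eSuc_enat)
  from assms[OF this] n show False by simp
qed

lemma (in module) depth_ge_imp_wreg:
  assumes k: "enat k \<le> depth R M"
  shows "\<exists>xs. length xs = k \<and> set xs \<subseteq> max_ideal R \<and> wreg M (carrier M) {\<zero>\<^bsub>M\<^esub>} xs"
proof (cases k)
  \<comment> \<open>At \<open>k = 0\<close> the supremum may be empty, as for the zero module; the
    empty sequence still serves.\<close>
  case 0
  then show ?thesis by (intro exI[of _ "[]"]) simp
next
  case Suc
  have "{enat (length xs) | xs. set xs \<subseteq> max_ideal R \<and> regular_sequence R M xs} =
      {enat n | n. \<exists>xs. length xs = n \<and> set xs \<subseteq> max_ideal R \<and> regular_sequence R M xs}" by auto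
  then obtain xs where "length xs \<ge> k" "set xs \<subseteq> max_ideal R" "regular_sequence R M xs"
    using k enat_le_Sup_imp[of k "\<lambda>n. \<exists>xs. length xs = n \<and> set xs \<subseteq> max_ideal R \<and> regular_sequence R M xs"] Suc
    unfolding depth_def by auto
  then show ?thesis
    using set_take_subset[of k xs]
    by (intro exI[of _ "take k xs"]) (auto simp: regular_sequence_iff intro: wreg_take)
qed

lemma (in noetherian_local_ring) krull_dim_ge_imp_prime_chain:
  assumes k: "enat k \<le> krull_dim R"
  shows "\<exists>P :: nat \<Rightarrow> 'a set. (\<forall>i\<le>k. primeideal (P i) R) \<and> (\<forall>i<k. P i \<subset> P (Suc i))"
proof (cases k)
  case 0
  then show ?thesis using primeideal_max_ideal by (intro exI[of _ "\<lambda>_. max_ideal R"]) simp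
next
  case Suc
  then obtain n and P :: "nat \<Rightarrow> 'a set"
    where "n \<ge> k" "\<forall>i\<le>n. primeideal (P i) R" "\<forall>i<n. P i \<subset> P (Suc i)"
    using enat_le_Sup_imp[OF k[unfolded krull_dim_def]] by auto
  then show ?thesis by (intro exI[of _ P]) auto
qed

lemma (in cring) primeideal_quot:
  assumes J: "ideal J R" and P: "primeideal P R" "J \<subseteq> P"
  shows "primeideal ((+>) J ` P) (R Quot J)"
proof (rule primeidealI)
  have iP: "ideal P R" using P by (simp add: primeideal_def)
  show "ideal ((+>) J ` P) (R Quot J)" by (rule ring_ideal_imp_quot_ideal[OF J iP])
  show "cring (R Quot J)" by (rule ideal.quotient_is_cring[OF J is_cring])
  have mem: "a \<in> P" if "a \<in> carrier R" "J +> a \<in> (+>) J ` P" for a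
  proof -
    have "(+>) J ` P \<subseteq> carrier (R Quot J)"
      using iP by (auto simp: FactRing_def A_RCOSETS_def' dest: ideal.Icarr)
    from canonical_proj_vimage_mem_iff[OF J this that(1)] that(2) have "a \<in> (\<Union>j\<in>P. J +> j)" by blast
    then show ?thesis using ideal_incl_iff[OF J iP] P(2) by blast
  qed
  have carr: "carrier (R Quot J) = (+>) J ` carrier R"
    by (auto simp: FactRing_def A_RCOSETS_def')
  have "\<one> \<notin> P" using ideal.one_imp_carrier[OF iP] primeideal.I_notcarr[OF P(1)] by blast
  then show "carrier (R Quot J) \<noteq> (+>) J ` P" unfolding carr using mem[of \<one>] by blast
  fix U V assume UV: "U \<in> carrier (R Quot J)" "V \<in> carrier (R Quot J)"
    "U \<otimes>\<^bsub>R Quot J\<^esub> V \<in> (+>) J ` P"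
  then obtain a b where ab: "a \<in> carrier R" "b \<in> carrier R" "U = J +> a" "V = J +> b"
    by (auto simp: carr)
  have "U \<otimes>\<^bsub>R Quot J\<^esub> V = J +> (a \<otimes> b)"
    using ideal.rcoset_mult_add[OF J ab(1,2)] ab by (simp add: FactRing_def)
  then have "a \<otimes> b \<in> P" using mem[of "a \<otimes> b"] UV(3) ab by simp
  then show "U \<in> (+>) J ` P \<or> V \<in> (+>) J ` P"
    using primeideal.I_prime[OF P(1) ab(1,2)] ab by blast
qed

text \<open>The images stay distinct because \<open>P i\<close> contains \<open>J\<close> and so is
  the union of the cosets in its image.\<close>

lemma (in cring) krull_dim_quot_ge:
  assumes J: "ideal J R" and P: "\<And>i. i \<le> k \<Longrightarrow> primeideal (P i) R" "\<And>i. i < k \<Longrightarrow> P i \<subset> P (Suc i)"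
    and J0: "J \<subseteq> P 0"
  shows "enat k \<le> krull_dim (R Quot J)"
proof -
  have JP: "J \<subseteq> P i" if "i \<le> k" for i
    using that by (induction i) (use J0 P(2) in \<open>auto simp: Suc_le_eq\<close>)
  have idl: "ideal (P i) R" if "i \<le> k" for i using P(1)[OF that] by (simp add: primeideal_def)
  have less: "(+>) J ` P i \<subset> (+>) J ` P (Suc i)" if i: "i < k" for i
  proof -
    have "(\<Union>j\<in>P i. J +> j) = P i" "(\<Union>j\<in>P (Suc i). J +> j) = P (Suc i)"
      using ideal_incl_iff[OF J idl] JP i by (auto simp: Suc_le_eq)
    then have "(+>) J ` P i \<noteq> (+>) J ` P (Suc i)" using P(2)[OF i] by (metis psubsetE subset_refl)
    then show ?thesis using P(2)[OF i] by blast
  qed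
  show ?thesis unfolding krull_dim_def
    by (intro Sup_upper CollectI exI[of _ k] conjI refl exI[of _ "\<lambda>i. (+>) J ` P i"])
      (use primeideal_quot[OF J P(1) JP] less in auto)
qed

text \<open>A nonzero module has an associated prime, above which a regular sequence produces a
  chain of primes of its own length.\<close>

lemma (in local_noetherian_module) depth_le_krull_dim:
  assumes "carrier M \<noteq> {\<zero>\<^bsub>M\<^esub>}"
  shows "depth R M \<le> krull_dim R"
  unfolding depth_def
proof (rule Sup_least)
  fix d assume "d \<in> {enat (length xs) | xs. set xs \<subseteq> max_ideal R \<and> regular_sequence R M xs}"
  then obtain xs where xs: "d = enat (length xs)" "set xs \<subseteq> max_ideal R" "wreg M (carrier M) {\<zero>\<^bsub>M\<^esub>} xs"
    by (auto simp: regular_sequence_iff)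
  obtain w where w: "w \<in> carrier M" "w \<notin> {\<zero>\<^bsub>M\<^esub>}" using assms M.zero_closed by blast
  obtain u where u: "u \<in> carrier M" "primeideal (colon R M {\<zero>\<^bsub>M\<^esub>} u) R"
    using exists_maximal_colon[OF carrier_is_submodule submodule_zero w] by blast
  obtain P :: "nat \<Rightarrow> 'a set" where "\<forall>i\<le>length xs. primeideal (P i) R" "\<forall>i<length xs. P i \<subset> P (Suc i)"
    using exists_prime_chain[OF carrier_is_submodule submodule_zero _ xs(2,3) u] by auto
  then show "d \<le> krull_dim R" unfolding krull_dim_def xs(1) by (intro Sup_upper) auto
qed

lemma (in local_noetherian_module) wreg_imp_depth_ge:
  assumes "carrier M \<noteq> {\<zero>\<^bsub>M\<^esub>}" "set xs \<subseteq> max_ideal R" "wreg M (carrier M) {\<zero>\<^bsub>M\<^esub>} xs"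
  shows "enat (length xs) \<le> depth R M"
proof -
  have "\<not> carrier M \<subseteq> fold (\<lambda>x N. ext_sub M (carrier M) N x) xs {\<zero>\<^bsub>M\<^esub>}"
    using assms by (intro wreg_imp_proper) (auto intro: carrier_is_submodule submodule_zero)
  then have "regular_sequence R M xs"
    using assms max_ideal_subset by (auto simp: regular_sequence_iff)
  then show ?thesis unfolding depth_def using assms(2) by (intro Sup_upper) auto
qed

lemma (in noetherian_local_ring) local_noetherian_ring_module:
  "local_noetherian_module R (ring_module R)"
proof (intro local_noetherian_module.intro local_noetherian_module_axioms.intro)
  show "module R (ring_module R)" by (rule module_ring_module)
  show "noetherian_local_ring R" ..
qed (simp add: ideal_family_maximal submodule_ring_module_iff)

text \<open>Preimages embed the ordered set of submodules of the quotient into that of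
  \<open>M\<close>.\<close>

lemma (in local_noetherian_module) local_noetherian_quot_module:
  assumes N: "submodule N R M"
  shows "local_noetherian_module R (quot_module M N)"
proof (intro local_noetherian_module.intro local_noetherian_module_axioms.intro)
  let ?Q = "quot_module M N"
  interpret Q: module R ?Q by (rule module_quot_module[OF N])
  show "module R ?Q" ..
  show "noetherian_local_ring R" ..
  define pre where "pre L = {u \<in> carrier M. N +>\<^bsub>M\<^esub> u \<in> L}" for L
  have pre: "submodule (pre L) R M" if L: "submodule L R ?Q" for L
  proof (rule submoduleI)
    have "\<zero>\<^bsub>?Q\<^esub> = N +>\<^bsub>M\<^esub> \<zero>\<^bsub>M\<^esub>"
      using rcos_eq_zero_iff[OF N M.zero_closed] sub_zero[OF N] by (simp add: zero_quot_module)
    then show "\<zero>\<^bsub>M\<^esub> \<in> pre L" using Q.sub_zero[OF L] by (simp add: pre_def)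
    fix u assume u: "u \<in> pre L"
    show sm: "a \<odot>\<^bsub>M\<^esub> u \<in> pre L" if "a \<in> carrier R" for a
      using u Q.sub_smult[OF L that, of "N +>\<^bsub>M\<^esub> u"] that by (simp add: pre_def smult_quot_module[OF N])
    show "\<ominus>\<^bsub>M\<^esub> u \<in> pre L"
      using sm[of "\<ominus>\<^bsub>R\<^esub> \<one>\<^bsub>R\<^esub>"] u by (simp add: smult_l_minus pre_def)
    fix v assume v: "v \<in> pre L"
    show "u \<oplus>\<^bsub>M\<^esub> v \<in> pre L"
      using u v Q.sub_add[OF L, of "N +>\<^bsub>M\<^esub> u" "N +>\<^bsub>M\<^esub> v"] by (simp add: pre_def add_quot_module[OF N])
  qed (auto simp: pre_def)
  have le: "L \<subseteq> L'" if "submodule L R ?Q" "pre L \<subseteq> pre L'" for L L'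
    using that Q.sub_carrier[OF that(1)] by (fastforce simp: pre_def carrier_quot_module)
  fix S assume S: "S \<noteq> {}" "\<And>L. L \<in> S \<Longrightarrow> submodule L R ?Q"
  then obtain L where L: "L \<in> S" "\<forall>K\<in>pre ` S. pre L \<subseteq> K \<longrightarrow> K = pre L"
    using submodule_family_maximal[of "pre ` S"] pre by auto
  have "K = L" if "K \<in> S" "L \<subseteq> K" for K
  proof -
    have "pre L \<subseteq> pre K" using that(2) by (auto simp: pre_def)
    then have "pre K = pre L" using L(2) that(1) by blast
    then show ?thesis using le[of K L] le[of L K] S(2) that L(1) by auto
  qed
  then show "\<exists>L\<in>S. \<forall>K\<in>S. L \<subseteq> K \<longrightarrow> K = L" using L(1) by blast
qed

section \<open>The Koszul complex\<close>

lemma finite_koszul_basis [simp]: "finite (koszul_basis n i)"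
  by (rule finite_subset[of _ "Pow {..<n}"]) (auto simp: koszul_basis_def)

lemma koszul_basis_top: "koszul_basis n n = {{..<n}}"
  by (auto simp: koszul_basis_def) (metis card_lessThan card_subset_eq finite_lessThan lessThan_iff subsetD)+

lemma insert_in_koszul_basis:
  assumes "T \<in> koszul_basis n m" "j < n'" "j \<notin> T" "n \<le> n'"
  shows "insert j T \<in> koszul_basis n' (Suc m)"
proof -
  have "finite T" using assms(1) finite_subset by (auto simp: koszul_basis_def)
  then show ?thesis using assms by (auto simp: koszul_basis_def)
qed

lemma koszul_basis_Suc_iff:
  "n \<notin> S \<Longrightarrow> S \<in> koszul_basis (Suc n) i \<longleftrightarrow> S \<in> koszul_basis n i"
  by (auto simp: koszul_basis_def less_Suc_eq subset_iff)

lemma koszul_module_simps [simp]: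
  "carrier (koszul_module R xs i) = koszul_basis (length xs) i \<rightarrow>\<^sub>E carrier R"
  "\<zero>\<^bsub>koszul_module R xs i\<^esub> = (\<lambda>S\<in>koszul_basis (length xs) i. \<zero>\<^bsub>R\<^esub>)"
  "f \<oplus>\<^bsub>koszul_module R xs i\<^esub> g = (\<lambda>S\<in>koszul_basis (length xs) i. f S \<oplus>\<^bsub>R\<^esub> g S)"
  "a \<odot>\<^bsub>koszul_module R xs i\<^esub> f = (\<lambda>S\<in>koszul_basis (length xs) i. a \<otimes>\<^bsub>R\<^esub> f S)"
  by (simp_all add: koszul_module_def Let_def)

text \<open>One coefficient of the differential, freed from the restriction to a fixed degree. The
  proof that the differential squares to zero can then use arbitrary coefficient functions with
  values in \<open>R\<close>.\<close>

definition koszul_sum :: "('a, 'b) ring_scheme \<Rightarrow> 'a list \<Rightarrow> (nat set \<Rightarrow> 'a) \<Rightarrow> nat set \<Rightarrow> 'a" where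
  "koszul_sum R xs f T = (\<Oplus>\<^bsub>R\<^esub>j \<in> {..<length xs} - T.
     (\<ominus>\<^bsub>R\<^esub> \<one>\<^bsub>R\<^esub>) [^]\<^bsub>R\<^esub> card {k \<in> T. k < j} \<otimes>\<^bsub>R\<^esub> (xs ! j) \<otimes>\<^bsub>R\<^esub> f (insert j T))"

lemma koszul_diff_eq:
  "koszul_diff R xs i f = (\<lambda>T\<in>koszul_basis (length xs) i. koszul_sum R xs f T)"
  by (simp add: koszul_diff_def koszul_sum_def)

lemma (in module) submodule_kernel:
  assumes M': "module R M'"
    and add: "\<And>u v. u \<in> carrier M \<Longrightarrow> v \<in> carrier M \<Longrightarrow> h (u \<oplus>\<^bsub>M\<^esub> v) = h u \<oplus>\<^bsub>M'\<^esub> h v"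
    and smult: "\<And>a u. a \<in> carrier R \<Longrightarrow> u \<in> carrier M \<Longrightarrow> h (a \<odot>\<^bsub>M\<^esub> u) = a \<odot>\<^bsub>M'\<^esub> h u"
    and closed: "\<And>u. u \<in> carrier M \<Longrightarrow> h u \<in> carrier M'"
  shows "submodule {u \<in> carrier M. h u = \<zero>\<^bsub>M'\<^esub>} R M"
proof -
  interpret M': module R M' by fact
  have zero: "h \<zero>\<^bsub>M\<^esub> = \<zero>\<^bsub>M'\<^esub>"
    using smult[of "\<zero>\<^bsub>R\<^esub>" "\<zero>\<^bsub>M\<^esub>"] closed[of "\<zero>\<^bsub>M\<^esub>"] by simp
  have neg: "h (\<ominus>\<^bsub>M\<^esub> u) = \<ominus>\<^bsub>M'\<^esub> h u" if "u \<in> carrier M" for u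
    using smult[of "\<ominus>\<^bsub>R\<^esub> \<one>\<^bsub>R\<^esub>" u] closed[OF that] that by (simp add: smult_l_minus M'.smult_l_minus)
  show ?thesis
    by (rule submoduleI) (auto simp: zero neg add smult M'.M.add.inv_one)
qed

lemma (in module) submodule_image:
  assumes M': "module R M'"
    and add: "\<And>u v. u \<in> carrier M \<Longrightarrow> v \<in> carrier M \<Longrightarrow> h (u \<oplus>\<^bsub>M\<^esub> v) = h u \<oplus>\<^bsub>M'\<^esub> h v"
    and smult: "\<And>a u. a \<in> carrier R \<Longrightarrow> u \<in> carrier M \<Longrightarrow> h (a \<odot>\<^bsub>M\<^esub> u) = a \<odot>\<^bsub>M'\<^esub> h u"
    and closed: "\<And>u. u \<in> carrier M \<Longrightarrow> h u \<in> carrier M'"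
  shows "submodule (h ` carrier M) R M'"
proof -
  interpret M': module R M' by fact
  have zero: "h \<zero>\<^bsub>M\<^esub> = \<zero>\<^bsub>M'\<^esub>"
    using smult[of "\<zero>\<^bsub>R\<^esub>" "\<zero>\<^bsub>M\<^esub>"] closed[of "\<zero>\<^bsub>M\<^esub>"] by simp
  have neg: "h (\<ominus>\<^bsub>M\<^esub> u) = \<ominus>\<^bsub>M'\<^esub> h u" if "u \<in> carrier M" for u
    using smult[of "\<ominus>\<^bsub>R\<^esub> \<one>\<^bsub>R\<^esub>" u] closed[OF that] that by (simp add: smult_l_minus M'.smult_l_minus)
  show ?thesis
  proof (rule M'.submoduleI)
    show "\<zero>\<^bsub>M'\<^esub> \<in> h ` carrier M" using zero by (metis M.zero_closed image_eqI)
    show "\<ominus>\<^bsub>M'\<^esub> w \<in> h ` carrier M" if "w \<in> h ` carrier M" for w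
      using that neg by (metis (no_types, lifting) imageE image_eqI M.a_inv_closed)
    show "v \<oplus>\<^bsub>M'\<^esub> w \<in> h ` carrier M" if "v \<in> h ` carrier M" "w \<in> h ` carrier M" for v w
      using that add by (metis (no_types, lifting) imageE image_eqI M.a_closed)
    show "a \<odot>\<^bsub>M'\<^esub> w \<in> h ` carrier M" if "a \<in> carrier R" "w \<in> h ` carrier M" for a w
      using that smult by (metis (no_types, lifting) imageE image_eqI smult_closed)
  qed (use closed in auto)
qed

context cring
begin

lemma module_koszul_module: "module R (koszul_module R xs i)"
proof (rule moduleI)
  let ?B = "koszul_basis (length xs) i"
  show "cring R" ..
  show "abelian_group (koszul_module R xs i)"
  proof (rule abelian_groupI)
    fix f assume f: "f \<in> carrier (koszul_module R xs i)"
    then have fS: "f S \<in> carrier R" if "S \<in> ?B" for S using that by auto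
    show "\<zero>\<^bsub>koszul_module R xs i\<^esub> \<oplus>\<^bsub>koszul_module R xs i\<^esub> f = f"
      using f fS by (auto intro!: PiE_ext[of _ ?B "\<lambda>_. carrier R"])
    show "\<exists>g\<in>carrier (koszul_module R xs i). g \<oplus>\<^bsub>koszul_module R xs i\<^esub> f = \<zero>\<^bsub>koszul_module R xs i\<^esub>"
      using fS by (intro bexI[of _ "\<lambda>S\<in>?B. \<ominus> f S"]) (auto simp: l_neg intro!: restrict_ext)
  qed (auto simp: a_ac PiE_iff intro!: restrict_ext)
  fix f assume f: "f \<in> carrier (koszul_module R xs i)"
  then have fS: "f S \<in> carrier R" if "S \<in> ?B" for S using that by auto
  show "\<one> \<odot>\<^bsub>koszul_module R xs i\<^esub> f = f"
    using f fS by (auto intro!: PiE_ext[of _ ?B "\<lambda>_. carrier R"])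
qed (auto simp: l_distr r_distr m_assoc PiE_iff intro!: restrict_ext)

lemma koszul_module_minus:
  assumes "f \<in> carrier (koszul_module R xs i)" "g \<in> carrier (koszul_module R xs i)"
    and S: "S \<in> koszul_basis (length xs) i"
  shows "(f \<ominus>\<^bsub>koszul_module R xs i\<^esub> g) S = f S \<ominus> g S"
proof -
  interpret K: module R "koszul_module R xs i" by (rule module_koszul_module)
  have "f \<ominus>\<^bsub>koszul_module R xs i\<^esub> g =
      f \<oplus>\<^bsub>koszul_module R xs i\<^esub> (\<ominus> \<one>) \<odot>\<^bsub>koszul_module R xs i\<^esub> g"
    using assms by (simp only: K.smult_l_minus[OF one_closed] K.smult_one K.M.minus_eq)
  moreover have "g S \<in> carrier R" using assms by auto
  ultimately show ?thesis using S by (simp add: l_minus minus_eq)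
qed

text \<open>Regularity is tested coordinatewise: adding \<open>y\<close> times the free module to
  the functions with values in \<open>N\<close> gives the functions with values in
  \<open>N + y R\<close>. \<open>N\<close> varies because \<open>wreg\<close> enlarges it at each
  element.\<close>

lemma wreg_koszul_module:
  assumes "set ys \<subseteq> carrier R" "N \<subseteq> carrier R" "wreg (ring_module R) (carrier R) N ys"
  shows "wreg (koszul_module R xs i) (carrier (koszul_module R xs i))
    (koszul_basis (length xs) i \<rightarrow>\<^sub>E N) ys"
  using assms
proof (induction ys arbitrary: N)
  case (Cons y ys)
  let ?B = "koszul_basis (length xs) i" and ?K = "koszul_module R xs i"
  let ?E = "ext_sub (ring_module R) (carrier R) N y"
  interpret K: module R ?K by (rule module_koszul_module)
  have y: "y \<in> carrier R" using Cons.prems by simp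
  have "nzd_mod ?K (carrier ?K) (?B \<rightarrow>\<^sub>E N) y"
    unfolding nzd_mod_def
  proof (intro ballI impI)
    fix f assume f: "f \<in> carrier ?K" "y \<odot>\<^bsub>?K\<^esub> f \<in> ?B \<rightarrow>\<^sub>E N"
    have "f S \<in> N" if S: "S \<in> ?B" for S
    proof -
      have "y \<otimes> f S \<in> N" using PiE_mem[OF f(2) S] S by simp
      moreover have "f S \<in> carrier R" using f(1) S by auto
      ultimately show ?thesis using Cons.prems(3) by (simp add: nzd_mod_def)
    qed
    then show "f \<in> ?B \<rightarrow>\<^sub>E N" using f(1) by (auto simp: PiE_iff)
  qed
  moreover have "ext_sub ?K (carrier ?K) (?B \<rightarrow>\<^sub>E N) y = ?B \<rightarrow>\<^sub>E ?E"
  proof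
    show "ext_sub ?K (carrier ?K) (?B \<rightarrow>\<^sub>E N) y \<subseteq> ?B \<rightarrow>\<^sub>E ?E"
    proof
      fix f assume "f \<in> ext_sub ?K (carrier ?K) (?B \<rightarrow>\<^sub>E N) y"
      then obtain g where f: "f \<in> carrier ?K" and g: "g \<in> carrier ?K"
        "f \<ominus>\<^bsub>?K\<^esub> y \<odot>\<^bsub>?K\<^esub> g \<in> ?B \<rightarrow>\<^sub>E N" by (auto simp: ext_sub_def)
      have "f S \<in> ?E" if S: "S \<in> ?B" for S
      proof -
        have "f S \<ominus> y \<otimes> g S \<in> N"
          using PiE_mem[OF g(2) S] koszul_module_minus[OF f K.smult_closed[OF y g(1)] S] S by simp
        moreover have "f S \<in> carrier R" "g S \<in> carrier R" using f g(1) S by auto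
        ultimately show ?thesis by (auto simp: ext_sub_def)
      qed
      then show "f \<in> ?B \<rightarrow>\<^sub>E ?E" using f by (auto simp: PiE_iff)
    qed
    show "?B \<rightarrow>\<^sub>E ?E \<subseteq> ext_sub ?K (carrier ?K) (?B \<rightarrow>\<^sub>E N) y"
    proof
      fix f assume f: "f \<in> ?B \<rightarrow>\<^sub>E ?E"
      then have fc: "f \<in> carrier ?K" by (auto simp: PiE_iff ext_sub_def)
      have "\<forall>S\<in>?B. \<exists>r\<in>carrier R. f S \<ominus> y \<otimes> r \<in> N"
        using f by (auto simp: PiE_iff ext_sub_def)
      then obtain g where g: "\<forall>S\<in>?B. g S \<in> carrier R \<and> f S \<ominus> y \<otimes> g S \<in> N" by metis
      let ?g = "restrict g ?B"
      have gc: "?g \<in> carrier ?K" using g by auto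
      have "f \<ominus>\<^bsub>?K\<^esub> y \<odot>\<^bsub>?K\<^esub> ?g \<in> ?B \<rightarrow>\<^sub>E N"
      proof (rule PiE_I)
        fix S assume S: "S \<in> ?B"
        show "(f \<ominus>\<^bsub>?K\<^esub> y \<odot>\<^bsub>?K\<^esub> ?g) S \<in> N"
          using koszul_module_minus[OF fc K.smult_closed[OF y gc] S] S g by simp
      next
        fix S assume S: "S \<notin> ?B"
        have "f \<ominus>\<^bsub>?K\<^esub> y \<odot>\<^bsub>?K\<^esub> ?g \<in> carrier ?K" using K.M.minus_closed[OF fc K.smult_closed[OF y gc]] .
        then show "(f \<ominus>\<^bsub>?K\<^esub> y \<odot>\<^bsub>?K\<^esub> ?g) S = undefined" using S by (auto simp: PiE_iff extensional_def)
      qed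
      then show "f \<in> ext_sub ?K (carrier ?K) (?B \<rightarrow>\<^sub>E N) y"
        using fc gc unfolding ext_sub_def by blast
    qed
  qed
  moreover have "wreg ?K (carrier ?K) (?B \<rightarrow>\<^sub>E ?E) ys"
    using Cons.prems by (intro Cons.IH) (auto simp: ext_sub_def)
  ultimately show ?case by simp
qed simp

section \<open>The differential and its square\<close>

lemma koszul_term_closed:
  "\<lbrakk>set xs \<subseteq> carrier R; j < length xs; y \<in> carrier R\<rbrakk> \<Longrightarrow>
    (\<ominus> \<one>) [^] (c :: nat) \<otimes> (xs ! j) \<otimes> y \<in> carrier R"
  by (auto simp: subset_iff)

lemma koszul_sum_closed:
  assumes "set xs \<subseteq> carrier R" "\<And>j. j < length xs \<Longrightarrow> j \<notin> T \<Longrightarrow> f (insert j T) \<in> carrier R"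
  shows "koszul_sum R xs f T \<in> carrier R"
  unfolding koszul_sum_def using assms by (intro finsum_closed) (auto intro!: koszul_term_closed)

lemma koszul_sum_cong:
  assumes "set xs \<subseteq> carrier R" "\<And>j. j < length xs \<Longrightarrow> j \<notin> T \<Longrightarrow> g (insert j T) \<in> carrier R"
    and "\<And>j. j < length xs \<Longrightarrow> j \<notin> T \<Longrightarrow> f (insert j T) = g (insert j T)"
  shows "koszul_sum R xs f T = koszul_sum R xs g T"
  unfolding koszul_sum_def using assms by (intro finsum_cong') (auto intro!: koszul_term_closed)

lemma koszul_sum_add:
  assumes xs: "set xs \<subseteq> carrier R"
    and f: "\<And>j. j < length xs \<Longrightarrow> j \<notin> T \<Longrightarrow> f (insert j T) \<in> carrier R"
    and g: "\<And>j. j < length xs \<Longrightarrow> j \<notin> T \<Longrightarrow> g (insert j T) \<in> carrier R"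
  shows "koszul_sum R xs (\<lambda>S. f S \<oplus> g S) T = koszul_sum R xs f T \<oplus> koszul_sum R xs g T"
proof -
  have "koszul_sum R xs (\<lambda>S. f S \<oplus> g S) T = (\<Oplus>j \<in> {..<length xs} - T.
     ((\<ominus> \<one>) [^] card {k \<in> T. k < j} \<otimes> (xs ! j) \<otimes> f (insert j T)) \<oplus>
     ((\<ominus> \<one>) [^] card {k \<in> T. k < j} \<otimes> (xs ! j) \<otimes> g (insert j T)))"
    unfolding koszul_sum_def using xs f g
    by (intro finsum_cong') (auto simp: r_distr subset_iff intro!: koszul_term_closed)
  also have "\<dots> = koszul_sum R xs f T \<oplus> koszul_sum R xs g T"
    unfolding koszul_sum_def using xs f g by (intro finsum_addf) (auto intro!: koszul_term_closed)
  finally show ?thesis .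
qed

lemma koszul_sum_smult:
  assumes xs: "set xs \<subseteq> carrier R" and a: "a \<in> carrier R"
    and f: "\<And>j. j < length xs \<Longrightarrow> j \<notin> T \<Longrightarrow> f (insert j T) \<in> carrier R"
  shows "koszul_sum R xs (\<lambda>S. a \<otimes> f S) T = a \<otimes> koszul_sum R xs f T"
proof -
  have "a \<otimes> koszul_sum R xs f T = (\<Oplus>j \<in> {..<length xs} - T.
     a \<otimes> ((\<ominus> \<one>) [^] card {k \<in> T. k < j} \<otimes> (xs ! j) \<otimes> f (insert j T)))"
    unfolding koszul_sum_def using xs f a
    by (intro finsum_rdistr) (auto intro!: koszul_term_closed)
  also have "\<dots> = koszul_sum R xs (\<lambda>S. a \<otimes> f S) T"
    unfolding koszul_sum_def using xs f a
    by (intro finsum_cong') (auto simp: m_ac subset_iff)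
  finally show ?thesis by simp
qed

lemma koszul_sum_zero:
  assumes "set xs \<subseteq> carrier R"
  shows "koszul_sum R xs (\<lambda>_. \<zero>) T = \<zero>"
  using koszul_sum_smult[OF assms zero_closed, of T "\<lambda>_. \<zero>"]
    koszul_sum_closed[OF assms, of T "\<lambda>_. \<zero>"] by simp

text \<open>The new index contributes one summand, and since all of \<open>T\<close> lies below it,
  the sign is \<open>(-1)^card T\<close>. Together with \<open>koszul_sum_snoc_insert\<close> this
  is the differential of the mapping cone of multiplication by \<open>x\<close>.\<close>

lemma koszul_sum_snoc:
  assumes xs: "set (xs @ [x]) \<subseteq> carrier R" and T: "T \<subseteq> {..<length xs}"
    and f: "\<And>j. j \<le> length xs \<Longrightarrow> j \<notin> T \<Longrightarrow> f (insert j T) \<in> carrier R"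
  shows "koszul_sum R (xs @ [x]) f T =
    koszul_sum R xs f T \<oplus> (\<ominus> \<one>) [^] card T \<otimes> x \<otimes> f (insert (length xs) T)"
proof -
  let ?n = "length xs"
  let ?t = "\<lambda>j. (\<ominus> \<one>) [^] card {k \<in> T. k < j} \<otimes> ((xs @ [x]) ! j) \<otimes> f (insert j T)"
  have nT: "?n \<notin> T" using T by auto
  have set: "{..<length (xs @ [x])} - T = insert ?n ({..<?n} - T)" using nT by auto
  have closed: "?t j \<in> carrier R" if "j \<le> ?n" "j \<notin> T" for j
    using that f xs by (intro koszul_term_closed) auto
  have "koszul_sum R (xs @ [x]) f T = ?t ?n \<oplus> (\<Oplus>j \<in> {..<?n} - T. ?t j)"
    unfolding koszul_sum_def set using closed nT closed[OF order_refl nT]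
    by (intro finsum_insert) auto
  also have "(\<Oplus>j \<in> {..<?n} - T. ?t j) = koszul_sum R xs f T"
    unfolding koszul_sum_def using xs f
    by (intro finsum_cong') (auto simp: nth_append intro!: koszul_term_closed)
  also have "{k \<in> T. k < ?n} = T" using T by auto
  finally show ?thesis
    using xs f nT koszul_sum_closed[of xs T f] by (simp add: a_comm)
qed

text \<open>The new index is the largest, so its presence in the set alters none of the
  signs.\<close>

lemma koszul_sum_snoc_insert:
  assumes xs: "set (xs @ [x]) \<subseteq> carrier R" and T: "T \<subseteq> {..<length xs}"
    and f: "\<And>j. j < length xs \<Longrightarrow> j \<notin> T \<Longrightarrow> f (insert (length xs) (insert j T)) \<in> carrier R"
  shows "koszul_sum R (xs @ [x]) f (insert (length xs) T) =
    koszul_sum R xs (\<lambda>S. f (insert (length xs) S)) T"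
proof -
  let ?n = "length xs"
  have set: "{..<length (xs @ [x])} - insert ?n T = {..<?n} - T" by auto
  have card: "{k \<in> insert ?n T. k < j} = {k \<in> T. k < j}" if "j < ?n" for j using that by auto
  show ?thesis unfolding koszul_sum_def set
  proof (rule finsum_cong')
    fix j assume "j \<in> {..<?n} - T"
    then show "(\<ominus> \<one>) [^] card {k \<in> insert ?n T. k < j} \<otimes> ((xs @ [x]) ! j) \<otimes> f (insert j (insert ?n T)) =
      (\<ominus> \<one>) [^] card {k \<in> T. k < j} \<otimes> (xs ! j) \<otimes> f (insert ?n (insert j T))"
      by (simp only: card nth_append insert_commute[of j] Diff_iff lessThan_iff if_True)
  qed (use xs f in \<open>auto intro!: koszul_term_closed\<close>)
qed

lemma neg_one_pow_Suc_cancel: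
  assumes "y \<in> carrier R"
  shows "(\<ominus> \<one>) [^] Suc c \<otimes> y \<oplus> (\<ominus> \<one>) [^] (c :: nat) \<otimes> y = \<zero>"
  using assms by (simp add: l_minus r_minus l_neg)

text \<open>Induction along the mapping cone instead of pairing the terms of a double sum. If the
  last index is not in \<open>T\<close>, then \<open>x\<close> times the differential of
  \<open>?f1\<close> occurs twice, with exponents \<open>card T + 1\<close> and
  \<open>card T\<close> of the sign, and cancels; otherwise the claim reduces to
  \<open>?f1\<close>.\<close>

lemma koszul_sum_koszul_sum:
  assumes "set xs \<subseteq> carrier R" "T \<subseteq> {..<length xs}" "\<And>S. f S \<in> carrier R"
  shows "koszul_sum R xs (koszul_sum R xs f) T = \<zero>"
  using assms
proof (induction xs arbitrary: f T rule: rev_induct)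
  case Nil
  then show ?case by (simp add: koszul_sum_def)
next
  case (snoc x xs)
  let ?n = "length xs" and ?f1 = "\<lambda>S. f (insert (length xs) S)"
  let ?g = "koszul_sum R (xs @ [x]) f"
  note xsx = snoc.prems(1)
  have xs: "set xs \<subseteq> carrier R" and x: "x \<in> carrier R" using xsx by auto
  have gc: "?g S \<in> carrier R" for S
    by (rule koszul_sum_closed[OF xsx]) (rule snoc.prems(3))
  have f1c: "koszul_sum R xs ?f1 S \<in> carrier R" for S
    by (rule koszul_sum_closed[OF xs]) (rule snoc.prems(3))
  have fc: "koszul_sum R xs f S \<in> carrier R" for S
    by (rule koszul_sum_closed[OF xs]) (rule snoc.prems(3))
  have g_insert: "?g (insert ?n S) = koszul_sum R xs ?f1 S" if "S \<subseteq> {..<?n}" for S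
    by (rule koszul_sum_snoc_insert[OF xsx that]) (rule snoc.prems(3))
  show ?case
  proof (cases "?n \<in> T")
    case False
    then have T: "T \<subseteq> {..<?n}" using snoc.prems(2) by (auto simp: less_Suc_eq subset_iff)
    then have finT: "finite T" using finite_subset by blast
    let ?c = "(\<ominus> \<one>) [^] Suc (card T) \<otimes> x"
    have cc: "?c \<in> carrier R" using x by simp
    have "koszul_sum R xs ?g T = koszul_sum R xs (\<lambda>S. koszul_sum R xs f S \<oplus> ?c \<otimes> ?f1 S) T"
    proof (rule koszul_sum_cong[OF xs])
      fix j assume j: "j < ?n" "j \<notin> T"
      then have "insert j T \<subseteq> {..<?n}" "card (insert j T) = Suc (card T)" using T finT by auto
      then show "?g (insert j T) = koszul_sum R xs f (insert j T) \<oplus> ?c \<otimes> ?f1 (insert j T)"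
        using koszul_sum_snoc[OF xsx, of "insert j T" f] snoc.prems(3) by simp
    qed (use fc cc snoc.prems(3) in auto)
    also have "\<dots> = koszul_sum R xs (koszul_sum R xs f) T \<oplus> koszul_sum R xs (\<lambda>S. ?c \<otimes> ?f1 S) T"
      using fc cc snoc.prems(3) by (intro koszul_sum_add[OF xs]) auto
    also have "koszul_sum R xs (koszul_sum R xs f) T = \<zero>"
      by (rule snoc.IH[OF xs T]) (rule snoc.prems(3))
    also have "koszul_sum R xs (\<lambda>S. ?c \<otimes> ?f1 S) T = ?c \<otimes> koszul_sum R xs ?f1 T"
      by (rule koszul_sum_smult[OF xs cc]) (rule snoc.prems(3))
    finally have 1: "koszul_sum R xs ?g T = ?c \<otimes> koszul_sum R xs ?f1 T" using cc f1c by simp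
    have "koszul_sum R (xs @ [x]) ?g T =
        koszul_sum R xs ?g T \<oplus> (\<ominus> \<one>) [^] card T \<otimes> x \<otimes> ?g (insert ?n T)"
      by (rule koszul_sum_snoc[OF xsx T]) (rule gc)
    then show ?thesis
      using neg_one_pow_Suc_cancel[of "x \<otimes> koszul_sum R xs ?f1 T" "card T"] x f1c
      by (simp add: 1 g_insert[OF T] m_assoc)
  next
    case True
    define U where "U = T - {?n}"
    have U: "U \<subseteq> {..<?n}" "T = insert ?n U"
      using True snoc.prems(2) by (auto simp: U_def less_Suc_eq subset_iff)
    have "koszul_sum R (xs @ [x]) ?g T = koszul_sum R xs (\<lambda>S. ?g (insert ?n S)) U"
      unfolding U(2) by (rule koszul_sum_snoc_insert[OF xsx U(1)]) (rule gc)
    also have "\<dots> = koszul_sum R xs (koszul_sum R xs ?f1) U"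
      using f1c U(1) by (intro koszul_sum_cong[OF xs] g_insert) auto
    also have "\<dots> = \<zero>" by (rule snoc.IH[OF xs U(1)]) (rule snoc.prems(3))
    finally show ?thesis .
  qed
qed

section \<open>Cycles and boundaries as submodules\<close>

lemma koszul_diff_closed:
  assumes "set xs \<subseteq> carrier R" "f \<in> carrier (koszul_module R xs (Suc i))"
  shows "koszul_diff R xs i f \<in> carrier (koszul_module R xs i)"
proof -
  have "f (insert j T) \<in> carrier R" if "T \<in> koszul_basis (length xs) i" "j < length xs" "j \<notin> T" for j T
    using assms(2) insert_in_koszul_basis[OF that order_refl] by auto
  then show ?thesis using koszul_sum_closed[OF assms(1)] by (auto simp: koszul_diff_eq)
qed

lemma koszul_diff_add:
  assumes xs: "set xs \<subseteq> carrier R"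
    and "f \<in> carrier (koszul_module R xs (Suc i))" "g \<in> carrier (koszul_module R xs (Suc i))"
  shows "koszul_diff R xs i (f \<oplus>\<^bsub>koszul_module R xs (Suc i)\<^esub> g) =
    koszul_diff R xs i f \<oplus>\<^bsub>koszul_module R xs i\<^esub> koszul_diff R xs i g"
  unfolding koszul_diff_eq koszul_module_simps
proof (rule restrict_ext)
  fix T assume T: "T \<in> koszul_basis (length xs) i"
  note ins = insert_in_koszul_basis[OF T _ _ order_refl]
  have c: "f (insert j T) \<in> carrier R" "g (insert j T) \<in> carrier R" if "j < length xs" "j \<notin> T" for j
    using assms(2,3) ins[OF that] by auto
  have "koszul_sum R xs (\<lambda>S\<in>koszul_basis (length xs) (Suc i). f S \<oplus> g S) T =
      koszul_sum R xs (\<lambda>S. f S \<oplus> g S) T"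
    using c ins by (intro koszul_sum_cong[OF xs]) auto
  also have "\<dots> = koszul_sum R xs f T \<oplus> koszul_sum R xs g T"
    using c by (rule koszul_sum_add[OF xs])
  finally show "koszul_sum R xs (\<lambda>S\<in>koszul_basis (length xs) (Suc i). f S \<oplus> g S) T =
      (\<lambda>T\<in>koszul_basis (length xs) i. koszul_sum R xs f T) T \<oplus>
      (\<lambda>T\<in>koszul_basis (length xs) i. koszul_sum R xs g T) T" using T by simp
qed

lemma koszul_diff_smult:
  assumes xs: "set xs \<subseteq> carrier R" and a: "a \<in> carrier R"
    and "f \<in> carrier (koszul_module R xs (Suc i))"
  shows "koszul_diff R xs i (a \<odot>\<^bsub>koszul_module R xs (Suc i)\<^esub> f) =
    a \<odot>\<^bsub>koszul_module R xs i\<^esub> koszul_diff R xs i f"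
  unfolding koszul_diff_eq koszul_module_simps
proof (rule restrict_ext)
  fix T assume T: "T \<in> koszul_basis (length xs) i"
  note ins = insert_in_koszul_basis[OF T _ _ order_refl]
  have c: "f (insert j T) \<in> carrier R" if "j < length xs" "j \<notin> T" for j
    using assms(3) ins[OF that] by auto
  have "koszul_sum R xs (\<lambda>S\<in>koszul_basis (length xs) (Suc i). a \<otimes> f S) T =
      koszul_sum R xs (\<lambda>S. a \<otimes> f S) T"
    using c ins a by (intro koszul_sum_cong[OF xs]) auto
  also have "\<dots> = a \<otimes> koszul_sum R xs f T" using c by (rule koszul_sum_smult[OF xs a])
  finally show "koszul_sum R xs (\<lambda>S\<in>koszul_basis (length xs) (Suc i). a \<otimes> f S) T =
      a \<otimes> (\<lambda>T\<in>koszul_basis (length xs) i. koszul_sum R xs f T) T" using T by simp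
qed

lemma koszul_cycles_iff:
  "f \<in> koszul_cycles R xs i \<longleftrightarrow> f \<in> carrier (koszul_module R xs i) \<and>
    (\<forall>m. i = Suc m \<longrightarrow> (\<forall>T\<in>koszul_basis (length xs) m. koszul_sum R xs f T = \<zero>))"
proof (cases i)
  case (Suc m)
  have "koszul_diff R xs m f = \<zero>\<^bsub>koszul_module R xs m\<^esub> \<longleftrightarrow>
      (\<forall>T\<in>koszul_basis (length xs) m. koszul_sum R xs f T = \<zero>)"
    by (auto simp: koszul_diff_eq fun_eq_iff restrict_def split: if_splits)
  then show ?thesis using Suc by (simp add: a_kernel_def' del: koszul_module_simps)
qed simp

lemma submodule_koszul_cycles:
  assumes xs: "set xs \<subseteq> carrier R"
  shows "submodule (koszul_cycles R xs i) R (koszul_module R xs i)"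
proof (cases i)
  case 0
  then show ?thesis using module.carrier_is_submodule[OF module_koszul_module] by simp
next
  case (Suc m)
  have "submodule {f \<in> carrier (koszul_module R xs (Suc m)).
      koszul_diff R xs m f = \<zero>\<^bsub>koszul_module R xs m\<^esub>} R (koszul_module R xs (Suc m))"
    by (rule module.submodule_kernel[OF module_koszul_module module_koszul_module])
      (fact koszul_diff_add[OF xs] koszul_diff_smult[OF xs] koszul_diff_closed[OF xs])+
  then show ?thesis by (simp add: Suc a_kernel_def' del: koszul_module_simps)
qed

lemma submodule_koszul_boundaries:
  assumes xs: "set xs \<subseteq> carrier R"
  shows "submodule (koszul_boundaries R xs i) R (koszul_module R xs i)"
  unfolding koszul_boundaries_def
  by (rule module.submodule_image[OF module_koszul_module module_koszul_module])
    (fact koszul_diff_add[OF xs] koszul_diff_smult[OF xs] koszul_diff_closed[OF xs])+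

lemma koszul_boundaries_subset_cycles:
  assumes xs: "set xs \<subseteq> carrier R"
  shows "koszul_boundaries R xs i \<subseteq> koszul_cycles R xs i"
proof
  fix g assume "g \<in> koszul_boundaries R xs i"
  then obtain f where f: "f \<in> carrier (koszul_module R xs (Suc i))" "g = koszul_diff R xs i f"
    by (auto simp: koszul_boundaries_def)
  \<comment> \<open>Outside the basis \<open>f\<close> is \<open>undefined\<close>; extension by
    zero gives the total \<open>R\<close>-valued function that \<open>koszul_sum_koszul_sum\<close>
    requires.\<close>
  define h where "h S = (if S \<in> koszul_basis (length xs) (Suc i) then f S else \<zero>)" for S
  have hc: "h S \<in> carrier R" for S using f(1) by (auto simp: h_def)
  have gh: "g S = koszul_sum R xs h S" if S: "S \<in> koszul_basis (length xs) i" for S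
  proof -
    have "koszul_sum R xs f S = koszul_sum R xs h S"
      by (rule koszul_sum_cong[OF xs hc]) (simp add: h_def insert_in_koszul_basis[OF S])
    then show ?thesis using S by (simp add: f(2) koszul_diff_eq)
  qed
  have "koszul_sum R xs g T = \<zero>" if i: "i = Suc m" and T: "T \<in> koszul_basis (length xs) m" for m T
  proof -
    have "koszul_sum R xs g T = koszul_sum R xs (koszul_sum R xs h) T"
    proof (rule koszul_sum_cong[OF xs])
      show "koszul_sum R xs h (insert j T) \<in> carrier R" for j
        by (rule koszul_sum_closed[OF xs hc])
      show "g (insert j T) = koszul_sum R xs h (insert j T)" if "j < length xs" "j \<notin> T" for j
        using insert_in_koszul_basis[OF T that order_refl] by (intro gh) (simp add: i)
    qed
    also have "\<dots> = \<zero>"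
      using T by (intro koszul_sum_koszul_sum[OF xs _ hc]) (simp add: koszul_basis_def)
    finally show ?thesis .
  qed
  then show "g \<in> koszul_cycles R xs i"
    using koszul_diff_closed[OF xs f(1)] f(2) unfolding koszul_cycles_iff by blast
qed

end

section \<open>Koszul homology and associated primes\<close>

text \<open>A submodule of a free module is determined, among those comparable with it, by its ideal of
  coefficients at one basis element together with its elements whose coefficient there vanishes.\<close>

lemma (in noetherian_local_ring) koszul_submodule_family_maximal:
  assumes "finite C" "C \<subseteq> koszul_basis (length xs) i"
    and "S \<noteq> {}" "\<And>N. N \<in> S \<Longrightarrow> submodule N R (koszul_module R xs i)"
    and "\<And>N f T. N \<in> S \<Longrightarrow> f \<in> N \<Longrightarrow> T \<in> koszul_basis (length xs) i - C \<Longrightarrow> f T = \<zero>"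
  shows "\<exists>N\<in>S. \<forall>L\<in>S. N \<subseteq> L \<longrightarrow> L = N"
  using assms
proof (induction C arbitrary: S)
  case empty
  let ?K = "koszul_module R xs i"
  interpret K: module R ?K by (rule module_koszul_module)
  have "N = {\<zero>\<^bsub>?K\<^esub>}" if N: "N \<in> S" for N
  proof -
    have "f = \<zero>\<^bsub>?K\<^esub>" if f: "f \<in> N" for f
    proof (rule PiE_ext)
      show "f \<in> koszul_basis (length xs) i \<rightarrow>\<^sub>E carrier R"
        using K.sub_carrier[OF empty.prems(3)[OF N] f] by simp
      show "\<zero>\<^bsub>?K\<^esub> \<in> koszul_basis (length xs) i \<rightarrow>\<^sub>E carrier R" by simp
      show "f T = \<zero>\<^bsub>?K\<^esub> T" if "T \<in> koszul_basis (length xs) i" for T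
        using empty.prems(4)[OF N f] that by simp
    qed
    then show ?thesis using K.sub_zero[OF empty.prems(3)[OF N]] by blast
  qed
  then show ?case using empty.prems(2) by blast
next
  case (insert b C)
  let ?K = "koszul_module R xs i"
  interpret K: module R ?K by (rule module_koszul_module)
  have b: "b \<in> koszul_basis (length xs) i" using insert.prems(1) by blast
  note S = insert.prems(3)
  note carr = K.sub_carrier[OF S]
  have bc: "f b \<in> carrier R" if "N \<in> S" "f \<in> N" for N f using carr[OF that] b by auto
  define co where "co N = (\<lambda>f. f b) ` N" for N :: "(nat set \<Rightarrow> 'a) set"
  define ke where "ke N = {f \<in> N. f b = \<zero>}" for N :: "(nat set \<Rightarrow> 'a) set"
  have ideal_co: "ideal (co N) R" if N: "N \<in> S" for N
  proof -
    have "submodule ((\<lambda>f. f b) ` carrier (?K\<lparr>carrier := N\<rparr>)) R (ring_module R)"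
    proof (rule module.submodule_image[OF _ module_ring_module])
      show "module R (?K\<lparr>carrier := N\<rparr>)"
        using submodule.submodule_is_module[OF S[OF N]] K.module_axioms by blast
    qed (use b bc[OF N] in auto)
    then show ?thesis by (simp add: co_def submodule_ring_module_iff)
  qed
  have "co ` S \<noteq> {}" using insert.prems(2) by blast
  then obtain N1 where N1: "N1 \<in> S" "\<And>L. L \<in> S \<Longrightarrow> co N1 \<subseteq> co L \<Longrightarrow> co L = co N1"
    using ideal_family_maximal[of "co ` S"] ideal_co by (metis (no_types, lifting) imageE image_eqI)
  \<comment> \<open>Among members with the maximal coefficient ideal, the kernels also vanish at
    \<open>b\<close>, so the induction hypothesis provides a maximal kernel.\<close>
  let ?S = "ke ` {N \<in> S. co N = co N1}"
  have ke: "submodule (ke N) R ?K" if N: "N \<in> S" for N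
  proof (rule K.submoduleI)
    show "ke N \<subseteq> carrier ?K" using carr[OF N] by (auto simp: ke_def)
    show "\<zero>\<^bsub>?K\<^esub> \<in> ke N" using K.sub_zero[OF S[OF N]] b by (simp add: ke_def)
    fix f assume f: "f \<in> ke N"
    then have fN: "f \<in> N" "f b = \<zero>" by (auto simp: ke_def)
    show sm: "a \<odot>\<^bsub>?K\<^esub> f \<in> ke N" if "a \<in> carrier R" for a
      using K.sub_smult[OF S[OF N] that fN(1)] b fN(2) that by (simp add: ke_def)
    show "\<ominus>\<^bsub>?K\<^esub> f \<in> ke N"
      using sm[of "\<ominus> \<one>"] K.smult_l_minus[OF one_closed carr[OF N fN(1)]] K.smult_one[OF carr[OF N fN(1)]]
      by simp
    fix g assume "g \<in> ke N"
    then have gN: "g \<in> N" "g b = \<zero>" by (auto simp: ke_def)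
    show "f \<oplus>\<^bsub>?K\<^esub> g \<in> ke N"
      using K.sub_add[OF S[OF N] fN(1) gN(1)] b fN(2) gN(2) by (simp add: ke_def)
  qed
  have "\<exists>N\<in>?S. \<forall>L\<in>?S. N \<subseteq> L \<longrightarrow> L = N"
  proof (rule insert.IH)
    show "C \<subseteq> koszul_basis (length xs) i" using insert.prems(1) by blast
    show "?S \<noteq> {}" using N1(1) by blast
    show "submodule N R ?K" if "N \<in> ?S" for N using that ke by blast
    show "f T = \<zero>" if "N \<in> ?S" "f \<in> N" "T \<in> koszul_basis (length xs) i - C" for N f T
      using that insert.prems(4)[of _ f T] by (cases "T = b") (auto simp: ke_def)
  qed
  then obtain N where N: "N \<in> S" "co N = co N1" "\<And>L. L \<in> S \<Longrightarrow> co L = co N1 \<Longrightarrow> ke N \<subseteq> ke L \<Longrightarrow> ke L = ke N"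
    by auto
  have "L = N" if L: "L \<in> S" "N \<subseteq> L" for L
  proof
    show "N \<subseteq> L" by fact
    have "co N \<subseteq> co L" using L(2) by (auto simp: co_def)
    then have co: "co L = co N1" using N1(2)[OF L(1)] N(2) by simp
    have ke_eq: "ke L = ke N" using N(3)[OF L(1) co] L(2) by (auto simp: ke_def)
    show "L \<subseteq> N"
    proof
      fix f assume f: "f \<in> L"
      then have "f b \<in> co N" using co N(2) by (auto simp: co_def)
      then obtain g where g: "g \<in> N" "g b = f b" by (auto simp: co_def)
      have gL: "g \<in> L" using g L(2) by blast
      have "(f \<ominus>\<^bsub>?K\<^esub> g) b = \<zero>"
        using koszul_module_minus[OF carr[OF L(1) f] carr[OF L(1) gL] b] g(2) bc[OF L(1) f]
        by (simp add: minus_eq r_neg)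
      then have "f \<ominus>\<^bsub>?K\<^esub> g \<in> ke L" using K.sub_minus[OF S[OF L(1)] f gL] by (simp add: ke_def)
      then have "f \<ominus>\<^bsub>?K\<^esub> g \<in> N" unfolding ke_eq by (simp add: ke_def)
      then show "f \<in> N" using K.sub_minus_cancel[OF S[OF N(1)] _ g(1) carr[OF L(1) f]] by blast
    qed
  qed
  then show ?case using N(1) by blast
qed

lemma (in noetherian_local_ring) local_noetherian_koszul_module:
  "local_noetherian_module R (koszul_module R xs i)"
proof (intro local_noetherian_module.intro local_noetherian_module_axioms.intro)
  show "module R (koszul_module R xs i)" by (rule module_koszul_module)
  show "noetherian_local_ring R" ..
  fix S assume "S \<noteq> {}" "\<And>N. N \<in> S \<Longrightarrow> submodule N R (koszul_module R xs i)"
  then show "\<exists>N\<in>S. \<forall>L\<in>S. N \<subseteq> L \<longrightarrow> L = N"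
    by (intro koszul_submodule_family_maximal[of "koszul_basis (length xs) i"]) auto
qed

context cring
begin

lemma koszul_sign_cancel:
  assumes "y \<in> carrier R" "(\<ominus> \<one>) [^] (c :: nat) \<otimes> y = \<zero>"
  shows "y = \<zero>"
proof -
  have "(\<ominus> \<one>) [^] c = \<one> \<or> (\<ominus> \<one>) [^] c = \<ominus> \<one>"
    by (induction c) (auto simp: l_minus)
  then show ?thesis using assms by (auto simp: l_minus)
qed

text \<open>The only basis set in top degree is \<open>{..<n}\<close>, and at its subset without
  \<open>j\<close> the differential has the coefficient \<open>x_j r\<close> up to sign. Hence the
  top cycles form the annihilator of the sequence, which is also the top homology, the top
  boundaries being zero.\<close>

lemma koszul_top_cycle_iff:
  assumes xs: "set xs \<subseteq> carrier R" and r: "r \<in> carrier R"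
  shows "(\<lambda>S\<in>koszul_basis (length xs) (length xs). r) \<in> koszul_cycles R xs (length xs) \<longleftrightarrow>
    (\<forall>x\<in>set xs. x \<otimes> r = \<zero>)" (is "?h \<in> _ \<longleftrightarrow> _")
proof (cases "length xs")
  case 0
  then show ?thesis using r by simp
next
  case (Suc m)
  let ?n = "length xs"
  have hc: "?h \<in> carrier (koszul_module R xs ?n)" using r by simp
  have sum: "koszul_sum R xs ?h ({..<?n} - {j}) =
      (\<ominus> \<one>) [^] card {k \<in> {..<?n} - {j}. k < j} \<otimes> ((xs ! j) \<otimes> r)" if j: "j < ?n" for j
  proof -
    have set: "{..<?n} - ({..<?n} - {j}) = {j}" using j by auto
    have ins: "insert j ({..<?n} - {j}) = {..<?n}" using j by auto
    have xj: "xs ! j \<in> carrier R" using xs j by auto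
    show ?thesis unfolding koszul_sum_def set using xj r j
      by (subst finsum_insert) (auto simp: ins koszul_basis_top m_assoc)
  qed
  have basis: "koszul_basis ?n m = (\<lambda>j. {..<?n} - {j}) ` {..<?n}"
  proof
    show "(\<lambda>j. {..<?n} - {j}) ` {..<?n} \<subseteq> koszul_basis ?n m"
      using Suc by (auto simp: koszul_basis_def)
    show "koszul_basis ?n m \<subseteq> (\<lambda>j. {..<?n} - {j}) ` {..<?n}"
    proof
      fix T assume "T \<in> koszul_basis ?n m"
      then have T: "T \<subseteq> {..<?n}" "card T = m" by (auto simp: koszul_basis_def)
      then have "card ({..<?n} - T) = 1" using Suc by (subst card_Diff_subset) (auto intro: finite_subset)
      then obtain j where "{..<?n} - T = {j}" by (auto simp: card_1_singleton_iff)
      then have "j < ?n" "T = {..<?n} - {j}" using T(1) by auto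
      then show "T \<in> (\<lambda>j. {..<?n} - {j}) ` {..<?n}" by blast
    qed
  qed
  have "?h \<in> koszul_cycles R xs ?n \<longleftrightarrow> (\<forall>j<?n. koszul_sum R xs ?h ({..<?n} - {j}) = \<zero>)"
    unfolding koszul_cycles_iff using hc Suc basis by auto
  also have "\<dots> \<longleftrightarrow> (\<forall>j<?n. (xs ! j) \<otimes> r = \<zero>)"
  proof -
    have "koszul_sum R xs ?h ({..<?n} - {j}) = \<zero> \<longleftrightarrow> (xs ! j) \<otimes> r = \<zero>" if j: "j < ?n" for j
    proof -
      have "(xs ! j) \<otimes> r \<in> carrier R" using subsetD[OF xs nth_mem[OF j]] r by simp
      then show ?thesis unfolding sum[OF j] using koszul_sign_cancel by auto
    qed
    then show ?thesis by blast
  qed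
  also have "\<dots> \<longleftrightarrow> (\<forall>x\<in>set xs. x \<otimes> r = \<zero>)" by (simp add: all_set_conv_all_nth)
  finally show ?thesis .
qed

lemma koszul_top_boundaries: "koszul_boundaries R xs (length xs) \<subseteq> {\<zero>\<^bsub>koszul_module R xs (length xs)\<^esub>}"
  by (auto simp: koszul_boundaries_def koszul_diff_eq koszul_basis_top koszul_sum_def intro!: restrict_ext)

text \<open>Up to sign, the Koszul complex of \<open>xs @ [x]\<close> is the mapping cone of multiplication by \<open>x\<close> on
  that of \<open>xs\<close>, so \<open>H\<^sub>i(xs) / x H\<^sub>i(xs)\<close> embeds into \<open>H\<^sub>i(xs @ [x])\<close>.\<close>

lemma koszul_snoc_annihilated:
  assumes xsx: "set (xs @ [x]) \<subseteq> carrier R" and a: "a \<in> carrier R"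
    and H: "\<And>z. z \<in> koszul_cycles R (xs @ [x]) i \<Longrightarrow>
      a \<odot>\<^bsub>koszul_module R (xs @ [x]) i\<^esub> z \<in> koszul_boundaries R (xs @ [x]) i"
    and z: "z \<in> koszul_cycles R xs i"
  shows "\<exists>v\<in>koszul_cycles R xs i. a \<odot>\<^bsub>koszul_module R xs i\<^esub> z \<ominus>\<^bsub>koszul_module R xs i\<^esub>
    x \<odot>\<^bsub>koszul_module R xs i\<^esub> v \<in> koszul_boundaries R xs i"
proof -
  let ?n = "length xs"
  let ?B = "koszul_basis ?n i" and ?B' = "koszul_basis (Suc ?n) i" and ?K = "koszul_module R xs i"
  interpret K: module R ?K by (rule module_koszul_module)
  have xs: "set xs \<subseteq> carrier R" and x: "x \<in> carrier R" using xsx by auto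
  have zc: "z \<in> carrier ?K" using z by (simp add: koszul_cycles_iff)
  have zS: "z S \<in> carrier R" if "S \<in> ?B" for S using zc that by auto
  have sub: "T \<subseteq> {..<?n}" "?n \<notin> T" if "T \<in> koszul_basis ?n m" for T m
    using that by (auto simp: koszul_basis_def)
  have mono: "T \<in> koszul_basis (Suc ?n) m" if "T \<in> koszul_basis ?n m" for T m
    using that by (auto simp: koszul_basis_def)
  \<comment> \<open>\<open>z\<close> as an element of the larger complex, with coefficient zero at
    the sets containing the new index; it remains a cycle.\<close>
  define z' where "z' = (\<lambda>S\<in>?B'. if ?n \<in> S then \<zero> else z S)"
  have z'S: "z' S \<in> carrier R" if "S \<in> ?B'" for S
    using that zS koszul_basis_Suc_iff[of ?n S i] by (auto simp: z'_def)
  have z'z: "z' S = z S" if "S \<in> ?B" for S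
    using that mono[OF that] sub[OF that] by (simp add: z'_def)
  have z'0: "z' (insert ?n S) = \<zero>" if "insert ?n S \<in> ?B'" for S using that by (simp add: z'_def)
  have "z' \<in> koszul_cycles R (xs @ [x]) i"
    unfolding koszul_cycles_iff
  proof (intro conjI allI impI ballI)
    show "z' \<in> carrier (koszul_module R (xs @ [x]) i)" using z'S by (auto simp: z'_def)
    fix m T assume i: "i = Suc m" and T: "T \<in> koszul_basis (length (xs @ [x])) m"
    have ins: "insert j T \<in> ?B'" if "j \<le> ?n" "j \<notin> T" for j
      using insert_in_koszul_basis[OF T, of j "Suc ?n"] that i by simp
    show "koszul_sum R (xs @ [x]) z' T = \<zero>"
    proof (cases "?n \<in> T")
      case False
      then have T': "T \<in> koszul_basis ?n m" using T koszul_basis_Suc_iff[of ?n T m] by simp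
      have "koszul_sum R xs z' T = koszul_sum R xs z T"
        using insert_in_koszul_basis[OF T' _ _ order_refl] zS z'z i
        by (intro koszul_sum_cong[OF xs]) auto
      also have "\<dots> = \<zero>" using z T' unfolding koszul_cycles_iff i by blast
      finally show ?thesis
        using koszul_sum_snoc[OF xsx sub(1)[OF T'], of z'] z'S ins z'0[OF ins[OF order_refl False]] x
        by simp
    next
      case True
      define U where "U = T - {?n}"
      have U: "U \<subseteq> {..<?n}" "T = insert ?n U"
        using True T by (auto simp: U_def koszul_basis_def less_Suc_eq subset_iff)
      have ins': "insert ?n (insert j U) \<in> ?B'" if "j < ?n" "j \<notin> U" for j
        using ins[of j] that U by (simp add: insert_commute)
      have "koszul_sum R (xs @ [x]) z' T = koszul_sum R xs (\<lambda>S. z' (insert ?n S)) U"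
        unfolding U(2) using ins' z'S by (intro koszul_sum_snoc_insert[OF xsx U(1)]) auto
      also have "\<dots> = koszul_sum R xs (\<lambda>_. \<zero>) U"
        using ins' z'0 by (intro koszul_sum_cong[OF xs]) auto
      finally show ?thesis using koszul_sum_zero[OF xs] by simp
    qed
  qed
  from H[OF this] obtain f where f: "f \<in> carrier (koszul_module R (xs @ [x]) (Suc i))"
    and eq: "a \<odot>\<^bsub>koszul_module R (xs @ [x]) i\<^esub> z' = koszul_diff R (xs @ [x]) i f"
    by (auto simp: koszul_boundaries_def)
  have fc: "f S \<in> carrier R" if "S \<in> koszul_basis (Suc ?n) (Suc i)" for S using f that by auto
  have az': "a \<otimes> z' S = koszul_sum R (xs @ [x]) f S" if "S \<in> ?B'" for S
    using fun_cong[OF eq, of S] that by (simp add: koszul_diff_eq)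
  \<comment> \<open>The two components of \<open>f\<close> in the cone. Comparing
    \<open>a z'\<close> with the differential of \<open>f\<close> at sets containing the new index
    makes \<open>f1\<close> a cycle; at the remaining sets it gives
    \<open>a z = d f0 + (-1)^i x f1\<close>, so the required \<open>v\<close> is
    \<open>(-1)^i f1\<close>.\<close>
  define f0 where "f0 = restrict f (koszul_basis ?n (Suc i))"
  define f1 where "f1 = (\<lambda>S\<in>?B. f (insert ?n S))"
  have insn: "insert ?n S \<in> koszul_basis (Suc ?n) (Suc m)" if "S \<in> koszul_basis ?n m" for S m
    using insert_in_koszul_basis[OF that, of ?n "Suc ?n"] sub(2)[OF that] by simp
  have f0: "f0 \<in> carrier (koszul_module R xs (Suc i))" using fc mono by (auto simp: f0_def)
  have f1c: "f1 \<in> carrier ?K" using fc insn by (auto simp: f1_def)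
  have "f1 \<in> koszul_cycles R xs i"
    unfolding koszul_cycles_iff
  proof (intro conjI allI impI ballI f1c)
    fix m T assume i: "i = Suc m" and T: "T \<in> koszul_basis ?n m"
    have ins: "insert j T \<in> ?B" if "j < ?n" "j \<notin> T" for j
      using insert_in_koszul_basis[OF T that order_refl] i by simp
    have "koszul_sum R xs f1 T = koszul_sum R xs (\<lambda>S. f (insert ?n S)) T"
      using ins fc insn by (intro koszul_sum_cong[OF xs]) (auto simp: f1_def)
    also have "\<dots> = koszul_sum R (xs @ [x]) f (insert ?n T)"
      using ins fc insn by (intro koszul_sum_snoc_insert[OF xsx sub(1)[OF T], symmetric]) auto
    also have "\<dots> = \<zero>" using az'[of "insert ?n T"] z'0 insn[OF T] i a by simp
    finally show "koszul_sum R xs f1 T = \<zero>" .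
  qed
  then have v: "(\<ominus> \<one>) [^] i \<odot>\<^bsub>?K\<^esub> f1 \<in> koszul_cycles R xs i"
    using K.sub_smult[OF submodule_koszul_cycles[OF xs]] by simp
  let ?v = "(\<ominus> \<one>) [^] i \<odot>\<^bsub>?K\<^esub> f1"
  have vc: "?v \<in> carrier ?K" by (rule K.smult_closed[OF _ f1c]) simp
  have az: "a \<odot>\<^bsub>?K\<^esub> z \<in> carrier ?K" and xv: "x \<odot>\<^bsub>?K\<^esub> ?v \<in> carrier ?K"
    using K.smult_closed[OF a zc] K.smult_closed[OF x vc] .
  have "a \<odot>\<^bsub>?K\<^esub> z \<ominus>\<^bsub>?K\<^esub> x \<odot>\<^bsub>?K\<^esub> ?v = koszul_diff R xs i f0"
  proof (rule PiE_ext)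
    show "a \<odot>\<^bsub>?K\<^esub> z \<ominus>\<^bsub>?K\<^esub> x \<odot>\<^bsub>?K\<^esub> ?v \<in> ?B \<rightarrow>\<^sub>E carrier R"
      using K.M.minus_closed[OF az xv] by simp
    show "koszul_diff R xs i f0 \<in> ?B \<rightarrow>\<^sub>E carrier R" using koszul_diff_closed[OF xs f0] by simp
    fix S assume S: "S \<in> ?B"
    have card: "card S = i" using S by (simp add: koszul_basis_def)
    have ins: "insert j S \<in> koszul_basis (Suc ?n) (Suc i)" if "j \<le> ?n" "j \<notin> S" for j
      using insert_in_koszul_basis[OF S, of j "Suc ?n"] that by simp
    have fS: "koszul_sum R xs f S \<in> carrier R" using fc ins by (intro koszul_sum_closed[OF xs]) auto
    have fn: "f (insert ?n S) \<in> carrier R" using fc insn[OF S] by blast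
    have "a \<otimes> z S = koszul_sum R (xs @ [x]) f S" using az'[OF mono[OF S]] z'z[OF S] by simp
    also have "\<dots> = koszul_sum R xs f S \<oplus> (\<ominus> \<one>) [^] i \<otimes> x \<otimes> f (insert ?n S)"
      using koszul_sum_snoc[OF xsx sub(1)[OF S], of f] fc ins card by auto
    also have "(\<ominus> \<one>) [^] i \<otimes> x \<otimes> f (insert ?n S) = x \<otimes> ((\<ominus> \<one>) [^] i \<otimes> f (insert ?n S))"
      using x fn by (simp add: m_ac)
    finally have 1: "a \<otimes> z S = koszul_sum R xs f S \<oplus> x \<otimes> ((\<ominus> \<one>) [^] i \<otimes> f (insert ?n S))" .
    have "koszul_sum R xs f0 S = koszul_sum R xs f S"
      using insert_in_koszul_basis[OF S _ _ order_refl] fc ins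
      by (intro koszul_sum_cong[OF xs]) (auto simp: f0_def)
    moreover have "(a \<odot>\<^bsub>?K\<^esub> z \<ominus>\<^bsub>?K\<^esub> x \<odot>\<^bsub>?K\<^esub> ?v) S =
        a \<otimes> z S \<ominus> x \<otimes> ((\<ominus> \<one>) [^] i \<otimes> f (insert ?n S))"
      using koszul_module_minus[OF az xv S] S by (simp add: f1_def)
    ultimately show "(a \<odot>\<^bsub>?K\<^esub> z \<ominus>\<^bsub>?K\<^esub> x \<odot>\<^bsub>?K\<^esub> ?v) S = koszul_diff R xs i f0 S"
      using S fS fn x by (simp add: 1 koszul_diff_eq minus_eq a_assoc r_neg)
  qed
  then have "a \<odot>\<^bsub>?K\<^esub> z \<ominus>\<^bsub>?K\<^esub> x \<odot>\<^bsub>?K\<^esub> ?v \<in> koszul_boundaries R xs i"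
    using f0 by (auto simp: koszul_boundaries_def simp del: koszul_module_simps)
  then show ?thesis using v by blast
qed

end

text \<open>This says that \<open>P\<close> is in the support of \<open>H_i\<close>, without
  localizing. In top degree \<open>s\<close> gives a cycle with annihilator \<open>P\<close>. Below
  it, an \<open>a\<close> outside \<open>P\<close> killing \<open>H_i(ys @ [x])\<close> would give
  \<open>a H_i(ys)\<close> inside \<open>x H_i(ys)\<close> with \<open>x\<close> in
  \<open>P\<close>; by Nakayama some \<open>t\<close> outside \<open>P\<close> would then kill
  \<open>H_i(ys)\<close>, against the induction hypothesis.\<close>

lemma (in noetherian_local_ring) koszul_homology_annihilator_subset:
  assumes P: "primeideal P R" and s: "s \<in> carrier R" "P = {a \<in> carrier R. a \<otimes> s = \<zero>}"
  shows "\<lbrakk>set xs \<subseteq> P; i \<le> length xs; a \<in> carrier R;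
    \<And>z. z \<in> koszul_cycles R xs i \<Longrightarrow> a \<odot>\<^bsub>koszul_module R xs i\<^esub> z \<in> koszul_boundaries R xs i\<rbrakk>
    \<Longrightarrow> a \<in> P"
proof (induction "length xs" arbitrary: xs i a rule: less_induct)
  case less
  note H = less.prems(4)
  have Pc: "P \<subseteq> carrier R" using s(2) by blast
  have xs: "set xs \<subseteq> carrier R" using less.prems(1) Pc by blast
  show ?case
  proof (cases "i = length xs")
    case True
    let ?h = "\<lambda>S\<in>koszul_basis (length xs) (length xs). s"
    have "\<forall>x\<in>set xs. x \<otimes> s = \<zero>" using less.prems(1) s(2) by blast
    then have "?h \<in> koszul_cycles R xs (length xs)" using koszul_top_cycle_iff[OF xs s(1)] by simp
    from H[unfolded True, OF this] have
      "a \<odot>\<^bsub>koszul_module R xs (length xs)\<^esub> ?h = \<zero>\<^bsub>koszul_module R xs (length xs)\<^esub>"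
      using koszul_top_boundaries by blast
    from fun_cong[OF this, of "{..<length xs}"] have "a \<otimes> s = \<zero>" by (simp add: koszul_basis_top)
    then show ?thesis using s(2) less.prems(3) by blast
  next
    case False
    then have "xs \<noteq> []" using less.prems(2) by auto
    then obtain ys x where xs_eq: "xs = ys @ [x]" by (metis append_butlast_last_id)
    have i: "i \<le> length ys" using False less.prems(2) by (simp add: xs_eq)
    interpret K: local_noetherian_module R "koszul_module R ys i"
      by (rule local_noetherian_koszul_module)
    have ys: "set ys \<subseteq> carrier R" and x: "x \<in> P" using xs less.prems(1) by (auto simp: xs_eq)
    show ?thesis
    proof (rule ccontr)
      assume aP: "a \<notin> P"
      have "\<exists>t\<in>carrier R - P. \<forall>u\<in>koszul_cycles R ys i.
          t \<odot>\<^bsub>koszul_module R ys i\<^esub> u \<in> koszul_boundaries R ys i"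
      proof (rule K.nakayama_at_prime[OF P x submodule_koszul_cycles[OF ys]
            submodule_koszul_boundaries[OF ys] koszul_boundaries_subset_cycles[OF ys]])
        fix z assume "z \<in> koszul_cycles R ys i"
        from koszul_snoc_annihilated[OF xs[unfolded xs_eq] less.prems(3) H[unfolded xs_eq] this]
        show "\<exists>t\<in>carrier R - P. \<exists>v\<in>koszul_cycles R ys i.
            t \<odot>\<^bsub>koszul_module R ys i\<^esub> z \<ominus>\<^bsub>koszul_module R ys i\<^esub> x \<odot>\<^bsub>koszul_module R ys i\<^esub> v
              \<in> koszul_boundaries R ys i"
          using aP less.prems(3) by blast
      qed
      then obtain t where "t \<in> carrier R - P" "\<And>u. u \<in> koszul_cycles R ys i \<Longrightarrow>
          t \<odot>\<^bsub>koszul_module R ys i\<^esub> u \<in> koszul_boundaries R ys i" by blast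
      with less.hyps[of ys i t] i less.prems(1) show False by (simp add: xs_eq)
    qed
  qed
qed

section \<open>The quotient by the annihilator\<close>

text \<open>Induction along \<open>0 \<rightarrow> Z\<^sub>i \<rightarrow> K\<^sub>i \<rightarrow> K\<^sub>i/Z\<^sub>i \<rightarrow> 0\<close>,
  \<open>0 \<rightarrow> B\<^sub>i \<rightarrow> Z\<^sub>i \<rightarrow> H\<^sub>i \<rightarrow> 0\<close> and \<open>K\<^bsub>i+1\<^esub>/Z\<^bsub>i+1\<^esub> \<cong> B\<^sub>i\<close>.\<close>

lemma (in cring) wreg_koszul_mod_cycles:
  assumes ys: "set ys \<subseteq> carrier R" and xs: "set xs \<subseteq> carrier R"
    and K: "\<And>i. i \<le> length ys \<Longrightarrow> wreg (koszul_module R ys i) (carrier (koszul_module R ys i))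
      {\<zero>\<^bsub>koszul_module R ys i\<^esub>} xs"
    and H: "\<And>i. i \<le> length ys \<Longrightarrow>
      wreg (koszul_module R ys i) (koszul_cycles R ys i) (koszul_boundaries R ys i) xs"
  shows "i \<le> length ys \<Longrightarrow>
    wreg (koszul_module R ys i) (carrier (koszul_module R ys i)) (koszul_cycles R ys i) xs"
proof (induction i)
  case 0
  interpret K: module R "koszul_module R ys 0" by (rule module_koszul_module)
  show ?case using K.wreg_self[OF K.carrier_is_submodule xs] by simp
next
  case (Suc i)
  let ?K = "koszul_module R ys i" and ?L = "koszul_module R ys (Suc i)"
  let ?Z = "koszul_cycles R ys i" and ?B = "koszul_boundaries R ys i"
  interpret K: module R ?K by (rule module_koszul_module)
  interpret L: module R ?L by (rule module_koszul_module)
  note Z = submodule_koszul_cycles[OF ys] and B = submodule_koszul_boundaries[OF ys]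
  have i: "i \<le> length ys" using Suc.prems by simp
  have "wreg ?K ?Z {\<zero>\<^bsub>?K\<^esub>} xs"
    using K.wreg_restrict[OF K.carrier_is_submodule Z K.submodule_zero _ _ xs K[OF i] Suc.IH[OF i]]
      K.sub_zero[OF Z] K.sub_carrier[OF Z] by blast
  then have "wreg ?K ?B {\<zero>\<^bsub>?K\<^esub>} xs"
    using K.wreg_restrict[OF Z B K.submodule_zero _ koszul_boundaries_subset_cycles[OF ys] xs _ H[OF i]]
      K.sub_zero[OF B] by blast
  moreover have "wreg ?L (carrier ?L) (koszul_cycles R ys (Suc i)) xs \<longleftrightarrow> wreg ?K ?B {\<zero>\<^bsub>?K\<^esub>} xs"
  proof (rule L.wreg_transport[where h = "koszul_diff R ys i"])
    show "module R ?K" ..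
    show "koszul_diff R ys i f \<in> ?B" if "f \<in> carrier ?L" for f
      using that by (simp add: koszul_boundaries_def del: koszul_module_simps)
    show "koszul_diff R ys i f \<in> {\<zero>\<^bsub>?K\<^esub>} \<longleftrightarrow> f \<in> koszul_cycles R ys (Suc i)" if "f \<in> carrier ?L" for f
      using that by (simp add: a_kernel_def' del: koszul_module_simps)
    show "\<exists>f\<in>carrier ?L. g \<ominus>\<^bsub>?K\<^esub> koszul_diff R ys i f \<in> {\<zero>\<^bsub>?K\<^esub>}" if g: "g \<in> ?B" for g
    proof -
      obtain f where "f \<in> carrier ?L" "g = koszul_diff R ys i f"
        using g by (auto simp: koszul_boundaries_def simp del: koszul_module_simps)
      then show ?thesis
        using K.sub_carrier[OF B g] by (intro bexI[of _ f]) (simp_all add: K.M.minus_eq K.M.r_neg del: koszul_module_simps)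
    qed
  qed (fact L.carrier_is_submodule B Z K.submodule_zero xs koszul_diff_add[OF ys] koszul_diff_smult[OF ys])+
  ultimately show ?case by simp
qed

lemma (in cring) annihilator_genideal_iff:
  assumes ys: "set ys \<subseteq> carrier R" and r: "r \<in> carrier R"
  shows "r \<in> annihilator R (ring_module R) (Idl (set ys)) \<longleftrightarrow> (\<forall>y\<in>set ys. y \<otimes> r = \<zero>)"
proof
  interpret RM: module R "ring_module R" by (rule module_ring_module)
  assume *: "r \<in> annihilator R (ring_module R) (Idl (set ys))"
  show "\<forall>y\<in>set ys. y \<otimes> r = \<zero>"
  proof
    fix y assume y: "y \<in> set ys"
    then have "r \<otimes> y = \<zero>" using * genideal_self[OF ys] by (auto simp: annihilator_def)
    then show "y \<otimes> r = \<zero>" using m_comm[of y r] y ys r by auto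
  qed
next
  interpret RM: module R "ring_module R" by (rule module_ring_module)
  assume y: "\<forall>y\<in>set ys. y \<otimes> r = \<zero>"
  have "ideal (colon R (ring_module R) {\<zero>} r) R"
    using RM.colon_ideal[OF RM.submodule_zero] r by simp
  moreover have "set ys \<subseteq> colon R (ring_module R) {\<zero>} r" using y ys by (auto simp: colon_def)
  ultimately have "Idl (set ys) \<subseteq> colon R (ring_module R) {\<zero>} r" by (rule genideal_minimal)
  then show "r \<in> annihilator R (ring_module R) (Idl (set ys))"
    using r m_comm[OF r] by (auto simp: annihilator_def colon_def subset_iff)
qed

text \<open>The isomorphism of \<open>R\<close> with the top Koszul module, sending \<open>r\<close>
  to \<open>r\<close> times the only basis element, pulls the top cycles back to the annihilator of
  the ideal.\<close>

lemma (in cring) wreg_koszul_top: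
  assumes ys: "set ys \<subseteq> carrier R" and xs: "set xs \<subseteq> carrier R"
  shows "wreg (ring_module R) (carrier R) (annihilator R (ring_module R) (Idl (set ys))) xs \<longleftrightarrow>
    wreg (koszul_module R ys (length ys)) (carrier (koszul_module R ys (length ys)))
      (koszul_cycles R ys (length ys)) xs"
proof -
  let ?n = "length ys"
  let ?K = "koszul_module R ys ?n"
  interpret RM: module R "ring_module R" by (rule module_ring_module)
  interpret K: module R ?K by (rule module_koszul_module)
  let ?h = "\<lambda>r. \<lambda>S\<in>koszul_basis ?n ?n. r"
  have idl: "Idl (set ys) \<subseteq> carrier (ring_module R)"
    using genideal_ideal[OF ys] by (auto intro: ideal.Icarr)
  note Z = submodule_koszul_cycles[OF ys]
  show ?thesis
  proof (rule RM.wreg_transport[where h = ?h])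
    show "module R ?K" ..
    show "submodule (carrier R) R (ring_module R)" using RM.carrier_is_submodule by simp
    show "submodule (annihilator R (ring_module R) (Idl (set ys))) R (ring_module R)"
      using RM.ideal_annihilator[OF idl] by (simp add: submodule_ring_module_iff)
    show "?h r \<in> koszul_cycles R ys ?n \<longleftrightarrow> r \<in> annihilator R (ring_module R) (Idl (set ys))"
      if "r \<in> carrier R" for r
      using koszul_top_cycle_iff[OF ys that] annihilator_genideal_iff[OF ys that] by simp
    show "\<exists>r\<in>carrier R. w \<ominus>\<^bsub>?K\<^esub> ?h r \<in> koszul_cycles R ys ?n" if w: "w \<in> carrier ?K" for w
    proof (intro bexI)
      have "w = ?h (w {..<?n})"
        using w by (intro PiE_ext[of _ "koszul_basis ?n ?n" "\<lambda>_. carrier R"]) (auto simp: koszul_basis_top)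
      then have "w \<ominus>\<^bsub>?K\<^esub> ?h (w {..<?n}) = \<zero>\<^bsub>?K\<^esub>"
        using K.M.r_neg[OF w] by (simp only: K.M.minus_eq)
      then show "w \<ominus>\<^bsub>?K\<^esub> ?h (w {..<?n}) \<in> koszul_cycles R ys ?n" using K.sub_zero[OF Z] by simp
      show "w {..<?n} \<in> carrier R" using w by (auto simp: koszul_basis_top)
    qed
  qed (use K.carrier_is_submodule Z xs in \<open>auto intro!: restrict_ext\<close>)
qed

context noetherian_local_ring
begin

lemma one_noteq_zero: "\<one> \<noteq> \<zero>"
proof
  interpret m: primeideal "max_ideal R" R by (rule primeideal_max_ideal)
  assume "\<one> = \<zero>"
  then have "\<one> \<in> max_ideal R" by simp
  then show False using m.one_imp_carrier m.I_notcarr by blast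
qed

lemma fin_gen_quot_ring_module:
  assumes N: "ideal N R"
  shows "fin_gen_module R (quot_module (ring_module R) N)"
proof -
  let ?Q = "quot_module (ring_module R) N"
  interpret RM: module R "ring_module R" by (rule module_ring_module)
  have sub: "submodule N R (ring_module R)" using N by (simp add: submodule_ring_module_iff)
  interpret Q: module R ?Q by (rule RM.module_quot_module[OF sub])
  let ?g = "N +>\<^bsub>ring_module R\<^esub> \<one>"
  have g: "?g \<in> carrier ?Q" by (simp add: RM.carrier_quot_module)
  have "carrier ?Q \<subseteq> L" if L: "submodule L R ?Q" "?g \<in> L" for L
  proof
    fix w assume "w \<in> carrier ?Q"
    then obtain r where r: "r \<in> carrier R" "w = N +>\<^bsub>ring_module R\<^esub> r"
      by (auto simp: RM.carrier_quot_module)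
    then have "w = r \<odot>\<^bsub>?Q\<^esub> ?g" using RM.smult_quot_module[OF sub, of r \<one>] by simp
    then show "w \<in> L" using Q.sub_smult[OF L(1) r(1) L(2)] by simp
  qed
  then have "gen_submodule R ?Q {?g} = carrier ?Q"
    using Q.gen_submodule_least[OF Q.carrier_is_submodule, of "{?g}"] g
    by (auto simp: gen_submodule_def)
  moreover have "module R ?Q" ..
  ultimately show ?thesis unfolding fin_gen_module_def using g by (intro conjI exI[of _ "{?g}"]) auto
qed

text \<open>By \<open>ann\<close> the annihilator of \<open>H_i\<close> lies in \<open>P 0\<close>,
  so the chain survives modulo it and \<open>dim H_i\<close> is at least \<open>k\<close>.
  Cohen-Macaulayness turns this into depth.\<close>

lemma depth_ge_koszul_homology:
  assumes ys: "set ys \<subseteq> carrier R" and CM: "cohen_macaulay_module R (koszul_homology R ys i)"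
    and P: "\<And>j. j \<le> k \<Longrightarrow> primeideal (P j) R" "\<And>j. j < k \<Longrightarrow> P j \<subset> P (Suc j)"
    and ann: "\<And>a. \<lbrakk>a \<in> carrier R; \<And>z. z \<in> koszul_cycles R ys i \<Longrightarrow>
      a \<odot>\<^bsub>koszul_module R ys i\<^esub> z \<in> koszul_boundaries R ys i\<rbrakk> \<Longrightarrow> a \<in> P 0"
  shows "depth_ge R (koszul_module R ys i) k (koszul_cycles R ys i) (koszul_boundaries R ys i)"
proof -
  let ?K = "koszul_module R ys i" and ?Z = "koszul_cycles R ys i" and ?B = "koszul_boundaries R ys i"
  let ?L = "?K\<lparr>carrier := ?Z\<rparr>" and ?H = "koszul_homology R ys i"
  interpret K: module R ?K by (rule module_koszul_module)
  note Z = submodule_koszul_cycles[OF ys, of i] and B = submodule_koszul_boundaries[OF ys, of i]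
    and BZ = koszul_boundaries_subset_cycles[OF ys, of i]
  interpret L: module R ?L using submodule.submodule_is_module[OF Z] K.module_axioms by blast
  have BL: "submodule ?B R ?L" by (rule K.submodule_carrier_update[OF Z B BZ])
  have H_eq: "?H = quot_module ?L ?B" by (simp only: koszul_homology_def)
  interpret H: module R ?H unfolding H_eq by (rule L.module_quot_module[OF BL])
  have "\<exists>xs. length xs = k \<and> set xs \<subseteq> max_ideal R \<and> wreg ?H (carrier ?H) {\<zero>\<^bsub>?H\<^esub>} xs"
  proof (cases "carrier ?H = {\<zero>\<^bsub>?H\<^esub>}")
    case True
    \<comment> \<open>Every sequence is weakly regular on the zero module, so \<open>k\<close> zeros
      will do.\<close>
    have "\<zero> \<in> max_ideal R"
      using primeideal_max_ideal by (simp add: additive_subgroup.zero_closed ideal_def primeideal_def)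
    then have "set (replicate k \<zero>) \<subseteq> max_ideal R" "set (replicate k \<zero>) \<subseteq> carrier R" by auto
    then show ?thesis
      using H.wreg_self[OF H.carrier_is_submodule, of "replicate k \<zero>"] True
      by (intro exI[of _ "replicate k \<zero>"]) simp
  next
    case False
    have J: "ideal (annihilator R ?H (carrier ?H)) R" by (rule H.ideal_annihilator) simp
    have "annihilator R ?H (carrier ?H) \<subseteq> P 0"
    proof
      fix a assume "a \<in> annihilator R ?H (carrier ?H)"
      then have a: "a \<in> carrier R" "\<And>w. w \<in> carrier ?H \<Longrightarrow> a \<odot>\<^bsub>?H\<^esub> w = \<zero>\<^bsub>?H\<^esub>"
        by (auto simp: annihilator_def)
      show "a \<in> P 0"
      proof (rule ann[OF a(1)])
        fix z assume "z \<in> ?Z"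
        then have z: "z \<in> carrier ?L" by simp
        then have "?B +>\<^bsub>?L\<^esub> z \<in> carrier ?H" unfolding H_eq L.carrier_quot_module by blast
        from a(2)[OF this] have "?B +>\<^bsub>?L\<^esub> (a \<odot>\<^bsub>?L\<^esub> z) = ?B"
          unfolding H_eq L.smult_quot_module[OF BL a(1) z] L.zero_quot_module .
        then have "a \<odot>\<^bsub>?L\<^esub> z \<in> ?B" using L.rcos_eq_zero_iff[OF BL L.smult_closed[OF a(1) z]] by simp
        then show "a \<odot>\<^bsub>?K\<^esub> z \<in> ?B" by simp
      qed
    qed
    then have "enat k \<le> module_dim R ?H"
      unfolding module_dim_def
      by (intro krull_dim_quot_ge[where P = P]) (simp_all add: J P)
    also have "\<dots> = depth R ?H" using CM False by (simp add: cohen_macaulay_module_def)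
    finally show ?thesis by (rule H.depth_ge_imp_wreg)
  qed
  then obtain xs where xs: "length xs = k" "set xs \<subseteq> max_ideal R" "wreg ?H (carrier ?H) {\<zero>\<^bsub>?H\<^esub>} xs"
    by blast
  have xc: "set xs \<subseteq> carrier R" using xs(2) max_ideal_subset by blast
  have "wreg ?L (carrier ?L) ?B xs" using xs(3) L.wreg_quot_module_iff[OF BL xc] unfolding H_eq by blast
  then have "wreg ?L ?Z ?B xs" by simp
  then have "wreg ?K ?Z ?B xs" using K.wreg_carrier_update_iff[OF Z B BZ xc] by blast
  then show ?thesis using xs(1,2) unfolding depth_ge_def by blast
qed

end

lemma (in cohen_macaulay_local_ring) exists_wreg_annihilator:
  assumes ys: "set ys \<subseteq> carrier R" and CM: "\<And>i. cohen_macaulay_module R (koszul_homology R ys i)"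
    and k: "enat k \<le> krull_dim R"
  shows "\<exists>xs. length xs = k \<and> set xs \<subseteq> max_ideal R \<and>
    wreg (ring_module R) (carrier R) (annihilator R (ring_module R) (Idl (set ys))) xs"
proof -
  let ?RM = "ring_module R" and ?A = "annihilator R (ring_module R) (Idl (set ys))"
  interpret RM: local_noetherian_module R ?RM by (rule local_noetherian_ring_module)
  have zero: "submodule {\<zero>} R ?RM" using RM.submodule_zero by simp
  have carr: "submodule (carrier R) R ?RM" using RM.carrier_is_submodule by simp
  have idl: "Idl (set ys) \<subseteq> carrier ?RM" using genideal_ideal[OF ys] by (auto intro: ideal.Icarr)
  have A: "submodule ?A R ?RM" using RM.ideal_annihilator[OF idl] by (simp add: submodule_ring_module_iff)
  obtain P0 :: "nat \<Rightarrow> 'a set" where P0: "\<And>i. i \<le> k \<Longrightarrow> primeideal (P0 i) R" "\<And>i. i < k \<Longrightarrow> P0 i \<subset> P0 (Suc i)"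
    using krull_dim_ge_imp_prime_chain[OF k] by blast
  have J: "ideal (annihilator R ?RM (carrier ?RM)) R" by (rule RM.ideal_annihilator) simp
  have "annihilator R ?RM (carrier ?RM) \<subseteq> {\<zero>}" by (auto simp: annihilator_def dest: bspec[OF _ one_closed])
  moreover have "\<zero> \<in> P0 0"
    using P0(1)[of 0] by (simp add: additive_subgroup.zero_closed ideal_def primeideal_def)
  ultimately have "annihilator R ?RM (carrier ?RM) \<subseteq> P0 0" by blast
  \<comment> \<open>\<open>module_dim\<close> refers to the quotient by the annihilator, here the
    zero ideal, so the chain of \<open>R\<close> has to be moved to that quotient.\<close>
  then have "enat k \<le> module_dim R ?RM"
    unfolding module_dim_def
    by (intro krull_dim_quot_ge[where P = P0]) (simp_all add: J P0 del: ring_module_simps)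
  also have "\<dots> = depth R ?RM"
  proof -
    have "carrier ?RM \<noteq> {\<zero>\<^bsub>?RM\<^esub>}" using one_noteq_zero one_closed by auto
    then show ?thesis using cohen_macaulay by (simp add: cohen_macaulay_module_def)
  qed
  finally obtain xs0 where xs0: "length xs0 = k" "set xs0 \<subseteq> max_ideal R" "wreg ?RM (carrier R) {\<zero>} xs0"
    using RM.depth_ge_imp_wreg by fastforce
  show ?thesis
  proof (cases "?A \<subseteq> {\<zero>}")
    case True
    then have "?A = {\<zero>}" using RM.sub_zero[OF A] by auto
    then show ?thesis using xs0 by auto
  next
    case False
    then obtain w where w: "w \<in> ?A" "w \<notin> {\<zero>}" by blast
    obtain u where u: "u \<in> ?A" "primeideal (colon R ?RM {\<zero>} u) R"
      using RM.exists_maximal_colon[OF A zero w] by blast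
    have uc: "u \<in> carrier R" using u(1) by (simp add: annihilator_def)
    \<comment> \<open>The chain of length \<open>k\<close> now starts at an associated prime
      containing \<open>ys\<close>; the regular sequence on \<open>R\<close> itself makes this
      possible.\<close>
    obtain P :: "nat \<Rightarrow> 'a set" where P: "P 0 = colon R ?RM {\<zero>} u"
      "\<And>i. i \<le> k \<Longrightarrow> primeideal (P i) R" "\<And>i. i < k \<Longrightarrow> P i \<subset> P (Suc i)"
      using RM.exists_prime_chain[OF carr zero _ xs0(2,3) uc u(2)] xs0(1) by auto
    have P_eq: "P 0 = {a \<in> carrier R. a \<otimes> u = \<zero>}" by (simp add: P(1) colon_def)
    have ysP: "set ys \<subseteq> P 0"
      using annihilator_genideal_iff[OF ys uc] u(1) ys by (auto simp: P_eq)
    \<comment> \<open>The Boolean selects the whole Koszul module (\<open>True\<close>) or its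
      homology (\<open>False\<close>), so that a single sequence serves both families.\<close>
    let ?J = "{..length ys} \<times> (UNIV :: bool set)"
    let ?M = "\<lambda>(i, b :: bool). koszul_module R ys i"
    let ?S = "\<lambda>(i, b). if b then carrier (koszul_module R ys i) else koszul_cycles R ys i"
    let ?T = "\<lambda>(i, b). if b then {\<zero>\<^bsub>koszul_module R ys i\<^esub>} else koszul_boundaries R ys i"
    have "\<exists>xs. length xs = k \<and> set xs \<subseteq> max_ideal R \<and> (\<forall>j\<in>?J. wreg (?M j) (?S j) (?T j) xs)"
    proof (rule exists_common_wreg)
      fix j assume "j \<in> ?J"
      then obtain i b where j: "j = (i, b)" "i \<le> length ys" by auto
      interpret K: local_noetherian_module R "koszul_module R ys i" by (rule local_noetherian_koszul_module)
      show "local_noetherian_module R (?M j)" unfolding j by (simp add: K.local_noetherian_module_axioms)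
      show "submodule (?S j) R (?M j)"
        unfolding j using submodule_koszul_cycles[OF ys] K.carrier_is_submodule
        by (simp del: koszul_module_simps)
      show "submodule (?T j) R (?M j)"
        unfolding j using submodule_koszul_boundaries[OF ys] K.submodule_zero
        by (simp del: koszul_module_simps)
      have "depth_ge R (koszul_module R ys i) k (carrier (koszul_module R ys i)) {\<zero>\<^bsub>koszul_module R ys i\<^esub>}"
      proof -
        have "koszul_basis (length ys) i \<rightarrow>\<^sub>E {\<zero>} = {\<zero>\<^bsub>koszul_module R ys i\<^esub>}"
          by (simp add: PiE_singleton restrict_extensional_sub)
        then show ?thesis
          using wreg_koszul_module[of xs0 "{\<zero>}" ys i] xs0 max_ideal_subset
          unfolding depth_ge_def by (intro exI[of _ xs0]) auto
      qed
      moreover have "depth_ge R (koszul_module R ys i) k (koszul_cycles R ys i) (koszul_boundaries R ys i)"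
      proof (rule depth_ge_koszul_homology[OF ys CM, where P = P])
        fix a assume "a \<in> carrier R" "\<And>z. z \<in> koszul_cycles R ys i \<Longrightarrow>
          a \<odot>\<^bsub>koszul_module R ys i\<^esub> z \<in> koszul_boundaries R ys i"
        then show "a \<in> P 0"
          by (rule koszul_homology_annihilator_subset[OF P(2)[OF le0] uc P_eq ysP j(2)])
      qed (fact P)+
      ultimately show "depth_ge R (?M j) k (?S j) (?T j)"
        unfolding j by (simp del: koszul_module_simps)
    qed simp
    then obtain xs where xs: "length xs = k" "set xs \<subseteq> max_ideal R"
      "\<forall>j\<in>?J. wreg (?M j) (?S j) (?T j) xs" by blast
    have xc: "set xs \<subseteq> carrier R" using xs(2) max_ideal_subset by blast
    have "wreg (koszul_module R ys (length ys)) (carrier (koszul_module R ys (length ys)))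
        (koszul_cycles R ys (length ys)) xs"
    proof (rule wreg_koszul_mod_cycles[OF ys xc])
      fix i assume i: "i \<le> length ys"
      show "wreg (koszul_module R ys i) (carrier (koszul_module R ys i)) {\<zero>\<^bsub>koszul_module R ys i\<^esub>} xs"
        using bspec[OF xs(3), of "(i, True)"] i by (simp del: koszul_module_simps)
      show "wreg (koszul_module R ys i) (koszul_cycles R ys i) (koszul_boundaries R ys i) xs"
        using bspec[OF xs(3), of "(i, False)"] i by (simp del: koszul_module_simps)
    qed simp
    then show ?thesis using wreg_koszul_top[OF ys xc] xs(1,2) by blast
  qed
qed

theorem theorem2p7:
  fixes R :: "('a, 'b) ring_scheme" and I :: "'a set"
  assumes "cohen_macaulay_local_ring R"
    and "ideal I R"
    and "strongly_cohen_macaulay R I"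
  shows "maximal_cohen_macaulay_module R
           (quot_module (ring_module R) (annihilator R (ring_module R) I))"
proof -
  interpret cohen_macaulay_local_ring R by fact
  let ?A = "annihilator R (ring_module R) I"
  let ?Q = "quot_module (ring_module R) ?A"
  obtain ys where ys: "set ys \<subseteq> carrier R" "Idl\<^bsub>R\<^esub> (set ys) = I"
    "\<And>i. cohen_macaulay_module R (koszul_homology R ys i)"
    using assms(3) by (auto simp: strongly_cohen_macaulay_def)
  interpret RM: local_noetherian_module R "ring_module R" by (rule local_noetherian_ring_module)
  have "I \<subseteq> carrier R" using assms(2) by (auto intro: ideal.Icarr)
  then have A: "ideal ?A R" by (intro RM.ideal_annihilator) simp
  then have sA: "submodule ?A R (ring_module R)" by (simp add: submodule_ring_module_iff)
  interpret Q: local_noetherian_module R ?Q by (rule RM.local_noetherian_quot_module[OF sA])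
  have "depth R ?Q = krull_dim R" if nz: "carrier ?Q \<noteq> {\<zero>\<^bsub>?Q\<^esub>}"
  proof (rule antisym)
    show "depth R ?Q \<le> krull_dim R" by (rule Q.depth_le_krull_dim[OF nz])
    show "krull_dim R \<le> depth R ?Q"
    proof (rule enat_le_if_all_nat_le)
      fix k assume "enat k \<le> krull_dim R"
      from exists_wreg_annihilator[OF ys(1,3) this] obtain xs where
        xs: "length xs = k" "set xs \<subseteq> max_ideal R" "wreg (ring_module R) (carrier R) ?A xs"
        unfolding ys(2) by blast
      have "set xs \<subseteq> carrier R" using xs(2) max_ideal_subset by blast
      from RM.wreg_quot_module_iff[OF sA this] have "wreg ?Q (carrier ?Q) {\<zero>\<^bsub>?Q\<^esub>} xs"
        using xs(3) by simp
      from Q.wreg_imp_depth_ge[OF nz xs(2) this] show "enat k \<le> depth R ?Q" by (simp add: xs(1))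
    qed
  qed
  then show ?thesis
    using fin_gen_quot_ring_module[OF A] by (auto simp: maximal_cohen_macaulay_module_def)
qed

end
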